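(* Let $\Omega$ be a compact metric space, $T:\Omega\to\Omega$ a homeomorphism, and $\mu$ a $T$-ergodic Borel probability measure with $\operatorname{supp}\mu=\Omega$. Then $$\mathrm{DL}(\Omega,T,\mu)\subseteq\mathrm{SL}(\Omega,T,\mu)\subseteq\mathrm{JL}(\Omega,T,\mu)\subseteq\mathfrak{S}_0(\Omega,T,\mu).$$
   Context: Operators: for continuous $\mathfrak{q}:\Omega\to\mathbb{R}$ and $\mathfrak{p}:\Omega\to\mathbb{R}_{\ge0}$, the Jacobi matrices $J_\omega=J_{\mathfrak{q},\mathfrak{p},\omega}$ act on $\ell^2(\mathbb{Z})$ by $[J_\omega\psi](n)=\mathfrak{p}(T^{n-1}\omega)\psi(n-1)+\mathfrak{q}(T^n\omega)\psi(n)+\mathfrak{p}(T^n\omega)\psi(n+1)$. There is a compact set $\Sigma_{\mathfrak{q},\mathfrak{p}}\subseteq\mathbb{R}$ (the almost-sure spectrum) with $\sigma(J_{\mathfrak{q},\mathfrak{p},\omega})=\Sigma_{\mathfrak{q},\mathfrak{p}}$ for $\mu$-a.e. $\omega$. The density of states measure $\kappa$ is defined by $\int h\,d\kappa=\int_\Omega\langle\delta_0,h(J_\omega)\delta_0\rangle\,d\mu(\omega)$ for $h\in C(\mathbb{R})$, and the integrated density of states is $k_{\mathfrak{q},\mathfrak{p}}(E)=\kappa((-\infty,E])$. Schwartzman group: the suspension $(X,\tau,\nu)$ of $(\Omega,T,\mu)$ is $X=(\Omega\times\mathbb{R})/\!\sim$ with $(T^n\omega,t)\sim(\omega,t+n)$,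 $\tau^s([\omega,t])=[\omega,s+t]$, $\int_X f\,d\nu=\int_\Omega\int_0^1 f([\omega,t])\,dt\,d\mu(\omega)$. For continuous $\phi:X\to\mathbb{T}=\mathbb{R}/\mathbb{Z}$ and $x\in X$, let $\widetilde\phi_x:\mathbb{R}\to\mathbb{R}$ be a continuous lift of $t\mapsto\phi(\tau^tx)$; $\lim_{t\to\infty}\widetilde\phi_x(t)/t$ exists for $\nu$-a.e. $x$, is a.e. constant and depends only on the homotopy class of $\phi$; call the value $\mathfrak{A}_\nu(\phi)$. The Schwartzman group $\mathfrak{S}(\Omega,T,\mu)\subseteq\mathbb{R}$ is the set of all values $\mathfrak{A}_\nu(\phi)$, and $\mathfrak{S}_0(\Omega,T,\mu)=\mathfrak{S}(\Omega,T,\mu)\cap(0,1)$. Gaps: for $\ell\in\mathfrak{S}_0$, $\Sigma_{\mathfrak{q},\mathfrak{p}}$ has an open gap with label $\ell$ if there is a bounded connected component $I$ of $\mathbb{R}\setminus\Sigma_{\mathfrak{q},\mathfrak{p}}$ with $k_{\mathfrak{q},\mathfrak{p}}(E)=\ell$ for $E\in I$. $\mathrm{OG}_{\mathrm{Jacobi}}(\ell)$ is the set of $(\mathfrak{q},\mathfrak{p})\in C(\Omega,\mathbb{R})\times C(\Omega,\mathbb{R}_{\ge0})$ such that $\Sigma_{\mathfrak{q},\mathfrak{p}}$ has an open gap with label $\ell$; $\mathrm{OG}_{\mathrm{Schr}}(\ell)=\{\mathfrak{q}\in C(\Omega,\mathbb{R}):(\mathfrak{q},1)\in\mathrm{OG}_{\mathrm{Jacobi}}(\ell)\}$;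 $\mathrm{OG}_{\mathrm{diag}}(\ell)=\{\mathfrak{q}\in C(\Omega,\mathbb{R}):(\mathfrak{q},0)\in\mathrm{OG}_{\mathrm{Jacobi}}(\ell)\}$. Label sets: $\mathrm{JL}=\{\ell\in\mathfrak{S}_0:\mathrm{OG}_{\mathrm{Jacobi}}(\ell)\ne\emptyset\}$, $\mathrm{SL}=\{\ell\in\mathfrak{S}_0:\mathrm{OG}_{\mathrm{Schr}}(\ell)\ne\emptyset\}$, $\mathrm{DL}=\{\ell\in\mathfrak{S}_0:\mathrm{OG}_{\mathrm{diag}}(\ell)\ne\emptyset\}$. *)

theory Defs
  imports "HOL-Probability.Probability" "HOL-Computational_Algebra.Polynomial"
begin

section \<open>The Hilbert space of square-summable sequences\<close>

typedef ell2 = "{\<psi> :: int \<Rightarrow> complex. (\<lambda>n. (cmod (\<psi> n))\<^sup>2) summable_on UNIV}"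
  morphisms ell2_nth Abs_ell2
  by (rule exI[of _ "\<lambda>_. 0"]) simp

setup_lifting type_definition_ell2

lemma ell2_summable: "(\<lambda>n. (cmod (ell2_nth \<psi> n))\<^sup>2) summable_on UNIV"
  using ell2_nth[of \<psi>] by simp

lemma ell2_eqI: "(\<And>n. ell2_nth \<phi> n = ell2_nth \<psi> n) \<Longrightarrow> \<phi> = \<psi>"
  by (metis ell2_nth_inject ext)

lemma square_summable_add:
  fixes \<phi> \<psi> :: "int \<Rightarrow> complex"
  assumes "(\<lambda>n. (cmod (\<phi> n))\<^sup>2) summable_on UNIV" "(\<lambda>n. (cmod (\<psi> n))\<^sup>2) summable_on UNIV"
  shows "(\<lambda>n. (cmod (\<phi> n + \<psi> n))\<^sup>2) summable_on UNIV"
proof (rule summable_on_comparison_test)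
  show "(\<lambda>n. 2 * (cmod (\<phi> n))\<^sup>2 + 2 * (cmod (\<psi> n))\<^sup>2) summable_on UNIV"
    using assms by (intro summable_on_add summable_on_cmult_right)
  fix n
  have "(cmod (\<phi> n + \<psi> n))\<^sup>2 \<le> (cmod (\<phi> n) + cmod (\<psi> n))\<^sup>2"
    by (simp add: norm_triangle_ineq power_mono)
  also have "\<dots> \<le> 2 * (cmod (\<phi> n))\<^sup>2 + 2 * (cmod (\<psi> n))\<^sup>2"
    using sum_squares_bound[of "cmod (\<phi> n)" "cmod (\<psi> n)"] by (simp add: power2_sum)
  finally show "(cmod (\<phi> n + \<psi> n))\<^sup>2 \<le> 2 * (cmod (\<phi> n))\<^sup>2 + 2 * (cmod (\<psi> n))\<^sup>2" .
qed simp

lemma square_summable_bounded_mult: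
  fixes a \<psi> :: "int \<Rightarrow> complex"
  assumes "(\<lambda>n. (cmod (\<psi> n))\<^sup>2) summable_on UNIV" "\<And>n. cmod (a n) \<le> C"
  shows "(\<lambda>n. (cmod (a n * \<psi> n))\<^sup>2) summable_on UNIV"
proof (rule summable_on_comparison_test)
  show "(\<lambda>n. C\<^sup>2 * (cmod (\<psi> n))\<^sup>2) summable_on UNIV"
    using assms(1) by (intro summable_on_cmult_right)
  fix n
  show "(cmod (a n * \<psi> n))\<^sup>2 \<le> C\<^sup>2 * (cmod (\<psi> n))\<^sup>2"
    using assms(2)[of n] by (simp add: norm_mult power_mult_distrib mult_right_mono power_mono)
qed simp

lemma square_summable_shift:
  fixes \<psi> :: "int \<Rightarrow> complex"
  assumes "(\<lambda>n. (cmod (\<psi> n))\<^sup>2) summable_on UNIV"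
  shows "(\<lambda>n. (cmod (\<psi> (n + k)))\<^sup>2) summable_on UNIV"
proof -
  have "bij_betw (\<lambda>n::int. n + k) UNIV UNIV"
    by (rule bij_betw_byWitness[where f' = "\<lambda>n. n - k"]) auto
  from summable_on_reindex_bij_betw[OF this, of "\<lambda>n. (cmod (\<psi> n))\<^sup>2"] assms
  show ?thesis by simp
qed

lift_definition ell2_cscale :: "complex \<Rightarrow> ell2 \<Rightarrow> ell2" is "\<lambda>z \<psi> n. z * \<psi> n"
  by (rule square_summable_bounded_mult[where C = "cmod z" for z]) auto

definition ell2_cinner :: "ell2 \<Rightarrow> ell2 \<Rightarrow> complex" where
  "ell2_cinner \<phi> \<psi> = (\<Sum>\<^sub>\<infinity>n. cnj (ell2_nth \<phi> n) * ell2_nth \<psi> n)"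

lift_definition ell2_delta :: "int \<Rightarrow> ell2" is "\<lambda>k n. if n = k then 1 else 0"
proof -
  fix k :: int
  show "(\<lambda>n. (cmod (if n = k then 1 else 0))\<^sup>2) summable_on UNIV"
    by (rule finite_nonzero_values_imp_summable_on, rule finite_subset[of _ "{k}"])
      (auto split: if_splits)
qed

lemma ell2_inner_summable:
  "(\<lambda>n. inner (ell2_nth \<phi> n) (ell2_nth \<psi> n)) summable_on UNIV"
proof -
  have "(\<lambda>n. (cmod (ell2_nth \<phi> n))\<^sup>2 + (cmod (ell2_nth \<psi> n))\<^sup>2) summable_on UNIV"
    by (intro summable_on_add ell2_summable)
  then have "(\<lambda>n. norm (inner (ell2_nth \<phi> n) (ell2_nth \<psi> n))) summable_on UNIV"
  proof (rule Infinite_Sum.abs_summable_on_comparison_test')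
    fix n
    have "norm (inner (ell2_nth \<phi> n) (ell2_nth \<psi> n)) \<le> cmod (ell2_nth \<phi> n) * cmod (ell2_nth \<psi> n)"
      using Cauchy_Schwarz_ineq2 by simp
    also have "\<dots> \<le> (cmod (ell2_nth \<phi> n))\<^sup>2 + (cmod (ell2_nth \<psi> n))\<^sup>2"
      using sum_squares_bound[of "cmod (ell2_nth \<phi> n)" "cmod (ell2_nth \<psi> n)"]
        mult_nonneg_nonneg[OF norm_ge_zero norm_ge_zero, of "ell2_nth \<phi> n" "ell2_nth \<psi> n"]
      by linarith
    finally show "norm (inner (ell2_nth \<phi> n) (ell2_nth \<psi> n))
        \<le> (cmod (ell2_nth \<phi> n))\<^sup>2 + (cmod (ell2_nth \<psi> n))\<^sup>2" .
  qed
  then show ?thesis by (rule summable_on_iff_abs_summable_on_real[THEN iffD2])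
qed

text \<open>
  The real inner product of the library class is the real part of \<^const>\<open>ell2_cinner\<close>;
  the norm it induces is the usual one.
\<close>

instantiation ell2 :: real_inner
begin

lift_definition zero_ell2 :: ell2 is "\<lambda>_. 0" by simp
lift_definition plus_ell2 :: "ell2 \<Rightarrow> ell2 \<Rightarrow> ell2" is "\<lambda>\<phi> \<psi> n. \<phi> n + \<psi> n"
  by (rule square_summable_add)
lift_definition uminus_ell2 :: "ell2 \<Rightarrow> ell2" is "\<lambda>\<psi> n. - \<psi> n" by simp
lift_definition minus_ell2 :: "ell2 \<Rightarrow> ell2 \<Rightarrow> ell2" is "\<lambda>\<phi> \<psi> n. \<phi> n - \<psi> n"
  using square_summable_add[where \<psi> = "\<lambda>n. - \<psi> n" for \<psi>] by simp
lift_definition scaleR_ell2 :: "real \<Rightarrow> ell2 \<Rightarrow> ell2" is "\<lambda>r \<psi> n. r *\<^sub>R \<psi> n"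
  by (simp add: power_mult_distrib summable_on_cmult_right)

definition inner_ell2 :: "ell2 \<Rightarrow> ell2 \<Rightarrow> real" where
  "inner_ell2 \<phi> \<psi> = (\<Sum>\<^sub>\<infinity>n. inner (ell2_nth \<phi> n) (ell2_nth \<psi> n))"
definition norm_ell2 :: "ell2 \<Rightarrow> real" where
  "norm_ell2 \<psi> = sqrt (\<Sum>\<^sub>\<infinity>n. (cmod (ell2_nth \<psi> n))\<^sup>2)"
definition sgn_ell2 :: "ell2 \<Rightarrow> ell2" where
  "sgn_ell2 \<psi> = inverse (norm \<psi>) *\<^sub>R \<psi>"
definition dist_ell2 :: "ell2 \<Rightarrow> ell2 \<Rightarrow> real" where
  "dist_ell2 \<phi> \<psi> = norm (\<phi> - \<psi>)"
definition uniformity_ell2 :: "(ell2 \<times> ell2) filter" where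
  "uniformity_ell2 = (INF e\<in>{0<..}. principal {(\<phi>, \<psi>). dist \<phi> \<psi> < e})"
definition open_ell2 :: "ell2 set \<Rightarrow> bool" where
  "open_ell2 U \<longleftrightarrow> (\<forall>\<phi>\<in>U. eventually (\<lambda>(\<phi>', \<psi>). \<phi>' = \<phi> \<longrightarrow> \<psi> \<in> U) uniformity)"

instance
proof
  fix \<phi> \<psi> \<theta> :: ell2 and r s :: real and U :: "ell2 set"
  show "\<phi> + \<psi> + \<theta> = \<phi> + (\<psi> + \<theta>)" by transfer (simp add: add.assoc)
  show "\<phi> + \<psi> = \<psi> + \<phi>" by transfer (simp add: add.commute)
  show "0 + \<phi> = \<phi>" by transfer simp
  show "- \<phi> + \<phi> = 0" by transfer simp
  show "\<phi> - \<psi> = \<phi> + - \<psi>" by transfer simp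
  show "r *\<^sub>R (\<phi> + \<psi>) = r *\<^sub>R \<phi> + r *\<^sub>R \<psi>" by transfer (simp add: scaleR_add_right)
  show "(r + s) *\<^sub>R \<phi> = r *\<^sub>R \<phi> + s *\<^sub>R \<phi>" by transfer (simp add: scaleR_add_left)
  show "r *\<^sub>R s *\<^sub>R \<phi> = (r * s) *\<^sub>R \<phi>" by transfer simp
  show "1 *\<^sub>R \<phi> = \<phi>" by transfer simp
  show "sgn \<phi> = inverse (norm \<phi>) *\<^sub>R \<phi>" by (rule sgn_ell2_def)
  show "dist \<phi> \<psi> = norm (\<phi> - \<psi>)" by (rule dist_ell2_def)
  show "uniformity = (INF e\<in>{0<..}. principal {(\<phi> :: ell2, \<psi>). dist \<phi> \<psi> < e})"
    by (rule uniformity_ell2_def)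
  show "open U \<longleftrightarrow> (\<forall>\<phi>\<in>U. \<forall>\<^sub>F (\<phi>', \<psi>) in uniformity. \<phi>' = \<phi> \<longrightarrow> \<psi> \<in> U)"
    by (rule open_ell2_def)
  show "inner \<phi> \<psi> = inner \<psi> \<phi>"
    unfolding inner_ell2_def by (subst inner_commute) (rule refl)
  show "inner (\<phi> + \<psi>) \<theta> = inner \<phi> \<theta> + inner \<psi> \<theta>"
    unfolding inner_ell2_def plus_ell2.rep_eq inner_add_left
    by (rule infsum_add) (rule ell2_inner_summable)+
  show "inner (r *\<^sub>R \<phi>) \<psi> = r * inner \<phi> \<psi>"
    unfolding inner_ell2_def scaleR_ell2.rep_eq inner_scaleR_left
    by (rule infsum_cmult_right')
  show "0 \<le> inner \<phi> \<phi>" unfolding inner_ell2_def by (rule infsum_nonneg) simp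
  show "inner \<phi> \<phi> = 0 \<longleftrightarrow> \<phi> = 0"
  proof
    assume *: "inner \<phi> \<phi> = 0"
    show "\<phi> = 0"
    proof (rule ell2_eqI)
      fix n
      have "inner (ell2_nth \<phi> n) (ell2_nth \<phi> n) = 0"
        by (rule nonneg_infsum_le_0D[OF _ ell2_inner_summable])
          (use * in \<open>simp_all only: inner_ell2_def inner_ge_zero UNIV_I order_refl\<close>)
      then show "ell2_nth \<phi> n = ell2_nth 0 n" by (simp add: zero_ell2.rep_eq)
    qed
  qed (simp add: inner_ell2_def zero_ell2.rep_eq)
  show "norm \<phi> = sqrt (inner \<phi> \<phi>)"
    unfolding norm_ell2_def inner_ell2_def power2_norm_eq_inner ..
qed

end


section \<open>Spectrum and continuous functional calculus\<close>

text \<open>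
  Operators are functions on \<^typ>\<open>ell2\<close>.  The library notion \<^const>\<open>bounded_linear\<close> is real
  linearity, which makes no difference here: the inverse of a complex linear bijection is
  complex linear, and so is a norm limit of complex linear operators.
\<close>

definition op_spectrum :: "(ell2 \<Rightarrow> ell2) \<Rightarrow> complex set" where
  "op_spectrum A = {z. \<not> (\<exists>B. bounded_linear B
      \<and> (\<forall>\<psi>. B (A \<psi> - ell2_cscale z \<psi>) = \<psi>)
      \<and> (\<forall>\<psi>. A (B \<psi>) - ell2_cscale z (B \<psi>) = \<psi>))}"

definition poly_op :: "real poly \<Rightarrow> (ell2 \<Rightarrow> ell2) \<Rightarrow> ell2 \<Rightarrow> ell2" where
  "poly_op P A \<psi> = (\<Sum>i\<le>degree P. coeff P i *\<^sub>R (A ^^ i) \<psi>)"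

text \<open>
  For bounded self-adjoint \<open>A\<close> and continuous real \<open>h\<close>, the operator \<open>h(A)\<close> is the limit in
  operator norm of \<open>P\<^sub>n(A)\<close>, for polynomials \<open>P\<^sub>n\<close> tending to \<open>h\<close> uniformly on the spectrum.
\<close>

definition op_apply :: "(real \<Rightarrow> real) \<Rightarrow> (ell2 \<Rightarrow> ell2) \<Rightarrow> ell2 \<Rightarrow> ell2" where
  "op_apply h A = (THE B. bounded_linear B \<and>
     (\<forall>P :: nat \<Rightarrow> real poly.
        uniform_limit {x. complex_of_real x \<in> op_spectrum A} (\<lambda>n. poly (P n)) h sequentially \<longrightarrow>
        (\<lambda>n. onorm (\<lambda>\<psi>. poly_op (P n) A \<psi> - B \<psi>)) \<longlonglongrightarrow> 0))"


section \<open>Ergodic systems\<close>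

definition ergodic_prob :: "('a::topological_space \<Rightarrow> 'a) \<Rightarrow> 'a measure \<Rightarrow> bool" where
  "ergodic_prob T M \<longleftrightarrow> prob_space M \<and> sets M = sets borel \<and>
     T \<in> measurable M M \<and> distr M M T = M \<and>
     (\<forall>A\<in>sets M. T -` A = A \<longrightarrow> measure M A = 0 \<or> measure M A = 1)"

definition measure_support :: "'a::topological_space measure \<Rightarrow> 'a set" where
  "measure_support M = {x. \<forall>U. open U \<and> x \<in> U \<longrightarrow> emeasure M U > 0}"

definition iter_int :: "('a \<Rightarrow> 'a) \<Rightarrow> int \<Rightarrow> 'a \<Rightarrow> 'a" where
  "iter_int T n = (if 0 \<le> n then T ^^ nat n else inv T ^^ nat (- n))"


section \<open>Jacobi matrices and the integrated density of states\<close>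

text \<open>
  For bounded \<open>q\<close> and \<open>p\<close> the sequence below is square-summable
  (see \<open>ell2_nth_jacobi\<close>), so \<^const>\<open>Abs_ell2\<close> is applied within its domain.
\<close>

definition jacobi :: "('a \<Rightarrow> 'a) \<Rightarrow> ('a \<Rightarrow> real) \<Rightarrow> ('a \<Rightarrow> real) \<Rightarrow> 'a \<Rightarrow> ell2 \<Rightarrow> ell2" where
  "jacobi T q p \<omega> \<psi> = Abs_ell2 (\<lambda>n.
      of_real (p (iter_int T (n - 1) \<omega>)) * ell2_nth \<psi> (n - 1)
    + of_real (q (iter_int T n \<omega>)) * ell2_nth \<psi> n
    + of_real (p (iter_int T n \<omega>)) * ell2_nth \<psi> (n + 1))"

lemma ell2_nth_jacobi:
  assumes "bounded (range q)" "bounded (range p)"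
  shows "ell2_nth (jacobi T q p \<omega> \<psi>) n =
      of_real (p (iter_int T (n - 1) \<omega>)) * ell2_nth \<psi> (n - 1)
    + of_real (q (iter_int T n \<omega>)) * ell2_nth \<psi> n
    + of_real (p (iter_int T n \<omega>)) * ell2_nth \<psi> (n + 1)"
proof -
  obtain C where C: "\<And>x. \<bar>q x\<bar> \<le> C" using assms(1) by (auto simp: bounded_iff)
  obtain D where D: "\<And>x. \<bar>p x\<bar> \<le> D" using assms(2) by (auto simp: bounded_iff)
  have "(\<lambda>n. (cmod (of_real (p (iter_int T (n - 1) \<omega>)) * ell2_nth \<psi> (n - 1)
      + of_real (q (iter_int T n \<omega>)) * ell2_nth \<psi> n
      + of_real (p (iter_int T n \<omega>)) * ell2_nth \<psi> (n + 1)))\<^sup>2) summable_on UNIV"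
    using square_summable_shift[OF ell2_summable, of \<psi> "-1"]
      square_summable_shift[OF ell2_summable, of \<psi> 1] C D
    by (intro square_summable_add square_summable_bounded_mult[where C = D]
        square_summable_bounded_mult[where C = C] ell2_summable) auto
  then show ?thesis by (simp add: jacobi_def Abs_ell2_inverse)
qed

definition as_spectrum ::
  "('a \<Rightarrow> 'a) \<Rightarrow> 'a measure \<Rightarrow> ('a \<Rightarrow> real) \<Rightarrow> ('a \<Rightarrow> real) \<Rightarrow> real set" where
  "as_spectrum T M q p = (THE S. compact S \<and>
     (AE \<omega> in M. op_spectrum (jacobi T q p \<omega>) = complex_of_real ` S))"

text \<open>
  Integrability is required explicitly because the library integral of a non-integrable
  function is \<open>0\<close>; for \<open>h = 1\<close> it makes the measure finite.
\<close>

definition dos_measure ::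
  "('a \<Rightarrow> 'a) \<Rightarrow> 'a measure \<Rightarrow> ('a \<Rightarrow> real) \<Rightarrow> ('a \<Rightarrow> real) \<Rightarrow> real measure" where
  "dos_measure T M q p = (THE K. sets K = sets borel \<and>
     (\<forall>h. continuous_on UNIV h \<longrightarrow> integrable K h \<and>
        complex_of_real (\<integral>x. h x \<partial>K) =
          (\<integral>\<omega>. ell2_cinner (ell2_delta 0) (op_apply h (jacobi T q p \<omega>) (ell2_delta 0)) \<partial>M)))"

definition ids ::
  "('a \<Rightarrow> 'a) \<Rightarrow> 'a measure \<Rightarrow> ('a \<Rightarrow> real) \<Rightarrow> ('a \<Rightarrow> real) \<Rightarrow> real \<Rightarrow> real" where
  "ids T M q p E = measure (dos_measure T M q p) {..E}"


section \<open>The Schwartzman group\<close>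

definition quotient_topology :: "('b::topological_space \<times> 'b) set \<Rightarrow> 'b set topology" where
  "quotient_topology r = topology (\<lambda>U. U \<subseteq> UNIV // r \<and> open {x. r `` {x} \<in> U})"

lemma openin_quotient_topology:
  "openin (quotient_topology r) U \<longleftrightarrow> U \<subseteq> UNIV // r \<and> open {x. r `` {x} \<in> U}"
proof -
  have "istopology (\<lambda>U. U \<subseteq> UNIV // r \<and> open {x. r `` {x} \<in> U})"
    unfolding istopology_def
  proof (intro conjI allI impI)
    fix S T assume "S \<subseteq> UNIV // r \<and> open {x. r `` {x} \<in> S}" "T \<subseteq> UNIV // r \<and> open {x. r `` {x} \<in> T}"
    then show "S \<inter> T \<subseteq> UNIV // r" "open {x. r `` {x} \<in> S \<inter> T}"
      by (auto simp: Collect_conj_eq intro: open_Int)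
  next
    fix \<K> assume *: "\<forall>K\<in>\<K>. K \<subseteq> UNIV // r \<and> open {x. r `` {x} \<in> K}"
    have "{x. r `` {x} \<in> \<Union>\<K>} = (\<Union>K\<in>\<K>. {x. r `` {x} \<in> K})" by auto
    then show "open {x. r `` {x} \<in> \<Union>\<K>}" using * by auto
    show "\<Union>\<K> \<subseteq> UNIV // r" using * by auto
  qed
  then show ?thesis by (simp add: quotient_topology_def)
qed

lemma topspace_quotient_topology: "topspace (quotient_topology r) = UNIV // r"
proof
  show "topspace (quotient_topology r) \<subseteq> UNIV // r"
    using openin_quotient_topology[of r] openin_topspace by blast
  have "{x. r `` {x} \<in> UNIV // r} = UNIV"
    by (auto intro: quotientI)
  then have "openin (quotient_topology r) (UNIV // r)"
    by (simp only: openin_quotient_topology open_UNIV subset_refl simp_thms)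
  then show "UNIV // r \<subseteq> topspace (quotient_topology r)"
    by (rule openin_subset)
qed

lemma quotient_map_quotient_topology:
  "quotient_map euclidean (quotient_topology r) (\<lambda>x. r `` {x})"
  unfolding quotient_map_def topspace_quotient_topology openin_quotient_topology
  by (simp add: quotient_def image_def) blast

definition circle_rel :: "(real \<times> real) set" where
  "circle_rel = {(s, t). s - t \<in> \<int>}"

definition susp_rel :: "('a \<Rightarrow> 'a) \<Rightarrow> (('a \<times> real) \<times> ('a \<times> real)) set" where
  "susp_rel T = {((iter_int T n \<omega>, t), (\<omega>, t + of_int n)) | n \<omega> t. True}"

abbreviation susp_class :: "('a \<Rightarrow> 'a) \<Rightarrow> 'a \<times> real \<Rightarrow> ('a \<times> real) set" where
  "susp_class T y \<equiv> susp_rel T `` {y}"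

abbreviation circle :: "real set topology" where
  "circle \<equiv> quotient_topology circle_rel"

abbreviation suspension :: "('a::topological_space \<Rightarrow> 'a) \<Rightarrow> ('a \<times> real) set topology" where
  "suspension T \<equiv> quotient_topology (susp_rel T)"

definition susp_flow :: "('a \<Rightarrow> 'a) \<Rightarrow> real \<Rightarrow> ('a \<times> real) set \<Rightarrow> ('a \<times> real) set" where
  "susp_flow T s x = (\<Union>(\<omega>, t)\<in>x. susp_class T (\<omega>, s + t))"

text \<open>
  This is the measure with \<open>\<integral> f d\<nu> = \<integral> \<integral>\<^sub>0\<^sup>1 f([\<omega>, t]) dt d\<mu>(\<omega>)\<close>, on the Borel sets of the suspension.
\<close>

definition susp_measure ::
  "('a::topological_space \<Rightarrow> 'a) \<Rightarrow> 'a measure \<Rightarrow> ('a \<times> real) set measure" where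
  "susp_measure T M = distr (M \<Otimes>\<^sub>M restrict_space lborel {0..1})
     (sigma (topspace (suspension T)) {U. openin (suspension T) U}) (susp_class T)"

definition is_orbit_lift ::
  "('a \<Rightarrow> 'a) \<Rightarrow> (('a \<times> real) set \<Rightarrow> real set) \<Rightarrow> ('a \<times> real) set \<Rightarrow> (real \<Rightarrow> real) \<Rightarrow> bool" where
  "is_orbit_lift T \<phi> x f \<longleftrightarrow> continuous_on UNIV f \<and>
     (\<forall>t. circle_rel `` {f t} = \<phi> (susp_flow T t x))"

definition asymptotic_winding ::
  "('a::topological_space \<Rightarrow> 'a) \<Rightarrow> 'a measure \<Rightarrow> (('a \<times> real) set \<Rightarrow> real set) \<Rightarrow> real" where
  "asymptotic_winding T M \<phi> = (THE a. AE x in susp_measure T M.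
     \<exists>f. is_orbit_lift T \<phi> x f \<and> ((\<lambda>t. f t / t) \<longlongrightarrow> a) at_top)"

definition schwartzman_group :: "('a::topological_space \<Rightarrow> 'a) \<Rightarrow> 'a measure \<Rightarrow> real set" where
  "schwartzman_group T M =
     {asymptotic_winding T M \<phi> | \<phi>. continuous_map (suspension T) circle \<phi>}"

definition schwartzman_group0 :: "('a::topological_space \<Rightarrow> 'a) \<Rightarrow> 'a measure \<Rightarrow> real set" where
  "schwartzman_group0 T M = schwartzman_group T M \<inter> {0<..<1}"


section \<open>Gap labels\<close>

definition has_open_gap ::
  "('a \<Rightarrow> 'a) \<Rightarrow> 'a measure \<Rightarrow> ('a \<Rightarrow> real) \<Rightarrow> ('a \<Rightarrow> real) \<Rightarrow> real \<Rightarrow> bool" where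
  "has_open_gap T M q p l \<longleftrightarrow>
     (\<exists>I\<in>components (- as_spectrum T M q p). bounded I \<and> (\<forall>E\<in>I. ids T M q p E = l))"

definition OG_Jacobi ::
  "('a::topological_space \<Rightarrow> 'a) \<Rightarrow> 'a measure \<Rightarrow> real \<Rightarrow> (('a \<Rightarrow> real) \<times> ('a \<Rightarrow> real)) set" where
  "OG_Jacobi T M l = {(q, p). continuous_on UNIV q \<and> continuous_on UNIV p \<and> (\<forall>\<omega>. 0 \<le> p \<omega>) \<and>
     has_open_gap T M q p l}"

definition OG_Schr ::
  "('a::topological_space \<Rightarrow> 'a) \<Rightarrow> 'a measure \<Rightarrow> real \<Rightarrow> ('a \<Rightarrow> real) set" where
  "OG_Schr T M l = {q. continuous_on UNIV q \<and> (q, \<lambda>_. 1) \<in> OG_Jacobi T M l}"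

definition OG_diag ::
  "('a::topological_space \<Rightarrow> 'a) \<Rightarrow> 'a measure \<Rightarrow> real \<Rightarrow> ('a \<Rightarrow> real) set" where
  "OG_diag T M l = {q. continuous_on UNIV q \<and> (q, \<lambda>_. 0) \<in> OG_Jacobi T M l}"

definition JL :: "('a::topological_space \<Rightarrow> 'a) \<Rightarrow> 'a measure \<Rightarrow> real set" where
  "JL T M = {l \<in> schwartzman_group0 T M. OG_Jacobi T M l \<noteq> {}}"

definition SL :: "('a::topological_space \<Rightarrow> 'a) \<Rightarrow> 'a measure \<Rightarrow> real set" where
  "SL T M = {l \<in> schwartzman_group0 T M. OG_Schr T M l \<noteq> {}}"

definition DL :: "('a::topological_space \<Rightarrow> 'a) \<Rightarrow> 'a measure \<Rightarrow> real set" where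
  "DL T M = {l \<in> schwartzman_group0 T M. OG_diag T M l \<noteq> {}}"

end

theory Submission
  imports Defs "HOL-Computational_Algebra.Fundamental_Theorem_Algebra"
begin

text \<open>
  The second and third inclusions hold by definition, so everything is about the first: a gap
  label of a diagonal operator is a gap label of a Schroedinger operator.

  Let the diagonal operator with potential \<open>q\<close> have a gap around \<open>E\<close> with label \<open>l\<close>.  Its spectrum
  contains the range of \<open>q\<close> and its density of states measure is the distribution of \<open>q\<close>, so \<open>q\<close>
  stays at some distance \<open>\<delta>\<close> from \<open>E\<close> and \<open>l\<close> is the measure of \<open>{q \<le> E}\<close>.  Replace \<open>q\<close> by \<open>c q\<close>
  with \<open>c = 4 / \<delta>\<close>.  The hopping term has norm at most \<open>2\<close>, so while it is switched on along
  \<open>c q + t \<Delta>\<close>, \<open>0 \<le> t \<le> 1\<close>, no spectrum enters a fixed interval \<open>(a, b)\<close> around \<open>c E\<close>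
  (\<open>notin_real_spectrum\<close>).

  The integrated density of states in this interval does not depend on \<open>t\<close>
  (\<open>gap_integral_invariant\<close>).  It is the value at \<open>h(J\<^sub>t)\<close> of the trace per unit volume
  \<open>\<tau>(X) = \<integral> \<langle>\<delta>\<^sub>0, X\<^sub>\<omega> \<delta>\<^sub>0\<rangle> d\<mu>\<close>, where \<open>h\<close> is \<open>1\<close> to the left of the interval and \<open>0\<close> to the right of it.
  For a polynomial \<open>R\<close>, cyclicity of \<open>\<tau>\<close> gives \<open>d/dt \<tau>(R(J\<^sub>t)) = \<tau>(R'(J\<^sub>t) \<Delta>)\<close>
  (\<open>trace_poly_has_derivative\<close>).  On the complement of the interval a polynomial can be close to
  \<open>h\<close> with its derivative close to \<open>h' = 0\<close> (\<open>gap_polynomial\<close>), which makes the derivative in \<open>t\<close>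
  arbitrarily small.  Hence the Schroedinger operator with potential \<open>c q\<close> has the value \<open>l\<close> of its
  integrated density of states in \<open>(a, b)\<close>; since \<open>0 < l < 1\<close>, there is spectrum on both sides, and
  the component of the complement of the spectrum is bounded (\<open>has_open_gapI\<close>).

  The almost-sure spectrum, the functional calculus and the density of states measure are
  introduced by descriptions, so that their existence and uniqueness are part of the proof.
  They rest on three facts.  For a symmetric operator, a real number lies outside the spectrum
  exactly if the shifted operator is bounded below; from this the norm of a polynomial of the
  operator is bounded by the maximum of the polynomial on the spectrum
  (\<open>onorm_poly_op_attained\<close>).  Almost every orbit is dense, and lower bounds survive strong limits,
  so almost all spectra agree (\<open>as_spectrum_props\<close>).  A normalised functional bounded by the
  supremum over an interval is integration against a probability measure (\<open>riesz_interval\<close>).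
\<close>

section \<open>Square-summable sequences as a Hilbert space\<close>

lemma norm_ell2_power2: "(norm \<psi>)\<^sup>2 = (\<Sum>\<^sub>\<infinity>n. (cmod (ell2_nth \<psi> n))\<^sup>2)"
  unfolding norm_ell2_def by (simp add: infsum_nonneg)

lemma finite_sum_le_norm_ell2:
  assumes "finite F"
  shows "(\<Sum>n\<in>F. (cmod (ell2_nth \<psi> n))\<^sup>2) \<le> (norm \<psi>)\<^sup>2"
  unfolding norm_ell2_power2
  by (rule finite_sum_le_infsum[OF ell2_summable assms]) auto

lemma cmod_ell2_nth_le: "cmod (ell2_nth \<psi> n) \<le> norm \<psi>"
  using finite_sum_le_norm_ell2[of "{n}" \<psi>] by (simp add: power2_le_iff_abs_le)

lemma ell2_norm_leI:
  assumes "\<And>F. finite F \<Longrightarrow> (\<Sum>n\<in>F. (cmod (f n))\<^sup>2) \<le> C\<^sup>2" "0 \<le> C"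
  shows "(\<lambda>n. (cmod (f n))\<^sup>2) summable_on UNIV" "norm (Abs_ell2 f) \<le> C"
proof -
  show s: "(\<lambda>n. (cmod (f n))\<^sup>2) summable_on UNIV"
    by (rule nonneg_bdd_above_summable_on) (auto intro!: bdd_aboveI2[where M = "C\<^sup>2"] assms)
  have "(norm (Abs_ell2 f))\<^sup>2 \<le> C\<^sup>2"
    unfolding norm_ell2_power2 using s
    by (simp add: Abs_ell2_inverse) (rule infsum_le_finite_sums[OF s], auto intro: assms)
  then show "norm (Abs_ell2 f) \<le> C"
    using assms(2) power2_le_imp_le by blast
qed

lemma ell2_nth_simps [simp]:
  "ell2_nth 0 n = 0" "ell2_nth (\<phi> + \<psi>) n = ell2_nth \<phi> n + ell2_nth \<psi> n"
  "ell2_nth (- \<psi>) n = - ell2_nth \<psi> n" "ell2_nth (\<phi> - \<psi>) n = ell2_nth \<phi> n - ell2_nth \<psi> n"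
  "ell2_nth (r *\<^sub>R \<psi>) n = r *\<^sub>R ell2_nth \<psi> n" "ell2_nth (ell2_cscale z \<psi>) n = z * ell2_nth \<psi> n"
  "ell2_nth (ell2_delta k) n = (if n = k then 1 else 0)"
  by (simp_all add: zero_ell2.rep_eq plus_ell2.rep_eq uminus_ell2.rep_eq minus_ell2.rep_eq
      scaleR_ell2.rep_eq ell2_cscale.rep_eq ell2_delta.rep_eq)

lemma bounded_linear_ell2_nth: "bounded_linear (\<lambda>\<psi>. ell2_nth \<psi> n)"
  by (rule bounded_linear_intro[where K = 1]) (auto simp: cmod_ell2_nth_le)

text \<open>
  Completeness is what turns lower bounds into inverses, by the contraction principle, and what
  makes operator norm limits available.  The pointwise limit of a Cauchy sequence is a limit in
  norm because the Cauchy estimate holds on every finite set of coordinates.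
\<close>

instance ell2 :: banach
proof
  fix X :: "nat \<Rightarrow> ell2"
  assume C: "Cauchy X"
  have "Cauchy (\<lambda>k. ell2_nth (X k) n)" for n
    by (rule bounded_linear.Cauchy[OF bounded_linear_ell2_nth C])
  then have f: "(\<lambda>k. ell2_nth (X k) n) \<longlonglongrightarrow> lim (\<lambda>k. ell2_nth (X k) n)" for n
    by (simp add: Cauchy_convergent_iff convergent_LIMSEQ_iff)
  define f where "f n = lim (\<lambda>k. ell2_nth (X k) n)" for n
  note f = f[folded f_def]
  have bd: "(\<Sum>n\<in>F. (cmod (f n - ell2_nth (X k) n))\<^sup>2) \<le> e\<^sup>2"
    if e: "\<And>j. j \<ge> N \<Longrightarrow> norm (X j - X k) \<le> e" and F: "finite F" for e k N F
  proof (rule tendsto_upperbound)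
    show "(\<lambda>j. \<Sum>n\<in>F. (cmod (ell2_nth (X j) n - ell2_nth (X k) n))\<^sup>2)
        \<longlonglongrightarrow> (\<Sum>n\<in>F. (cmod (f n - ell2_nth (X k) n))\<^sup>2)"
      by (intro tendsto_intros f)
    have "(\<Sum>n\<in>F. (cmod (ell2_nth (X j) n - ell2_nth (X k) n))\<^sup>2) \<le> e\<^sup>2" if "j \<ge> N" for j
    proof -
      have "(\<Sum>n\<in>F. (cmod (ell2_nth (X j - X k) n))\<^sup>2) \<le> (norm (X j - X k))\<^sup>2"
        by (rule finite_sum_le_norm_ell2[OF F])
      also have "\<dots> \<le> e\<^sup>2" by (rule power_mono[OF e[OF that]]) simp
      finally show ?thesis by simp
    qed
    then show "\<forall>\<^sub>F j in sequentially.
        (\<Sum>n\<in>F. (cmod (ell2_nth (X j) n - ell2_nth (X k) n))\<^sup>2) \<le> e\<^sup>2"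
      by (auto simp: eventually_sequentially)
  qed simp
  have lim: "\<exists>N. \<forall>k\<ge>N. (\<lambda>n. (cmod (f n - ell2_nth (X k) n))\<^sup>2) summable_on UNIV
       \<and> norm (Abs_ell2 (\<lambda>n. f n - ell2_nth (X k) n)) \<le> e" if "e > 0" for e :: real
  proof -
    obtain N where N: "\<And>j k. j \<ge> N \<Longrightarrow> k \<ge> N \<Longrightarrow> norm (X j - X k) < e"
      using CauchyD[OF C \<open>e > 0\<close>] by blast
    have b: "(\<Sum>n\<in>F. (cmod (f n - ell2_nth (X k) n))\<^sup>2) \<le> e\<^sup>2" if "k \<ge> N" "finite F" for k F
      by (rule bd[of N]) (use N that in \<open>auto intro: less_imp_le\<close>)
    show ?thesis
      using ell2_norm_leI[OF b] \<open>e > 0\<close> by (intro exI[of _ N]) auto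
  qed
  obtain N where N: "(\<lambda>n. (cmod (f n - ell2_nth (X N) n))\<^sup>2) summable_on UNIV"
    using lim[of 1] by auto
  have "(\<lambda>n. (cmod (f n))\<^sup>2) summable_on UNIV"
    using square_summable_add[OF N ell2_summable[of "X N"]] by simp
  then have nth: "ell2_nth (Abs_ell2 f) = f" by (simp add: Abs_ell2_inverse)
  have eq: "Abs_ell2 (\<lambda>n. f n - ell2_nth (X k) n) = Abs_ell2 f - X k" for k
    by (subst ell2_nth_inverse[symmetric]) (simp only: minus_ell2.rep_eq nth)
  have "X \<longlonglongrightarrow> Abs_ell2 f"
  proof (rule LIMSEQ_I)
    fix r :: real assume "r > 0"
    then obtain N where "\<forall>k\<ge>N. norm (Abs_ell2 f - X k) \<le> r / 2"
      using lim[of "r/2"] by (auto simp: eq)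
    then show "\<exists>N. \<forall>k\<ge>N. norm (X k - Abs_ell2 f) < r"
      using \<open>r > 0\<close> by (intro exI[of _ N]) (force simp: norm_minus_commute)
  qed
  then show "convergent X" by (rule convergentI)
qed

lemma norm_ell2_delta: "norm (ell2_delta k) = 1"
proof -
  have "(norm (ell2_delta k))\<^sup>2 = (\<Sum>\<^sub>\<infinity>n. if n = k then 1 else 0)"
    unfolding norm_ell2_power2 by (rule infsum_cong) simp
  also have "\<dots> = (\<Sum>\<^sub>\<infinity>n\<in>{k}. 1)"
    by (rule infsum_cong_neutral) auto
  finally show ?thesis using norm_ge_zero[of "ell2_delta k"] by (auto simp: power2_eq_1_iff simp del: norm_ge_zero)
qed

lemma ell2_delta_neq_0: "ell2_delta k \<noteq> 0"
  using norm_ell2_delta[of k] by auto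

lemma ell2_cinner_delta: "ell2_cinner (ell2_delta k) \<psi> = ell2_nth \<psi> k"
proof -
  have "ell2_cinner (ell2_delta k) \<psi> = (\<Sum>\<^sub>\<infinity>n\<in>{k}. ell2_nth \<psi> n)"
    unfolding ell2_cinner_def by (rule infsum_cong_neutral) auto
  then show ?thesis by simp
qed

lemma norm_ell2_cscale: "norm (ell2_cscale z \<psi>) = cmod z * norm \<psi>"
proof -
  have "(norm (ell2_cscale z \<psi>))\<^sup>2 = (cmod z * norm \<psi>)\<^sup>2"
    unfolding power_mult_distrib norm_ell2_power2
    by (simp add: norm_mult power_mult_distrib infsum_cmult_right')
  then show ?thesis by (simp add: power2_eq_iff_nonneg)
qed

lemma ell2_cscale_of_real: "ell2_cscale (of_real r) \<psi> = r *\<^sub>R \<psi>"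
  by (rule ell2_eqI) (simp add: scaleR_conv_of_real)

lemma bounded_linear_ell2_cscale: "bounded_linear (ell2_cscale z)"
  by (rule bounded_linear_intro[where K = "cmod z"])
    (auto intro!: ell2_eqI simp: norm_ell2_cscale algebra_simps)

lemma inner_ell2_cscale: "inner (ell2_cscale z \<phi>) \<psi> = inner \<phi> (ell2_cscale (cnj z) \<psi>)"
  unfolding inner_ell2_def by (rule infsum_cong) (simp add: inner_complex_def algebra_simps)

subsection \<open>Weighted shifts\<close>

text \<open>
  Jacobi matrices, their diagonal parts, the translation and the truncations are all built from
  these operators, so that bounds and adjoints need only be computed once.
\<close>

definition weighted_shift :: "(int \<Rightarrow> real) \<Rightarrow> int \<Rightarrow> ell2 \<Rightarrow> ell2" where
  "weighted_shift a k \<psi> = Abs_ell2 (\<lambda>n. of_real (a n) * ell2_nth \<psi> (n + k))"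

context
  fixes a :: "int \<Rightarrow> real" and C :: real
  assumes a: "\<And>n. \<bar>a n\<bar> \<le> C"
begin

lemma ell2_nth_weighted_shift:
  "ell2_nth (weighted_shift a k \<psi>) n = of_real (a n) * ell2_nth \<psi> (n + k)"
proof -
  have "(\<lambda>n. (cmod (of_real (a n) * ell2_nth \<psi> (n + k)))\<^sup>2) summable_on UNIV"
    by (rule square_summable_bounded_mult[OF square_summable_shift[OF ell2_summable], of _ C])
      (simp add: a)
  then show ?thesis by (simp add: weighted_shift_def Abs_ell2_inverse)
qed

lemma norm_weighted_shift_le: "norm (weighted_shift a k \<psi>) \<le> C * norm \<psi>"
proof -
  have C0: "0 \<le> C" using a[of 0] by linarith
  show ?thesis unfolding weighted_shift_def
  proof (rule ell2_norm_leI(2))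
    fix F :: "int set" assume F: "finite F"
    have "(\<Sum>n\<in>F. (cmod (of_real (a n) * ell2_nth \<psi> (n + k)))\<^sup>2)
        \<le> (\<Sum>n\<in>F. C\<^sup>2 * (cmod (ell2_nth \<psi> (n + k)))\<^sup>2)"
      using a by (intro sum_mono)
        (auto simp: norm_mult power_mult_distrib intro!: mult_right_mono abs_le_square_iff[THEN iffD1] order_trans[OF a])
    also have "\<dots> = C\<^sup>2 * (\<Sum>n\<in>(\<lambda>n. n + k) ` F. (cmod (ell2_nth \<psi> n))\<^sup>2)"
      by (subst sum.reindex) (auto simp: sum_distrib_left)
    also have "\<dots> \<le> C\<^sup>2 * (norm \<psi>)\<^sup>2"
      by (intro mult_left_mono finite_sum_le_norm_ell2) (use F in auto)
    finally show "(\<Sum>n\<in>F. (cmod (of_real (a n) * ell2_nth \<psi> (n + k)))\<^sup>2) \<le> (C * norm \<psi>)\<^sup>2"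
      by (simp add: power_mult_distrib)
  qed (use C0 in simp)
qed

lemma bounded_linear_weighted_shift: "bounded_linear (weighted_shift a k)"
  by (rule bounded_linear_intro[where K = C])
    (auto intro!: ell2_eqI norm_weighted_shift_le[THEN order_trans] simp: ell2_nth_weighted_shift algebra_simps)

end

lemma weighted_shift_adjoint:
  assumes a: "\<And>n. \<bar>a n\<bar> \<le> C"
  shows "inner (weighted_shift a k \<phi>) \<psi> = inner \<phi> (weighted_shift (\<lambda>n. a (n - k)) (- k) \<psi>)"
proof -
  have a': "\<bar>a (n - k)\<bar> \<le> C" for n by (rule a)
  have b: "bij_betw (\<lambda>n::int. n + k) UNIV UNIV"
    by (rule bij_betw_byWitness[where f' = "\<lambda>n. n - k"]) auto
  have "inner \<phi> (weighted_shift (\<lambda>n. a (n - k)) (- k) \<psi>)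
      = (\<Sum>\<^sub>\<infinity>n. inner (ell2_nth \<phi> (n + k)) (of_real (a n) * ell2_nth \<psi> n))"
    unfolding inner_ell2_def ell2_nth_weighted_shift[OF a']
    by (subst infsum_reindex_bij_betw[OF b, symmetric]) simp
  also have "\<dots> = inner (weighted_shift a k \<phi>) \<psi>"
    unfolding inner_ell2_def ell2_nth_weighted_shift[OF a]
    by (rule infsum_cong) (simp add: inner_complex_def algebra_simps)
  finally show ?thesis ..
qed

definition ell2_shift :: "ell2 \<Rightarrow> ell2" where
  "ell2_shift = weighted_shift (\<lambda>_. 1) 1"

lemma ell2_nth_shift [simp]: "ell2_nth (ell2_shift \<psi>) n = ell2_nth \<psi> (n + 1)"
  by (simp add: ell2_shift_def ell2_nth_weighted_shift[where C = 1])

lemma norm_ell2_shift [simp]: "norm (ell2_shift \<psi>) = norm \<psi>"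
proof -
  have "ell2_nth (weighted_shift (\<lambda>_. 1) (- 1) (ell2_shift \<psi>)) n = ell2_nth \<psi> n" for n
    by (simp add: ell2_nth_weighted_shift[where C = 1])
  then have "weighted_shift (\<lambda>_. 1) (- 1) (ell2_shift \<psi>) = \<psi>"
    by (rule ell2_eqI)
  then show ?thesis
    using norm_weighted_shift_le[of "\<lambda>_. 1" 1 1 \<psi>]
      norm_weighted_shift_le[of "\<lambda>_. 1" 1 "- 1" "ell2_shift \<psi>"]
    by (simp add: ell2_shift_def)
qed

lemma bounded_linear_ell2_shift: "bounded_linear ell2_shift"
  unfolding ell2_shift_def by (rule bounded_linear_weighted_shift[where C = 1]) simp

lemma ell2_shift_delta: "ell2_shift (ell2_delta k) = ell2_delta (k - 1)"
  by (rule ell2_eqI) auto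

lemma surj_ell2_shift: "surj ell2_shift"
proof (rule surjI)
  fix \<psi> show "ell2_shift (weighted_shift (\<lambda>_. 1) (- 1) \<psi>) = \<psi>"
    by (rule ell2_eqI) (simp add: ell2_nth_weighted_shift[where C = 1])
qed

subsection \<open>Truncation\<close>

definition ell2_cut :: "nat \<Rightarrow> ell2 \<Rightarrow> ell2" where
  "ell2_cut N = weighted_shift (indicator {- int N..int N}) 0"

lemma ell2_nth_cut: "ell2_nth (ell2_cut N \<psi>) n = (if \<bar>n\<bar> \<le> int N then ell2_nth \<psi> n else 0)"
  unfolding ell2_cut_def by (subst ell2_nth_weighted_shift[where C = 1]) (auto simp: indicator_def)

text \<open>
  The squared distance is the sum over the complement of an interval, hence a tail of a
  convergent sum.
\<close>

lemma ell2_cut_tendsto: "(\<lambda>N. ell2_cut N \<psi>) \<longlonglongrightarrow> \<psi>"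
proof (rule LIMSEQ_I)
  fix r :: real assume r: "r > 0"
  define g where "g n = (cmod (ell2_nth \<psi> n))\<^sup>2" for n
  have s: "g summable_on UNIV" unfolding g_def by (rule ell2_summable)
  have "(sum g \<longlongrightarrow> infsum g UNIV) (finite_subsets_at_top UNIV)"
    by (rule infsum_tendsto[OF s])
  then have "\<forall>\<^sub>F F in finite_subsets_at_top UNIV. dist (sum g F) (infsum g UNIV) < r\<^sup>2"
    using r by (simp add: tendsto_iff)
  then obtain F where F: "finite F" and
    *: "\<And>G. finite G \<Longrightarrow> F \<subseteq> G \<Longrightarrow> dist (sum g G) (infsum g UNIV) < r\<^sup>2"
    by (auto simp: eventually_finite_subsets_at_top)
  obtain N where N: "\<And>n. n \<in> F \<Longrightarrow> \<bar>n\<bar> \<le> int N"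
  proof
    fix n assume "n \<in> F"
    have "nat \<bar>n\<bar> \<le> Max (insert 0 ((\<lambda>n. nat \<bar>n\<bar>) ` F))"
      using F \<open>n \<in> F\<close> by (intro Max_ge) auto
    then show "\<bar>n\<bar> \<le> int (Max (insert 0 ((\<lambda>n. nat \<bar>n\<bar>) ` F)))" by linarith
  qed
  have "norm (ell2_cut M \<psi> - \<psi>) < r" if "M \<ge> N" for M
  proof -
    let ?G = "{- int M..int M}"
    have "F \<subseteq> ?G" using N that by fastforce
    then have d: "dist (sum g ?G) (infsum g UNIV) < r\<^sup>2" by (intro *) auto
    have "(norm (ell2_cut M \<psi> - \<psi>))\<^sup>2 = (\<Sum>\<^sub>\<infinity>n\<in>UNIV. if n \<in> ?G then 0 else g n)"
      unfolding norm_ell2_power2 by (rule infsum_cong) (auto simp: ell2_nth_cut g_def)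
    also have "\<dots> = infsum g (UNIV - ?G)"
      by (rule infsum_cong_neutral) auto
    also have "\<dots> = infsum g UNIV - sum g ?G"
      by (subst infsum_Diff) (auto intro: s summable_on_finite)
    also have "\<dots> < r\<^sup>2" using d by (simp add: dist_real_def)
    finally show ?thesis using r power2_less_imp_less less_imp_le by blast
  qed
  then show "\<exists>N. \<forall>M\<ge>N. norm (ell2_cut M \<psi> - \<psi>) < r" by blast
qed



section \<open>Spectra of symmetric operators\<close>

definition bounded_below :: "(ell2 \<Rightarrow> ell2) \<Rightarrow> bool" where
  "bounded_below S \<longleftrightarrow> (\<exists>c>0. \<forall>\<psi>. c * norm \<psi> \<le> norm (S \<psi>))"

lemma power2_norm_diff: "(norm (x - y))\<^sup>2 = (norm x)\<^sup>2 - 2 * inner x y + (norm y)\<^sup>2"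
  for x y :: "'b::real_inner"
  by (simp add: power2_norm_eq_inner inner_diff_left inner_diff_right inner_commute)

lemma bounded_below_comp:
  assumes "bounded_below S" "bounded_below S'"
  shows "bounded_below (\<lambda>\<psi>. S (S' \<psi>))"
proof -
  obtain c where c: "c > 0" "\<And>\<psi>. c * norm \<psi> \<le> norm (S \<psi>)"
    using assms(1) by (auto simp: bounded_below_def)
  obtain c' where c': "c' > 0" "\<And>\<psi>. c' * norm \<psi> \<le> norm (S' \<psi>)"
    using assms(2) by (auto simp: bounded_below_def)
  have "(c * c') * norm \<psi> \<le> norm (S (S' \<psi>))" for \<psi>
  proof -
    have "c * (c' * norm \<psi>) \<le> c * norm (S' \<psi>)"
      using c(1) c'(2) by (intro mult_left_mono) auto
    also have "\<dots> \<le> norm (S (S' \<psi>))" by (rule c(2))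
    finally show ?thesis by (simp only: mult.assoc)
  qed
  then show ?thesis
    unfolding bounded_below_def using c(1) c'(1) by (intro exI[of _ "c * c'"]) auto
qed

text \<open>
  If \<open>c \<parallel>\<psi>\<parallel> \<le> \<parallel>S \<psi>\<parallel> \<le> M \<parallel>\<psi>\<parallel>\<close>, then \<open>1 - S' S / M\<^sup>2\<close> has norm at most \<open>sqrt (1 - c\<^sup>2 / M\<^sup>2) < 1\<close>, and so
  \<open>S' S \<psi> = \<phi>\<close> is a fixed point equation for a contraction.  Normality turns a solution into a
  preimage of \<open>\<phi>\<close> under \<open>S\<close>.
\<close>

lemma normal_bounded_below_invertible:
  assumes S: "bounded_linear S" and S': "bounded_linear S'"
    and adj: "\<And>\<phi> \<psi>. inner (S \<phi>) \<psi> = inner \<phi> (S' \<psi>)"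
    and comm: "\<And>\<psi>. S (S' \<psi>) = S' (S \<psi>)"
    and below: "bounded_below S"
  shows "\<exists>B. bounded_linear B \<and> (\<forall>\<psi>. B (S \<psi>) = \<psi>) \<and> (\<forall>\<psi>. S (B \<psi>) = \<psi>)"
proof -
  interpret S: bounded_linear S by (rule S)
  interpret S': bounded_linear S' by (rule S')
  obtain c where c: "c > 0" "\<And>\<psi>. c * norm \<psi> \<le> norm (S \<psi>)"
    using below by (auto simp: bounded_below_def)
  obtain M where M: "M > 0" "\<And>\<psi>. norm (S \<psi>) \<le> norm \<psi> * M"
    using S.pos_bounded by blast
  have nS': "norm (S' \<psi>) = norm (S \<psi>)" for \<psi>
  proof -
    have "inner (S' \<psi>) (S' \<psi>) = inner (S \<psi>) (S \<psi>)"
      by (metis adj comm inner_commute)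
    then show ?thesis by (simp add: norm_eq_sqrt_inner)
  qed
  have "c \<le> M" using c(2)[of "ell2_delta 0"] M(2)[of "ell2_delta 0"] by (simp add: norm_ell2_delta)
  define k where "k = 1 - c\<^sup>2 / M\<^sup>2"
  have k: "0 \<le> k" "k < 1"
    using \<open>c \<le> M\<close> c(1) M(1) by (auto simp: k_def power_mono)
  have surj: "\<exists>\<theta>. S \<theta> = \<phi>" for \<phi>
  proof -
    define f where "f \<psi> = \<psi> - (1 / M\<^sup>2) *\<^sub>R (S' (S \<psi>) - \<phi>)" for \<psi>
    have "dist (f \<psi>) (f \<theta>) \<le> sqrt k * dist \<psi> \<theta>" for \<psi> \<theta>
    proof -
      define d where "d = \<psi> - \<theta>"
      have f: "f \<psi> - f \<theta> = d - (1 / M\<^sup>2) *\<^sub>R S' (S d)"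
        by (simp add: f_def d_def S.diff S'.diff algebra_simps)
      have i: "inner d (S' (S d)) = (norm (S d))\<^sup>2"
        by (metis adj power2_norm_eq_inner)
      have n: "norm (S' (S d)) \<le> M * norm (S d)"
        using nS'[of "S d"] M(2)[of "S d"] by (simp add: mult.commute)
      have "(norm (f \<psi> - f \<theta>))\<^sup>2
          = (norm d)\<^sup>2 - 2 / M\<^sup>2 * (norm (S d))\<^sup>2 + (norm (S' (S d)))\<^sup>2 / (M\<^sup>2)\<^sup>2"
        unfolding f power2_norm_diff by (simp add: i power_divide)
      also have "\<dots> \<le> (norm d)\<^sup>2 - 2 / M\<^sup>2 * (norm (S d))\<^sup>2 + (M * norm (S d))\<^sup>2 / (M\<^sup>2)\<^sup>2"
        using n by (intro add_left_mono divide_right_mono power_mono) auto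
      also have "\<dots> = (norm d)\<^sup>2 - (norm (S d))\<^sup>2 / M\<^sup>2"
        using M(1) by (simp add: power_mult_distrib field_simps power2_eq_square)
      also have "\<dots> \<le> (norm d)\<^sup>2 - (c * norm d)\<^sup>2 / M\<^sup>2"
        using c by (intro diff_left_mono divide_right_mono power_mono) auto
      also have "\<dots> = (sqrt k * norm d)\<^sup>2"
        using k(1) by (simp add: power_mult_distrib) (simp add: k_def algebra_simps)
      finally show ?thesis
        by (simp add: dist_norm d_def) (rule power2_le_imp_le, auto simp: k)
    qed
    then have "\<exists>!\<psi>. f \<psi> = \<psi>"
      by (intro banach_fix_type[of "sqrt k"]) (use k in auto)
    then obtain \<psi> where "f \<psi> = \<psi>" by blast
    then have "S (S' \<psi>) = \<phi>" using M(1) by (simp add: f_def comm)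
    then show ?thesis by blast
  qed
  have inj: "\<psi> = \<theta>" if "S \<psi> = S \<theta>" for \<psi> \<theta>
    using c(2)[of "\<psi> - \<theta>"] that c(1) by (simp add: S.diff mult_le_0_iff)
  define B where "B = inv S"
  have SB: "S (B \<psi>) = \<psi>" for \<psi>
    unfolding B_def using surj by (metis f_inv_into_f rangeI)
  then have BS: "B (S \<psi>) = \<psi>" for \<psi> by (metis inj)
  have "bounded_linear B"
  proof (rule bounded_linear_intro[where K = "1 / c"])
    show "B (\<psi> + \<phi>) = B \<psi> + B \<phi>" for \<psi> \<phi> by (rule inj) (simp add: S.add SB)
    show "B (r *\<^sub>R \<psi>) = r *\<^sub>R B \<psi>" for r \<psi> by (rule inj) (simp add: S.scaleR SB)
    show "norm (B \<psi>) \<le> norm \<psi> * (1 / c)" for \<psi>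
      using c(2)[of "B \<psi>"] c(1) by (simp add: SB field_simps)
  qed
  then show ?thesis using SB BS by blast
qed

subsection \<open>Polynomials of an operator\<close>

lemma poly_op_altdef:
  assumes "degree P \<le> n"
  shows "poly_op P A \<psi> = (\<Sum>i\<le>n. coeff P i *\<^sub>R (A ^^ i) \<psi>)"
  unfolding poly_op_def using assms
  by (intro sum.mono_neutral_left) (auto simp: coeff_eq_0)

lemma poly_op_0 [simp]: "poly_op 0 A \<psi> = 0"
  by (simp add: poly_op_def)

lemma poly_op_add: "poly_op (P + Q) A \<psi> = poly_op P A \<psi> + poly_op Q A \<psi>"
  using poly_op_altdef[of P "max (degree P) (degree Q)"] poly_op_altdef[of Q "max (degree P) (degree Q)"]
    poly_op_altdef[of "P + Q" "max (degree P) (degree Q)"]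
  by (simp add: degree_add_le_max sum.distrib scaleR_add_left)

lemma poly_op_smult: "poly_op (smult c P) A \<psi> = c *\<^sub>R poly_op P A \<psi>"
  using poly_op_altdef[of "smult c P" "degree P"]
  by (simp add: degree_smult_le poly_op_def scaleR_sum_right)

lemma poly_op_minus: "poly_op (P - Q) A \<psi> = poly_op P A \<psi> - poly_op Q A \<psi>"
  using poly_op_add[of P "- Q" A \<psi>] poly_op_smult[of "-1" Q A \<psi>] by simp

lemma poly_op_pCons:
  assumes "linear A"
  shows "poly_op (pCons a P) A \<psi> = a *\<^sub>R \<psi> + A (poly_op P A \<psi>)"
proof -
  have "poly_op (pCons a P) A \<psi> = (\<Sum>i\<le>Suc (degree P). coeff (pCons a P) i *\<^sub>R (A ^^ i) \<psi>)"
    by (rule poly_op_altdef) (simp add: degree_pCons_le)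
  also have "\<dots> = a *\<^sub>R \<psi> + (\<Sum>i\<le>degree P. coeff P i *\<^sub>R A ((A ^^ i) \<psi>))"
    by (subst sum.atMost_Suc_shift) simp
  also have "\<dots> = a *\<^sub>R \<psi> + A (poly_op P A \<psi>)"
    using assms by (simp add: poly_op_def linear_sum linear_scale)
  finally show ?thesis .
qed

lemma poly_op_mult:
  assumes "linear A"
  shows "poly_op (P * Q) A \<psi> = poly_op P A (poly_op Q A \<psi>)"
  by (induction P) (simp_all add: poly_op_add poly_op_smult poly_op_pCons[OF assms])

lemma bounded_linear_poly_op:
  assumes "bounded_linear A"
  shows "bounded_linear (poly_op P A)"
proof (induction P)
  case 0
  have "poly_op 0 A = (\<lambda>_. 0)" by auto
  then show ?case by simp
next
  case (pCons a P)
  have "poly_op (pCons a P) A = (\<lambda>\<psi>. a *\<^sub>R \<psi> + A (poly_op P A \<psi>))"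
    using poly_op_pCons[OF bounded_linear.linear[OF assms]] by auto
  then show ?case
    by (simp add: bounded_linear_add bounded_linear_scaleR_right bounded_linear_compose[OF assms pCons.IH])
qed

lemma poly_op_linear_factor:
  assumes "linear A"
  shows "poly_op [:- x, 1:] A \<psi> = A \<psi> - x *\<^sub>R \<psi>"
  using assms by (simp add: poly_op_pCons linear_0)

text \<open>
  The quadratic is the product of the linear factors of \<open>z\<close> and of its conjugate.  Such factors
  keep the factorisation of a real polynomial real, and an operator polynomial can be studied
  factor by factor without leaving the real vector space structure.
\<close>

lemma real_poly_complex_root_factor:
  fixes Q :: "real poly"
  assumes z: "poly (map_poly complex_of_real Q) z = 0" and im: "Im z \<noteq> 0"
  shows "[:(Re z)\<^sup>2 + (Im z)\<^sup>2, - 2 * Re z, 1:] dvd Q"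
proof -
  define ev where "ev P = poly (map_poly complex_of_real P) z" for P
  have ev_pCons: "ev (pCons a P) = of_real a + z * ev P" for a P
    by (simp add: ev_def map_poly_pCons)
  have ev_0: "ev 0 = 0" by (simp add: ev_def)
  have ev_add: "ev (P + P') = ev P + ev P'" for P P'
    by (induction P P' rule: poly_induct2) (simp_all add: ev_0 ev_pCons algebra_simps)
  have ev_smult: "ev (smult a P) = of_real a * ev P" for a P
    by (induction P) (simp_all add: ev_0 ev_pCons algebra_simps)
  have ev_mult: "ev (P * P') = ev P * ev P'" for P P'
    by (induction P) (simp_all add: ev_0 ev_add ev_smult ev_pCons algebra_simps)
  define q where "q = [:(Re z)\<^sup>2 + (Im z)\<^sup>2, - 2 * Re z, 1:]"
  have q: "ev q = 0"
    by (simp add: q_def ev_pCons ev_0 complex_eq_iff power2_eq_square algebra_simps)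
  define R where "R = Q mod q"
  have "q \<noteq> 0" "degree q = 2" by (auto simp: q_def)
  then have "degree R < 2"
    using degree_mod_less[of q Q] by (auto simp: R_def)
  then have "R = [:coeff R 0, coeff R 1:]"
    by (intro poly_eqI) (auto simp: coeff_pCons coeff_eq_0 split: nat.splits)
  then obtain a b where R: "R = [:a, b:]" by blast
  have "ev Q = ev R"
    using ev_add[of "q * (Q div q)" R] by (simp add: ev_mult q R_def)
  then have "of_real a + z * of_real b = 0"
    using z by (simp add: R ev_pCons ev_0 ev_def[symmetric])
  then have "b = 0" "a = 0"
    using im by (auto simp: complex_eq_iff)
  then have "Q mod q = 0" using R R_def by simp
  then show ?thesis unfolding q_def by (simp add: mod_eq_0_iff_dvd)
qed

subsection \<open>The spectrum as failure of lower bounds\<close>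

text \<open>
  A unit vector on which \<open>B\<close> almost attains its norm \<open>N\<close> is almost an eigenvector of \<open>B\<^sup>2\<close>:
  \<open>\<parallel>N\<^sup>2 \<psi> - B\<^sup>2 \<psi>\<parallel>\<^sup>2 \<le> N\<^sup>2 (N\<^sup>2 - \<parallel>B \<psi>\<parallel>\<^sup>2)\<close>.  A lower bound for \<open>N\<^sup>2 - B\<^sup>2\<close> would therefore push the norm of
  \<open>B\<close> below \<open>N\<close>.
\<close>

lemma symmetric_norm_not_bounded_below:
  assumes B: "bounded_linear B" and sym: "\<And>\<phi> \<psi>. inner (B \<phi>) \<psi> = inner \<phi> (B \<psi>)"
    and pos: "onorm B > 0"
  shows "\<not> bounded_below (\<lambda>\<psi>. (onorm B)\<^sup>2 *\<^sub>R \<psi> - B (B \<psi>))"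
proof
  define N where "N = onorm B"
  assume "bounded_below (\<lambda>\<psi>. (onorm B)\<^sup>2 *\<^sub>R \<psi> - B (B \<psi>))"
  then obtain c where c: "c > 0" "\<And>\<psi>. c * norm \<psi> \<le> norm (N\<^sup>2 *\<^sub>R \<psi> - B (B \<psi>))"
    by (auto simp: bounded_below_def N_def)
  have N: "norm (B \<psi>) \<le> N * norm \<psi>" for \<psi> unfolding N_def by (rule onorm[OF B])
  have "N > 0" using pos by (simp add: N_def)
  define k where "k = N\<^sup>2 - c\<^sup>2 / N\<^sup>2"
  have le: "(norm (B \<psi>))\<^sup>2 \<le> k * (norm \<psi>)\<^sup>2" for \<psi>
  proof -
    have "inner \<psi> (B (B \<psi>)) = (norm (B \<psi>))\<^sup>2" by (metis sym power2_norm_eq_inner)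
    then have "(norm (N\<^sup>2 *\<^sub>R \<psi> - B (B \<psi>)))\<^sup>2
        = (N\<^sup>2)\<^sup>2 * (norm \<psi>)\<^sup>2 - 2 * N\<^sup>2 * (norm (B \<psi>))\<^sup>2 + (norm (B (B \<psi>)))\<^sup>2"
      unfolding power2_norm_diff by (simp add: power_mult_distrib)
    also have "\<dots> \<le> (N\<^sup>2)\<^sup>2 * (norm \<psi>)\<^sup>2 - 2 * N\<^sup>2 * (norm (B \<psi>))\<^sup>2 + (N * norm (B \<psi>))\<^sup>2"
      by (intro add_left_mono power_mono N) auto
    finally have "(norm (N\<^sup>2 *\<^sub>R \<psi> - B (B \<psi>)))\<^sup>2 \<le> (N\<^sup>2)\<^sup>2 * (norm \<psi>)\<^sup>2 - N\<^sup>2 * (norm (B \<psi>))\<^sup>2"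
      by (simp add: power_mult_distrib)
    moreover have "(c * norm \<psi>)\<^sup>2 \<le> (norm (N\<^sup>2 *\<^sub>R \<psi> - B (B \<psi>)))\<^sup>2"
      using c by (intro power_mono) auto
    ultimately have "c\<^sup>2 * (norm \<psi>)\<^sup>2 \<le> (N\<^sup>2 * (norm \<psi>)\<^sup>2 - (norm (B \<psi>))\<^sup>2) * N\<^sup>2"
      by (simp add: power_mult_distrib algebra_simps power2_eq_square)
    then have "c\<^sup>2 * (norm \<psi>)\<^sup>2 / N\<^sup>2 \<le> N\<^sup>2 * (norm \<psi>)\<^sup>2 - (norm (B \<psi>))\<^sup>2"
      using \<open>N > 0\<close> by (subst pos_divide_le_eq) auto
    then show ?thesis by (simp add: k_def left_diff_distrib)
  qed
  have "0 \<le> (norm (B (ell2_delta 0)))\<^sup>2" by simp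
  also have "\<dots> \<le> k" using le[of "ell2_delta 0"] by (simp add: norm_ell2_delta)
  finally have "0 \<le> k" .
  have "norm (B \<psi>) \<le> sqrt k * norm \<psi>" for \<psi>
    by (rule power2_le_imp_le) (use le[of \<psi>] \<open>0 \<le> k\<close> in \<open>auto simp: power_mult_distrib\<close>)
  then have "N \<le> sqrt k" unfolding N_def using \<open>0 \<le> k\<close> by (intro onorm_bound) auto
  then have "N\<^sup>2 \<le> k" using \<open>N > 0\<close> \<open>0 \<le> k\<close> power_mono[of N "sqrt k" 2] by simp
  then show False using c(1) \<open>N > 0\<close> by (simp add: k_def divide_le_0_iff)
qed

definition real_spectrum :: "(ell2 \<Rightarrow> ell2) \<Rightarrow> real set" where
  "real_spectrum A = {x. complex_of_real x \<in> op_spectrum A}"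

text \<open>
  Symmetry refers to the real inner product.  Together with complex linearity it makes
  \<open>A - cnj z\<close> the adjoint of \<open>A - z\<close>.
\<close>

locale symmetric_operator =
  fixes A :: "ell2 \<Rightarrow> ell2"
  assumes blinear: "bounded_linear A"
    and cscale: "A (ell2_cscale z \<psi>) = ell2_cscale z (A \<psi>)"
    and symmetric: "inner (A \<phi>) \<psi> = inner \<phi> (A \<psi>)"
begin

sublocale A: bounded_linear A by (rule blinear)

abbreviation spec :: "real set" where
  "spec \<equiv> real_spectrum A"

text \<open>
  The operator \<open>A - z\<close> is normal with adjoint \<open>A - cnj z\<close>.
\<close>

lemma not_in_op_spectrumI:
  assumes "bounded_below (\<lambda>\<psi>. A \<psi> - ell2_cscale z \<psi>)"
  shows "z \<notin> op_spectrum A"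
proof -
  have bl: "bounded_linear (\<lambda>\<psi>. A \<psi> - ell2_cscale z \<psi>)" for z
    by (intro bounded_linear_sub blinear bounded_linear_ell2_cscale)
  have "\<exists>B. bounded_linear B \<and> (\<forall>\<psi>. B (A \<psi> - ell2_cscale z \<psi>) = \<psi>)
      \<and> (\<forall>\<psi>. A (B \<psi>) - ell2_cscale z (B \<psi>) = \<psi>)"
  proof (rule normal_bounded_below_invertible[OF bl bl _ _ assms])
    show "inner (A \<phi> - ell2_cscale z \<phi>) \<psi> = inner \<phi> (A \<psi> - ell2_cscale (cnj z) \<psi>)" for \<phi> \<psi>
      by (simp add: inner_diff_left inner_diff_right symmetric inner_ell2_cscale)
    show "A (A \<psi> - ell2_cscale (cnj z) \<psi>) - ell2_cscale z (A \<psi> - ell2_cscale (cnj z) \<psi>) =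
        A (A \<psi> - ell2_cscale z \<psi>) - ell2_cscale (cnj z) (A \<psi> - ell2_cscale z \<psi>)" for \<psi>
      by (rule ell2_eqI) (simp add: A.diff cscale algebra_simps)
  qed
  then show ?thesis by (simp add: op_spectrum_def)
qed

lemma real_notin_spec_iff: "x \<notin> spec \<longleftrightarrow> bounded_below (\<lambda>\<psi>. A \<psi> - x *\<^sub>R \<psi>)"
proof
  assume "x \<notin> spec"
  then obtain B where B: "bounded_linear B" "\<And>\<psi>. B (A \<psi> - x *\<^sub>R \<psi>) = \<psi>"
    by (auto simp: real_spectrum_def op_spectrum_def ell2_cscale_of_real)
  obtain K where K: "K > 0" "\<And>\<psi>. norm (B \<psi>) \<le> norm \<psi> * K"
    using bounded_linear.pos_bounded[OF B(1)] by blast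
  show "bounded_below (\<lambda>\<psi>. A \<psi> - x *\<^sub>R \<psi>)"
    unfolding bounded_below_def
  proof (intro exI[of _ "1 / K"] conjI allI)
    fix \<psi>
    show "1 / K * norm \<psi> \<le> norm (A \<psi> - x *\<^sub>R \<psi>)"
      using K(2)[of "A \<psi> - x *\<^sub>R \<psi>"] K(1) by (simp add: B(2) field_simps)
  qed (use K in simp)
next
  assume "bounded_below (\<lambda>\<psi>. A \<psi> - x *\<^sub>R \<psi>)"
  then show "x \<notin> spec"
    using not_in_op_spectrumI[of "of_real x"] by (simp add: real_spectrum_def ell2_cscale_of_real)
qed

lemma spec_notin: "bounded_below (\<lambda>\<psi>. A \<psi> - x *\<^sub>R \<psi>) \<Longrightarrow> x \<notin> spec"
  by (simp add: real_notin_spec_iff)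

text \<open>
  For \<open>z = x + i y\<close> the vectors \<open>(A - x) \<psi>\<close> and \<open>i y \<psi>\<close> are orthogonal, so \<open>A - z\<close> is bounded below by
  \<open>\<bar>y\<bar>\<close>.
\<close>

lemma op_spectrum_eq: "op_spectrum A = complex_of_real ` spec"
proof -
  have "z \<in> \<real>" if "z \<in> op_spectrum A" for z
  proof (rule ccontr)
    assume "z \<notin> \<real>"
    then have im: "Im z \<noteq> 0" by (simp add: complex_is_Real_iff)
    have "\<bar>Im z\<bar> * norm \<psi> \<le> norm (A \<psi> - ell2_cscale z \<psi>)" for \<psi>
    proof -
      define \<phi> where "\<phi> = A \<psi> - Re z *\<^sub>R \<psi>"
      define \<theta> where "\<theta> = ell2_cscale (\<i> * of_real (Im z)) \<psi>"
      have eq: "A \<psi> - ell2_cscale z \<psi> = \<phi> - \<theta>"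
        unfolding \<phi>_def \<theta>_def
        by (rule ell2_eqI) (simp add: complex_eq_iff algebra_simps)
      have "inner \<phi> \<theta> = inner (A \<theta> - Re z *\<^sub>R \<theta>) \<psi>"
        by (simp add: \<phi>_def symmetric inner_diff_left inner_diff_right inner_commute[of _ \<theta>]
            inner_commute[of _ "A \<theta>"])
      also have "A \<theta> - Re z *\<^sub>R \<theta> = ell2_cscale (\<i> * of_real (Im z)) \<phi>"
        unfolding \<theta>_def \<phi>_def cscale by (rule ell2_eqI) (simp add: algebra_simps scaleR_conv_of_real)
      also have "inner \<dots> \<psi> = inner \<phi> (- \<theta>)"
        unfolding inner_ell2_cscale \<theta>_def
        by (rule arg_cong2[where f = inner]) (auto intro!: ell2_eqI)
      finally have "inner \<phi> \<theta> = 0" by simp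
      then have "(norm (\<phi> - \<theta>))\<^sup>2 = (norm \<phi>)\<^sup>2 + (norm \<theta>)\<^sup>2"
        by (simp add: power2_norm_eq_inner inner_diff_left inner_diff_right inner_commute)
      then have "(norm \<theta>)\<^sup>2 \<le> (norm (\<phi> - \<theta>))\<^sup>2" by simp
      then have "norm \<theta> \<le> norm (\<phi> - \<theta>)" by (rule power2_le_imp_le) simp
      then show ?thesis by (simp add: eq) (simp add: \<theta>_def norm_ell2_cscale norm_mult)
    qed
    then have "bounded_below (\<lambda>\<psi>. A \<psi> - ell2_cscale z \<psi>)"
      unfolding bounded_below_def using im by (intro exI[of _ "\<bar>Im z\<bar>"]) auto
    then show False using not_in_op_spectrumI that by blast
  qed
  then show ?thesis by (auto simp: real_spectrum_def elim!: Reals_cases)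
qed

lemma spec_bounded:
  assumes R: "\<And>\<psi>. norm (A \<psi>) \<le> R * norm \<psi>"
  shows "spec \<subseteq> {- R..R}"
proof -
  have "x \<notin> spec" if "\<bar>x\<bar> > R" for x
  proof (rule spec_notin)
    have "(\<bar>x\<bar> - R) * norm \<psi> \<le> norm (A \<psi> - x *\<^sub>R \<psi>)" for \<psi>
      using R[of \<psi>] norm_triangle_ineq2[of "x *\<^sub>R \<psi>" "A \<psi>"]
      by (simp add: algebra_simps norm_minus_commute)
    then show "bounded_below (\<lambda>\<psi>. A \<psi> - x *\<^sub>R \<psi>)"
      unfolding bounded_below_def using that by (intro exI[of _ "\<bar>x\<bar> - R"]) auto
  qed
  then have "\<bar>x\<bar> \<le> R" if "x \<in> spec" for x using that not_less by blast
  then show ?thesis by (auto simp: abs_le_iff minus_le_iff)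
qed

lemma compact_spec: "compact spec"
proof (rule compact_eq_bounded_closed[THEN iffD2], intro conjI)
  obtain K where "\<And>\<psi>. norm (A \<psi>) \<le> norm \<psi> * K" using A.bounded by blast
  then have "spec \<subseteq> {- K..K}" by (intro spec_bounded) (simp add: mult.commute)
  then show "bounded spec" by (rule bounded_subset[rotated]) simp
  have "open (- spec)"
  proof (rule openI)
    fix x assume "x \<in> - spec"
    then obtain c where c: "c > 0" "\<And>\<psi>. c * norm \<psi> \<le> norm (A \<psi> - x *\<^sub>R \<psi>)"
      by (auto simp: real_notin_spec_iff bounded_below_def)
    have "y \<notin> spec" if y: "dist x y < c" for y
    proof (rule spec_notin)
      have "(c - \<bar>x - y\<bar>) * norm \<psi> \<le> norm (A \<psi> - y *\<^sub>R \<psi>)" for \<psi>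
      proof -
        have "norm (A \<psi> - x *\<^sub>R \<psi>) \<le> norm (A \<psi> - y *\<^sub>R \<psi>) + norm ((x - y) *\<^sub>R \<psi>)"
          using norm_triangle_ineq4[of "A \<psi> - y *\<^sub>R \<psi>" "(x - y) *\<^sub>R \<psi>"] by (simp add: scaleR_diff_left)
        then show ?thesis using c(2)[of \<psi>] unfolding norm_scaleR left_diff_distrib by linarith
      qed
      then show "bounded_below (\<lambda>\<psi>. A \<psi> - y *\<^sub>R \<psi>)"
        unfolding bounded_below_def using y by (intro exI[of _ "c - \<bar>x - y\<bar>"]) (auto simp: dist_real_def)
    qed
    then show "\<exists>e>0. ball x e \<subseteq> - spec" using c(1) by (auto intro!: exI[of _ c])
  qed
  then show "closed spec" by (simp add: closed_def)
qed

lemma poly_op_symmetric: "inner (poly_op P A \<phi>) \<psi> = inner \<phi> (poly_op P A \<psi>)"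
proof (induction P arbitrary: \<phi> \<psi>)
  case (pCons a P)
  have "A (poly_op P A \<psi>) = poly_op P A (A \<psi>)"
    using poly_op_mult[OF A.linear, of "[:0, 1:]" P] poly_op_mult[OF A.linear, of P "[:0, 1:]"]
    by (simp add: poly_op_pCons[OF A.linear] A.zero mult.commute)
  then show ?case
    by (simp add: poly_op_pCons[OF A.linear] inner_add_left inner_add_right symmetric pCons.IH)
qed simp

text \<open>
  Factor \<open>Q\<close> over the reals.  A linear factor \<open>A - x\<close> is bounded below because its root \<open>x\<close> is not in
  the spectrum.  A quadratic factor without real roots has the form \<open>(A - u)\<^sup>2 + v\<^sup>2\<close>, and pairing it
  with \<open>\<psi>\<close> gives the lower bound \<open>v\<^sup>2\<close>.
\<close>

lemma poly_op_bounded_below: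
  assumes "Q \<noteq> 0" "\<And>x. x \<in> spec \<Longrightarrow> poly Q x \<noteq> 0"
  shows "bounded_below (poly_op Q A)"
  using assms
proof (induction "degree Q" arbitrary: Q rule: less_induct)
  case less
  have factor: "bounded_below (poly_op (D * Q') A)"
    if "Q = D * Q'" "degree D > 0" "bounded_below (poly_op D A)" for D Q'
  proof -
    have "Q' \<noteq> 0" "D \<noteq> 0" using less.prems(1) that by auto
    then have "degree Q' < degree Q" using that by (simp add: degree_mult_eq)
    then have "bounded_below (poly_op Q' A)"
      using less.prems that \<open>Q' \<noteq> 0\<close> by (intro less.hyps) auto
    from bounded_below_comp[OF that(3) this] show ?thesis
      by (simp add: bounded_below_def poly_op_mult[OF A.linear])
  qed
  consider "degree Q = 0" | x where "poly Q x = 0" "degree Q > 0" | "\<forall>x. poly Q x \<noteq> 0" "degree Q > 0" by blast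
  then show ?case
  proof cases
    case 1
    then obtain a where "Q = [:a:]" by (rule degree_eq_zeroE)
    then show ?thesis using less.prems(1)
      by (auto simp: bounded_below_def poly_op_pCons[OF A.linear] A.zero intro!: exI[of _ "\<bar>a\<bar>"])
  next
    case 2
    then obtain Q' where Q': "Q = [:- x, 1:] * Q'"
      by (auto simp: poly_eq_0_iff_dvd)
    have "bounded_below (\<lambda>\<psi>. A \<psi> - x *\<^sub>R \<psi>)"
      using real_notin_spec_iff[of x] less.prems(2) 2 by blast
    then have "bounded_below (poly_op [:- x, 1:] A)"
      by (simp add: bounded_below_def poly_op_linear_factor[OF A.linear])
    then show ?thesis using factor[OF Q'] Q' by simp
  next
    case 3
    have "\<not> constant (poly (map_poly complex_of_real Q))"
      using 3(2) by (simp add: constant_degree degree_map_poly)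
    then obtain z where z: "poly (map_poly complex_of_real Q) z = 0"
      using fundamental_theorem_of_algebra by blast
    have ev: "poly (map_poly complex_of_real P) (of_real x) = of_real (poly P x)" for P x
      by (induction P) (simp_all add: map_poly_pCons)
    have im: "Im z \<noteq> 0"
    proof
      assume "Im z = 0"
      then have "z = of_real (Re z)" by (simp add: complex_eq_iff)
      then show False using z ev[of Q "Re z"] 3(1) by (metis of_real_eq_0_iff)
    qed
    define D where "D = [:(Re z)\<^sup>2 + (Im z)\<^sup>2, - 2 * Re z, 1:]"
    obtain Q' where Q': "Q = D * Q'"
      using real_poly_complex_root_factor[OF z im] by (auto simp: D_def)
    have "(Im z)\<^sup>2 * norm \<psi> \<le> norm (poly_op D A \<psi>)" for \<psi>
    proof (cases "\<psi> = 0")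
      case False
      define \<phi> where "\<phi> = A \<psi> - Re z *\<^sub>R \<psi>"
      have "poly_op D A \<psi> = (A \<phi> - Re z *\<^sub>R \<phi>) + (Im z)\<^sup>2 *\<^sub>R \<psi>"
        by (simp add: D_def \<phi>_def poly_op_pCons[OF A.linear] A.zero A.diff A.add A.scaleR
            algebra_simps power2_eq_square flip: scaleR_add_left)
      then have "inner (poly_op D A \<psi>) \<psi> = (norm \<phi>)\<^sup>2 + (Im z)\<^sup>2 * (norm \<psi>)\<^sup>2"
        by (simp add: inner_add_left inner_diff_left inner_diff_right symmetric \<phi>_def power2_norm_eq_inner)
      then have "(Im z)\<^sup>2 * (norm \<psi>)\<^sup>2 \<le> norm (poly_op D A \<psi>) * norm \<psi>"
        using norm_cauchy_schwarz[of "poly_op D A \<psi>" \<psi>] zero_le_power2[of "norm \<phi>"] by linarith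
      then show ?thesis using False by (simp add: power2_eq_square)
    qed (simp add: linear_0[OF bounded_linear.linear[OF bounded_linear_poly_op[OF blinear]]])
    then have "bounded_below (poly_op D A)"
      unfolding bounded_below_def using im by (intro exI[of _ "(Im z)\<^sup>2"]) auto
    then show ?thesis using factor[OF Q'] Q' by (simp add: D_def)
  qed
qed


text \<open>
  With empty spectrum every nonzero polynomial of \<open>A\<close> would be bounded below.  This fails for
  \<open>\<parallel>A\<parallel>\<^sup>2 - A\<^sup>2\<close>, and for \<open>A\<close> itself if \<open>A = 0\<close>.
\<close>

lemma spec_nonempty: "spec \<noteq> {}"
proof
  assume "spec = {}"
  then have bb: "bounded_below (poly_op Q A)" if "Q \<noteq> 0" for Q
    using poly_op_bounded_below that by auto
  show False
  proof (cases "onorm A = 0")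
    case True
    then have "A \<psi> = 0" for \<psi> using onorm[OF blinear, of \<psi>] by simp
    moreover have "bounded_below (poly_op [:0, 1:] A)" by (rule bb) simp
    ultimately show False
      using ell2_delta_neq_0 by (auto simp: bounded_below_def poly_op_pCons[OF A.linear] mult_le_0_iff)
  next
    case False
    then have "onorm A > 0" using onorm_pos_le[OF blinear] by linarith
    moreover have "bounded_below (poly_op [:(onorm A)\<^sup>2, 0, - 1:] A)" by (rule bb) simp
    ultimately show False
      using symmetric_norm_not_bounded_below[OF blinear symmetric]
      by (simp add: bounded_below_def poly_op_pCons[OF A.linear] A.zero A.neg)
  qed
qed

text \<open>
  This replaces the spectral theorem.  With \<open>N = \<parallel>P(A)\<parallel>\<close>, the operator \<open>N\<^sup>2 - P(A)\<^sup>2\<close> is not bounded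
  below, so the polynomial \<open>N\<^sup>2 - P\<^sup>2\<close> vanishes somewhere on the spectrum.
\<close>

lemma onorm_poly_op_attained: "\<exists>x\<in>spec. onorm (poly_op P A) \<le> \<bar>poly P x\<bar>"
proof (cases "onorm (poly_op P A) = 0")
  case True
  then show ?thesis using spec_nonempty by auto
next
  case False
  define N where "N = onorm (poly_op P A)"
  have blP: "bounded_linear (poly_op P A)" by (rule bounded_linear_poly_op[OF blinear])
  have "N > 0" using False onorm_pos_le[OF blP] by (simp add: N_def)
  have op: "poly_op ([:N\<^sup>2:] - P * P) A \<psi> = N\<^sup>2 *\<^sub>R \<psi> - poly_op P A (poly_op P A \<psi>)" for \<psi>
    by (simp add: poly_op_minus poly_op_mult[OF A.linear] poly_op_pCons[OF A.linear] A.zero)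
  have nb: "\<not> bounded_below (poly_op ([:N\<^sup>2:] - P * P) A)"
  proof -
    have "poly_op ([:N\<^sup>2:] - P * P) A = (\<lambda>\<psi>. N\<^sup>2 *\<^sub>R \<psi> - poly_op P A (poly_op P A \<psi>))"
      by (rule ext) (rule op)
    moreover have "onorm (poly_op P A) > 0" using \<open>N > 0\<close> by (simp add: N_def)
    ultimately show ?thesis
      using symmetric_norm_not_bounded_below[OF blP poly_op_symmetric] by (simp add: N_def)
  qed
  have "\<exists>x\<in>spec. poly ([:N\<^sup>2:] - P * P) x = 0"
  proof (cases "[:N\<^sup>2:] - P * P = 0")
    case True
    then show ?thesis using spec_nonempty by (auto simp del: poly_diff)
  next
    case False
    then show ?thesis using poly_op_bounded_below[OF False] nb by blast
  qed
  then obtain x where "x \<in> spec" "(poly P x)\<^sup>2 = N\<^sup>2"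
    by (auto simp: power2_eq_square)
  then have "N \<le> \<bar>poly P x\<bar>" by (metis abs_ge_self power2_eq_iff abs_minus_cancel)
  then show ?thesis using \<open>x \<in> spec\<close> by (auto simp: N_def)
qed

lemma norm_poly_op_le:
  assumes "\<And>x. x \<in> spec \<Longrightarrow> \<bar>poly P x\<bar> \<le> e"
  shows "norm (poly_op P A \<psi>) \<le> e * norm \<psi>"
proof -
  have "onorm (poly_op P A) \<le> e" using onorm_poly_op_attained[of P] assms by force
  then have "onorm (poly_op P A) * norm \<psi> \<le> e * norm \<psi>" by (rule mult_right_mono) simp
  with onorm[OF bounded_linear_poly_op[OF blinear], of P \<psi>] show ?thesis by (rule order_trans)
qed

end

subsection \<open>Continuous functional calculus\<close>

lemma polynomial_approximation:
  fixes h :: "real \<Rightarrow> real"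
  assumes "continuous_on {a..b} h" "e > 0"
  obtains P :: "real poly" where "\<And>x. x \<in> {a..b} \<Longrightarrow> \<bar>poly P x - h x\<bar> < e"
proof -
  obtain g where g: "real_polynomial_function g" "\<And>x. x \<in> {a..b} \<Longrightarrow> \<bar>h x - g x\<bar> < e"
    using Stone_Weierstrass_real_polynomial_function[OF compact_Icc assms] by blast
  then obtain c n where c: "g = (\<lambda>x. \<Sum>i\<le>n. c i * x ^ i)"
    by (auto simp: real_polynomial_function_iff_sum)
  have "poly (\<Sum>i\<le>n. monom (c i) i) x = g x" for x
    by (simp add: c poly_sum poly_monom)
  then show thesis
    using g(2) by (intro that[of "\<Sum>i\<le>n. monom (c i) i"]) (metis abs_minus_commute)
qed

lemma polynomial_sequence:
  fixes h :: "real \<Rightarrow> real"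
  assumes "continuous_on {a..b} h"
  obtains P :: "nat \<Rightarrow> real poly" where "uniform_limit {a..b} (\<lambda>n. poly (P n)) h sequentially"
proof -
  have "\<exists>P :: real poly. \<forall>x\<in>{a..b}. \<bar>poly P x - h x\<bar> < inverse (Suc n)" for n
    using polynomial_approximation[OF assms, of "inverse (Suc n)"] by (metis inverse_positive_iff_positive of_nat_0_less_iff zero_less_Suc)
  then obtain P :: "nat \<Rightarrow> real poly"
    where P: "\<And>n x. x \<in> {a..b} \<Longrightarrow> \<bar>poly (P n) x - h x\<bar> < inverse (Suc n)"
    by metis
  have "uniform_limit {a..b} (\<lambda>n. poly (P n)) h sequentially"
  proof (rule uniform_limitI)
    fix e :: real assume "e > 0"
    have "\<forall>\<^sub>F n in sequentially. inverse (real (Suc n)) < e"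
      using LIMSEQ_inverse_real_of_nat \<open>e > 0\<close> by (rule order_tendstoD)
    then show "\<forall>\<^sub>F n in sequentially. \<forall>x\<in>{a..b}. dist (poly (P n) x) (h x) < e"
    proof eventually_elim
      case (elim n)
      show ?case
      proof
        fix x assume "x \<in> {a..b}"
        then show "dist (poly (P n) x) (h x) < e"
          using less_trans[OF P[of x n] elim] by (simp only: dist_real_def)
      qed
    qed
  qed
  then show thesis by (rule that)
qed

context symmetric_operator
begin

definition approximates :: "(nat \<Rightarrow> real poly) \<Rightarrow> (real \<Rightarrow> real) \<Rightarrow> bool" where
  "approximates P h \<longleftrightarrow> uniform_limit spec (\<lambda>n. poly (P n)) h sequentially"

lemma approximates_exists:
  assumes h: "continuous_on UNIV h"
  shows "\<exists>P. approximates P h"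
proof -
  obtain K where "\<And>\<psi>. norm (A \<psi>) \<le> norm \<psi> * K" using A.bounded by blast
  then have K: "spec \<subseteq> {- K..K}" by (intro spec_bounded) (simp add: mult.commute)
  have "continuous_on {- K..K} h" by (rule continuous_on_subset[OF h]) auto
  then obtain P :: "nat \<Rightarrow> real poly" where "uniform_limit {- K..K} (\<lambda>n. poly (P n)) h sequentially"
    by (rule polynomial_sequence)
  then have "approximates P h"
    unfolding approximates_def by (rule uniform_limit_on_subset[OF _ K])
  then show ?thesis by blast
qed

text \<open>
  Two polynomial sequences with the same limit on the spectrum have the same operator limit,
  because their difference is small on the spectrum and hence in norm.
\<close>

lemma onorm_poly_op_diff_tendsto:
  assumes P: "approximates P h" and B: "bounded_linear B"
    and lim: "(\<lambda>n. onorm (\<lambda>\<psi>. poly_op (P n) A \<psi> - B \<psi>)) \<longlonglongrightarrow> 0"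
    and Q: "approximates Q h"
  shows "(\<lambda>n. onorm (\<lambda>\<psi>. poly_op (Q n) A \<psi> - B \<psi>)) \<longlonglongrightarrow> 0"
proof (rule LIMSEQ_I)
  fix e :: real assume "e > 0"
  have bl: "bounded_linear (\<lambda>\<psi>. poly_op P A \<psi> - B \<psi>)" for P
    by (intro bounded_linear_sub bounded_linear_poly_op blinear B)
  have "\<forall>\<^sub>F n in sequentially. \<forall>x\<in>spec. dist (poly (P n) x) (h x) < e / 4"
    using P \<open>e > 0\<close> unfolding approximates_def by (intro uniform_limitD) auto
  moreover have "\<forall>\<^sub>F n in sequentially. \<forall>x\<in>spec. dist (poly (Q n) x) (h x) < e / 4"
    using Q \<open>e > 0\<close> unfolding approximates_def by (intro uniform_limitD) auto
  moreover have "\<forall>\<^sub>F n in sequentially. onorm (\<lambda>\<psi>. poly_op (P n) A \<psi> - B \<psi>) < e / 4"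
    using lim \<open>e > 0\<close> by (intro order_tendstoD) auto
  ultimately have "\<forall>\<^sub>F n in sequentially. onorm (\<lambda>\<psi>. poly_op (Q n) A \<psi> - B \<psi>) < e"
  proof eventually_elim
    case (elim n)
    have "norm (poly_op (Q n) A \<psi> - B \<psi>) \<le> (3 * e / 4) * norm \<psi>" for \<psi>
    proof -
      have "\<bar>poly (Q n - P n) x\<bar> \<le> e / 2" if "x \<in> spec" for x
      proof -
        have "dist (poly (P n) x) (h x) < e / 4" "dist (poly (Q n) x) (h x) < e / 4"
          using elim that by auto
        then show ?thesis unfolding dist_real_def poly_diff by linarith
      qed
      then have "norm (poly_op (Q n - P n) A \<psi>) \<le> e / 2 * norm \<psi>" by (rule norm_poly_op_le)
      moreover have "norm (poly_op (P n) A \<psi> - B \<psi>) \<le> e / 4 * norm \<psi>"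
        using onorm[OF bl, of "P n" \<psi>] elim(3)
        by (meson mult_right_mono norm_ge_zero less_imp_le order_trans)
      moreover have "poly_op (Q n) A \<psi> - B \<psi> = poly_op (Q n - P n) A \<psi> + (poly_op (P n) A \<psi> - B \<psi>)"
        by (simp add: poly_op_minus)
      ultimately show ?thesis
        using norm_triangle_mono[of "poly_op (Q n - P n) A \<psi>" "e / 2 * norm \<psi>"
            "poly_op (P n) A \<psi> - B \<psi>" "e / 4 * norm \<psi>"] by (simp add: algebra_simps)
    qed
    then have "onorm (\<lambda>\<psi>. poly_op (Q n) A \<psi> - B \<psi>) \<le> 3 * e / 4"
      using \<open>e > 0\<close> by (intro onorm_bound) auto
    then show ?case using \<open>e > 0\<close> by simp
  qed
  then show "\<exists>N. \<forall>n\<ge>N. norm (onorm (\<lambda>\<psi>. poly_op (Q n) A \<psi> - B \<psi>) - 0) < e"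
    using onorm_pos_le[OF bl] by (simp add: eventually_sequentially)
qed

lemma poly_op_limit_exists:
  assumes P: "approximates P h"
  shows "\<exists>B. bounded_linear B \<and> (\<lambda>n. onorm (\<lambda>\<psi>. poly_op (P n) A \<psi> - B \<psi>)) \<longlonglongrightarrow> 0"
proof -
  define X where "X n = Blinfun (poly_op (P n) A)" for n
  have X: "blinfun_apply (X n) = poly_op (P n) A" for n
    unfolding X_def by (rule bounded_linear_Blinfun_apply[OF bounded_linear_poly_op[OF blinear]])
  have "Cauchy X"
  proof (rule metric_CauchyI)
    fix e :: real assume "e > 0"
    have "\<forall>\<^sub>F n in sequentially. \<forall>x\<in>spec. dist (poly (P n) x) (h x) < e / 4"
      using P \<open>e > 0\<close> unfolding approximates_def by (intro uniform_limitD) auto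
    then obtain N where N: "\<And>n x. n \<ge> N \<Longrightarrow> x \<in> spec \<Longrightarrow> dist (poly (P n) x) (h x) < e / 4"
      by (auto simp: eventually_sequentially)
    have "dist (X m) (X n) < e" if "m \<ge> N" "n \<ge> N" for m n
    proof -
      have "\<bar>poly (P m - P n) x\<bar> \<le> e / 2" if "x \<in> spec" for x
        using N[OF \<open>m \<ge> N\<close> that] N[OF \<open>n \<ge> N\<close> that]
        unfolding dist_real_def poly_diff by linarith
      then have "norm (poly_op (P m - P n) A \<psi>) \<le> e / 2 * norm \<psi>" for \<psi> by (rule norm_poly_op_le)
      then have "norm (X m - X n) \<le> e / 2"
        using \<open>e > 0\<close> by (intro norm_blinfun_bound) (auto simp: blinfun.diff_left X poly_op_minus)
      then show ?thesis using \<open>e > 0\<close> by (simp add: dist_norm)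
    qed
    then show "\<exists>M. \<forall>m\<ge>M. \<forall>n\<ge>M. dist (X m) (X n) < e" by blast
  qed
  then obtain B where "X \<longlonglongrightarrow> B" using Cauchy_convergent convergent_def by blast
  then have "(\<lambda>n. norm (X n - B)) \<longlonglongrightarrow> 0" by (simp add: LIM_zero tendsto_norm_zero)
  moreover have "blinfun_apply (X n - B) = (\<lambda>\<psi>. poly_op (P n) A \<psi> - blinfun_apply B \<psi>)" for n
    by (simp add: fun_eq_iff blinfun.diff_left X)
  ultimately have "(\<lambda>n. onorm (\<lambda>\<psi>. poly_op (P n) A \<psi> - blinfun_apply B \<psi>)) \<longlonglongrightarrow> 0"
    by (simp add: norm_blinfun.rep_eq)
  then show ?thesis using blinfun.bounded_linear_right[of B] by blast
qed

text \<open>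
  The description that defines the functional calculus is satisfied by the limit along one
  approximating sequence, and by nothing else, since such a sequence exists.
\<close>

lemma op_apply_limit:
  assumes h: "continuous_on UNIV h"
  shows "bounded_linear (op_apply h A)"
    and "approximates P h \<Longrightarrow> (\<lambda>n. onorm (\<lambda>\<psi>. poly_op (P n) A \<psi> - op_apply h A \<psi>)) \<longlonglongrightarrow> 0"
proof -
  obtain P0 where P0: "approximates P0 h"
    using approximates_exists[OF h] by blast
  obtain B where B: "bounded_linear B" "(\<lambda>n. onorm (\<lambda>\<psi>. poly_op (P0 n) A \<psi> - B \<psi>)) \<longlonglongrightarrow> 0"
    using poly_op_limit_exists[OF P0] by blast
  define is_lim where "is_lim B \<longleftrightarrow> bounded_linear B \<and> (\<forall>P. approximates P h \<longrightarrow>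
    (\<lambda>n. onorm (\<lambda>\<psi>. poly_op (P n) A \<psi> - B \<psi>)) \<longlonglongrightarrow> 0)" for B
  have "is_lim B"
    unfolding is_lim_def using B onorm_poly_op_diff_tendsto[OF P0 B] by blast
  moreover have "B' = B" if "is_lim B'" for B'
  proof
    fix \<psi>
    have lim: "(\<lambda>n. poly_op (P0 n) A \<psi>) \<longlonglongrightarrow> B'' \<psi>" if "is_lim B''" for B''
    proof -
      have bl: "bounded_linear (\<lambda>\<psi>. poly_op (P0 n) A \<psi> - B'' \<psi>)" for n
        using that by (intro bounded_linear_sub bounded_linear_poly_op blinear) (simp add: is_lim_def)
      have "(\<lambda>n. onorm (\<lambda>\<psi>. poly_op (P0 n) A \<psi> - B'' \<psi>) * norm \<psi>) \<longlonglongrightarrow> 0"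
        using that P0 by (auto simp: is_lim_def intro!: tendsto_mult_left_zero)
      then have "(\<lambda>n. poly_op (P0 n) A \<psi> - B'' \<psi>) \<longlonglongrightarrow> 0"
        by (rule Lim_null_comparison[rotated]) (use onorm[OF bl] in \<open>auto\<close>)
      then show ?thesis by (simp add: LIM_zero_iff)
    qed
    show "B' \<psi> = B \<psi>"
      using LIMSEQ_unique[OF lim[OF that] lim[OF \<open>is_lim B\<close>]] .
  qed
  ultimately have "is_lim (THE B. is_lim B)" by (rule theI)
  moreover have "(THE B. is_lim B) = op_apply h A"
    by (simp add: op_apply_def is_lim_def[abs_def] approximates_def real_spectrum_def)
  ultimately show "bounded_linear (op_apply h A)"
    and "approximates P h \<Longrightarrow> (\<lambda>n. onorm (\<lambda>\<psi>. poly_op (P n) A \<psi> - op_apply h A \<psi>)) \<longlonglongrightarrow> 0"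
    by (auto simp: is_lim_def)
qed

text \<open>
  A quantitative form with a single polynomial.  It allows the same polynomial and the same error
  to be used for all operators of a family.
\<close>

lemma norm_op_apply_diff_le:
  assumes h: "continuous_on UNIV h"
    and e: "\<And>x. x \<in> spec \<Longrightarrow> \<bar>poly P x - h x\<bar> \<le> e"
  shows "norm (poly_op P A \<psi> - op_apply h A \<psi>) \<le> e * norm \<psi>"
proof -
  obtain P0 where P0: "approximates P0 h"
    using approximates_exists[OF h] by blast
  show ?thesis
  proof (rule field_le_epsilon)
    fix r :: real assume "r > 0"
    define d where "d = r / (2 * (norm \<psi> + 1))"
    have n0: "norm \<psi> + 1 > 0" by (smt (verit) norm_ge_zero)
    then have "d > 0" using \<open>r > 0\<close> by (simp add: d_def)
    have "\<forall>\<^sub>F n in sequentially. \<forall>x\<in>spec. dist (poly (P0 n) x) (h x) < d"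
      using P0 \<open>d > 0\<close> unfolding approximates_def by (intro uniform_limitD) auto
    moreover have "\<forall>\<^sub>F n in sequentially. onorm (\<lambda>\<psi>. poly_op (P0 n) A \<psi> - op_apply h A \<psi>) < d"
      using op_apply_limit(2)[OF h P0] \<open>d > 0\<close> by (intro order_tendstoD) auto
    ultimately have "\<forall>\<^sub>F n in sequentially. (\<forall>x\<in>spec. dist (poly (P0 n) x) (h x) < d) \<and>
        onorm (\<lambda>\<psi>. poly_op (P0 n) A \<psi> - op_apply h A \<psi>) < d"
      by eventually_elim auto
    then obtain n where n: "\<And>x. x \<in> spec \<Longrightarrow> dist (poly (P0 n) x) (h x) < d"
      "onorm (\<lambda>\<psi>. poly_op (P0 n) A \<psi> - op_apply h A \<psi>) < d"
      by (auto simp: eventually_sequentially)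
    have "\<bar>poly (P - P0 n) x\<bar> \<le> e + d" if "x \<in> spec" for x
      using n(1)[OF that] e[OF that] by (simp add: dist_real_def)
    then have "norm (poly_op (P - P0 n) A \<psi>) \<le> (e + d) * norm \<psi>" by (rule norm_poly_op_le)
    moreover have "norm (poly_op (P0 n) A \<psi> - op_apply h A \<psi>) \<le> d * norm \<psi>"
    proof -
      have bl: "bounded_linear (\<lambda>\<psi>. poly_op (P0 n) A \<psi> - op_apply h A \<psi>)"
        by (intro bounded_linear_sub bounded_linear_poly_op blinear op_apply_limit h)
      show ?thesis
        using onorm[OF bl, of \<psi>] n(2) by (meson mult_right_mono norm_ge_zero less_imp_le order_trans)
    qed
    moreover have "poly_op P A \<psi> - op_apply h A \<psi>
        = poly_op (P - P0 n) A \<psi> + (poly_op (P0 n) A \<psi> - op_apply h A \<psi>)"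
      by (simp add: poly_op_minus)
    ultimately have "norm (poly_op P A \<psi> - op_apply h A \<psi>) \<le> (e + d) * norm \<psi> + d * norm \<psi>"
      by (simp only: norm_triangle_mono)
    also have "\<dots> = e * norm \<psi> + r * (norm \<psi> / (norm \<psi> + 1))"
    proof -
      have "2 * d = r / (norm \<psi> + 1)" using n0 by (simp add: d_def field_simps)
      then have "2 * d * norm \<psi> = r * (norm \<psi> / (norm \<psi> + 1))" by simp
      then show ?thesis by (simp add: distrib_right)
    qed
    also have "\<dots> \<le> e * norm \<psi> + r"
      using \<open>r > 0\<close> n0 by (simp add: field_simps)
    finally show "norm (poly_op P A \<psi> - op_apply h A \<psi>) \<le> e * norm \<psi> + r" .
  qed
qed

lemma op_apply_tendsto:
  assumes h: "continuous_on UNIV h" and P: "approximates P h"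
  shows "(\<lambda>n. poly_op (P n) A \<psi>) \<longlonglongrightarrow> op_apply h A \<psi>"
proof -
  have bl: "bounded_linear (\<lambda>\<psi>. poly_op (P n) A \<psi> - op_apply h A \<psi>)" for n
    by (intro bounded_linear_sub bounded_linear_poly_op blinear op_apply_limit h)
  have "(\<lambda>n. onorm (\<lambda>\<psi>. poly_op (P n) A \<psi> - op_apply h A \<psi>) * norm \<psi>) \<longlonglongrightarrow> 0"
    by (intro tendsto_mult_left_zero op_apply_limit h P)
  then have "(\<lambda>n. poly_op (P n) A \<psi> - op_apply h A \<psi>) \<longlonglongrightarrow> 0"
    by (rule Lim_null_comparison[rotated]) (use onorm[OF bl] in auto)
  then show ?thesis by (simp add: LIM_zero_iff)
qed

lemma op_apply_add:
  assumes f: "continuous_on UNIV f" and g: "continuous_on UNIV g"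
  shows "op_apply (\<lambda>x. f x + g x) A \<psi> = op_apply f A \<psi> + op_apply g A \<psi>"
proof -
  obtain P Q where PQ: "approximates P f" "approximates Q g"
    using approximates_exists f g by blast
  have "poly (P n + Q n) = (\<lambda>x. poly (P n) x + poly (Q n) x)" for n by (simp add: fun_eq_iff)
  then have "approximates (\<lambda>n. P n + Q n) (\<lambda>x. f x + g x)"
    using uniform_limit_add[OF PQ[unfolded approximates_def]] by (simp add: approximates_def)
  from op_apply_tendsto[OF continuous_on_add[OF f g] this, of \<psi>]
    tendsto_add[OF op_apply_tendsto[OF f PQ(1), of \<psi>] op_apply_tendsto[OF g PQ(2), of \<psi>]]
  show ?thesis by (simp add: poly_op_add LIMSEQ_unique)
qed

lemma op_apply_cmult:
  assumes f: "continuous_on UNIV f"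
  shows "op_apply (\<lambda>x. c * f x) A \<psi> = c *\<^sub>R op_apply f A \<psi>"
proof -
  obtain P where P: "approximates P f"
    using approximates_exists f by blast
  have "uniform_limit spec (\<lambda>n x. c * poly (P n) x) (\<lambda>x. c * f x) sequentially"
    using P unfolding approximates_def
    by (rule bounded_linear.uniform_limit[OF bounded_linear_mult_right])
  moreover have "poly (smult c (P n)) = (\<lambda>x. c * poly (P n) x)" for n by (simp add: fun_eq_iff)
  ultimately have "approximates (\<lambda>n. smult c (P n)) (\<lambda>x. c * f x)"
    by (simp add: approximates_def)
  from op_apply_tendsto[OF continuous_on_mult_left[OF f] this, of \<psi>]
    tendsto_scaleR[OF tendsto_const op_apply_tendsto[OF f P, of \<psi>], of c]
  show ?thesis by (simp add: poly_op_smult LIMSEQ_unique)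
qed

lemma op_apply_poly: "op_apply (poly P) A \<psi> = poly_op P A \<psi>"
  using norm_op_apply_diff_le[of "poly P" P 0 \<psi>] by (simp add: continuous_intros)

end



section \<open>Jacobi matrices\<close>

lemma surj_all: "surj f \<Longrightarrow> (\<forall>y. R y) \<longleftrightarrow> (\<forall>x. R (f x))"
proof (intro iffI allI)
  fix y assume "surj f" "\<forall>x. R (f x)"
  then have "R (f (inv f y))" by blast
  then show "R y" using \<open>surj f\<close> by (simp add: surj_f_inv_f)
qed simp

lemma poly_op_intertwine:
  assumes "linear A" "linear A'" "linear U" "\<And>\<psi>. A' (U \<psi>) = U (A \<psi>)"
  shows "poly_op P A' (U \<psi>) = U (poly_op P A \<psi>)"
  by (induction P)
    (simp_all add: poly_op_pCons[OF assms(1)] poly_op_pCons[OF assms(2)] linear_add[OF assms(3)]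
      linear_scale[OF assms(3)] linear_0[OF assms(3)] assms(4))

text \<open>
  Jacobi matrices have real entries, which makes the matrix elements in the density of states
  real numbers.
\<close>

definition real_vector :: "ell2 \<Rightarrow> bool" where
  "real_vector \<psi> \<longleftrightarrow> (\<forall>n. ell2_nth \<psi> n \<in> \<real>)"

text \<open>
  Jacobi operators depend on \<open>\<omega>\<close> only strongly continuously.  Continuity of each coordinate is all
  that matrix elements need, and it is preserved by the operators themselves.
\<close>

definition coord_continuous :: "('a::topological_space \<Rightarrow> ell2) \<Rightarrow> bool" where
  "coord_continuous f \<longleftrightarrow> (\<forall>n. continuous_on UNIV (\<lambda>\<omega>. ell2_nth (f \<omega>) n))"

locale bijective_dynamics =
  fixes T :: "'a \<Rightarrow> 'a"
  assumes bij_T: "bij T"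
begin

lemma iter_int_succ: "iter_int T (n + 1) \<omega> = T (iter_int T n \<omega>)"
proof (cases "0 \<le> n")
  case True
  then show ?thesis by (simp add: iter_int_def nat_add_distrib)
next
  case False
  define k where "k = nat (- (n + 1))"
  have n: "nat (- n) = Suc k" "n + 1 = - int k" using False by (auto simp: k_def)
  have "T (iter_int T n \<omega>) = (inv T ^^ k) \<omega>"
    using False bij_T by (simp add: iter_int_def n(1) surj_f_inv_f bij_is_surj)
  also have "\<dots> = iter_int T (n + 1) \<omega>" unfolding n(2) by (cases k) (auto simp: iter_int_def nat_add_distrib)
  finally show ?thesis ..
qed

lemma iter_int_T: "iter_int T n (T \<omega>) = iter_int T (n + 1) \<omega>"
proof (cases "0 \<le> n")
  case True
  then show ?thesis by (simp add: iter_int_def nat_add_distrib funpow_swap1)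
next
  case False
  define k where "k = nat (- (n + 1))"
  have n: "nat (- n) = Suc k" "n + 1 = - int k" using False by (auto simp: k_def)
  have "iter_int T n (T \<omega>) = (inv T ^^ k) \<omega>"
    using False bij_T by (simp add: iter_int_def n(1) bij_is_inj funpow_swap1)
  also have "\<dots> = iter_int T (n + 1) \<omega>" unfolding n(2) by (cases k) (auto simp: iter_int_def nat_add_distrib)
  finally show ?thesis .
qed

lemma iter_int_0 [simp]: "iter_int T 0 \<omega> = \<omega>"
  by (simp add: iter_int_def)

end

locale jacobi_family = bijective_dynamics T for T :: "'a \<Rightarrow> 'a" +
  fixes q p :: "'a \<Rightarrow> real" and Q P :: real
  assumes q_le: "\<And>\<omega>. \<bar>q \<omega>\<bar> \<le> Q" and p_le: "\<And>\<omega>. \<bar>p \<omega>\<bar> \<le> P"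
begin

abbreviation J :: "'a \<Rightarrow> ell2 \<Rightarrow> ell2" where
  "J \<equiv> jacobi T q p"

lemma nth_jacobi:
  "ell2_nth (J \<omega> \<psi>) n =
      of_real (p (iter_int T (n - 1) \<omega>)) * ell2_nth \<psi> (n - 1)
    + of_real (q (iter_int T n \<omega>)) * ell2_nth \<psi> n
    + of_real (p (iter_int T n \<omega>)) * ell2_nth \<psi> (n + 1)"
proof (rule ell2_nth_jacobi)
  show "bounded (range q)" using q_le by (auto simp: bounded_iff)
  show "bounded (range p)" using p_le by (auto simp: bounded_iff)
qed

lemma jacobi_eq_weighted_shifts:
  "J \<omega> \<psi> = weighted_shift (\<lambda>n. p (iter_int T (n - 1) \<omega>)) (- 1) \<psi>
    + weighted_shift (\<lambda>n. q (iter_int T n \<omega>)) 0 \<psi> + weighted_shift (\<lambda>n. p (iter_int T n \<omega>)) 1 \<psi>"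
  by (rule ell2_eqI)
    (simp only: nth_jacobi ell2_nth_simps ell2_nth_weighted_shift[where C = P, OF p_le]
      ell2_nth_weighted_shift[where C = Q, OF q_le], simp)

lemma norm_jacobi_le: "norm (J \<omega> \<psi>) \<le> (Q + 2 * P) * norm \<psi>"
proof -
  have "norm (J \<omega> \<psi>) \<le> P * norm \<psi> + Q * norm \<psi> + P * norm \<psi>"
    unfolding jacobi_eq_weighted_shifts
    by (intro norm_triangle_mono norm_weighted_shift_le p_le q_le)
  then show ?thesis by (simp add: algebra_simps)
qed

lemma symmetric_operator_jacobi: "symmetric_operator (J \<omega>)"
proof (rule symmetric_operator.intro)
  have "bounded_linear (\<lambda>\<psi>. weighted_shift (\<lambda>n. p (iter_int T (n - 1) \<omega>)) (- 1) \<psi>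
    + weighted_shift (\<lambda>n. q (iter_int T n \<omega>)) 0 \<psi> + weighted_shift (\<lambda>n. p (iter_int T n \<omega>)) 1 \<psi>)"
    by (intro bounded_linear_add bounded_linear_weighted_shift[where C = P, OF p_le]
        bounded_linear_weighted_shift[where C = Q, OF q_le])
  then show "bounded_linear (J \<omega>)" by (simp add: jacobi_eq_weighted_shifts[symmetric])
  show "J \<omega> (ell2_cscale z \<psi>) = ell2_cscale z (J \<omega> \<psi>)" for z \<psi>
    by (rule ell2_eqI) (simp add: nth_jacobi algebra_simps)
  show "inner (J \<omega> \<phi>) \<psi> = inner \<phi> (J \<omega> \<psi>)" for \<phi> \<psi>
    unfolding jacobi_eq_weighted_shifts
    using weighted_shift_adjoint[where C = P, OF p_le, of "\<lambda>n. iter_int T (n - 1) \<omega>" "- 1" \<phi> \<psi>]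
      weighted_shift_adjoint[where C = Q, OF q_le, of "\<lambda>n. iter_int T n \<omega>" 0 \<phi> \<psi>]
      weighted_shift_adjoint[where C = P, OF p_le, of "\<lambda>n. iter_int T n \<omega>" 1 \<phi> \<psi>]
    by (simp add: inner_add_left inner_add_right)
qed

lemma jacobi_shift: "J (T \<omega>) (ell2_shift \<psi>) = ell2_shift (J \<omega> \<psi>)"
  by (rule ell2_eqI) (simp add: nth_jacobi iter_int_T add_ac)

lemma linear_jacobi: "linear (J \<omega>)"
  by (rule bounded_linear.linear[OF symmetric_operator.blinear[OF symmetric_operator_jacobi]])

lemma poly_op_jacobi_shift: "poly_op R (J (T \<omega>)) (ell2_shift \<psi>) = ell2_shift (poly_op R (J \<omega>) \<psi>)"
  by (rule poly_op_intertwine)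
    (simp_all add: linear_jacobi jacobi_shift bounded_linear.linear[OF bounded_linear_ell2_shift])

lemma real_vector_jacobi: "real_vector \<psi> \<Longrightarrow> real_vector (J \<omega> \<psi>)"
  by (auto simp: real_vector_def nth_jacobi intro!: Reals_add Reals_mult)

lemma real_vector_poly_op_jacobi: "real_vector \<psi> \<Longrightarrow> real_vector (poly_op R (J \<omega>) \<psi>)"
proof (induction R)
  case (pCons a R)
  then show ?case
    using real_vector_jacobi[of "poly_op R (J \<omega>) \<psi>" \<omega>]
    by (auto simp: real_vector_def poly_op_pCons[OF linear_jacobi] scaleR_conv_of_real intro!: Reals_add Reals_mult)
qed (simp add: real_vector_def)

text \<open>
  Translation along the orbit is implemented by the unitary shift, so the operators along an orbit
  are unitarily equivalent.
\<close>

lemma jacobi_lower_bound_orbit: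
  "(\<forall>\<psi>. c * norm \<psi> \<le> norm (J (iter_int T m \<omega>) \<psi> - x *\<^sub>R \<psi>)) \<longleftrightarrow>
    (\<forall>\<psi>. c * norm \<psi> \<le> norm (J \<omega> \<psi> - x *\<^sub>R \<psi>))"
proof -
  have step: "(\<forall>\<psi>. c * norm \<psi> \<le> norm (J (T \<omega>) \<psi> - x *\<^sub>R \<psi>)) \<longleftrightarrow>
    (\<forall>\<psi>. c * norm \<psi> \<le> norm (J \<omega> \<psi> - x *\<^sub>R \<psi>))" for \<omega>
  proof -
    have "norm (J (T \<omega>) (ell2_shift \<psi>) - x *\<^sub>R ell2_shift \<psi>) = norm (J \<omega> \<psi> - x *\<^sub>R \<psi>)" for \<psi>
      using norm_ell2_shift[of "J \<omega> \<psi> - x *\<^sub>R \<psi>"]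
        bounded_linear_ell2_shift[THEN bounded_linear.linear]
      by (simp add: jacobi_shift linear_diff linear_scale)
    then show ?thesis
      using surj_all[OF surj_ell2_shift, of "\<lambda>\<psi>. c * norm \<psi> \<le> norm (J (T \<omega>) \<psi> - x *\<^sub>R \<psi>)"] by simp
  qed
  show ?thesis
  proof (induction m rule: int_induct[where k = 0])
    case (step2 i)
    then show ?case using step[of "iter_int T (i - 1) \<omega>"] iter_int_succ[of "i - 1" \<omega>] by simp
  qed (simp_all add: iter_int_succ step)
qed

end

lemma norm_ell2_power2_finite:
  assumes "finite F" "\<And>n. n \<notin> F \<Longrightarrow> ell2_nth \<psi> n = 0"
  shows "(norm \<psi>)\<^sup>2 = (\<Sum>n\<in>F. (cmod (ell2_nth \<psi> n))\<^sup>2)"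
proof -
  have "(norm \<psi>)\<^sup>2 = (\<Sum>\<^sub>\<infinity>n\<in>F. (cmod (ell2_nth \<psi> n))\<^sup>2)"
    unfolding norm_ell2_power2 by (rule infsum_cong_neutral) (use assms in auto)
  then show ?thesis using assms(1) by simp
qed

locale continuous_jacobi_family = jacobi_family T q p Q P
  for T :: "'a::metric_space \<Rightarrow> 'a" and q p Q P +
  assumes cont_T: "continuous_on UNIV T" and cont_inv_T: "continuous_on UNIV (inv T)"
    and cont_q: "continuous_on UNIV q" and cont_p: "continuous_on UNIV p"
begin

lemma continuous_on_iter_int: "continuous_on UNIV (iter_int T n)"
proof -
  have "continuous_on UNIV (f ^^ k)" if "continuous_on UNIV f" for f :: "'a \<Rightarrow> 'a" and k
  proof (induction k)
    case (Suc k)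
    show ?case using continuous_on_compose[OF Suc continuous_on_subset[OF that]] by simp
  qed (simp add: id_def)
  then show ?thesis by (simp add: iter_int_def cont_T cont_inv_T)
qed

lemma coord_continuous_jacobi:
  assumes "coord_continuous f"
  shows "coord_continuous (\<lambda>\<omega>. J \<omega> (f \<omega>))"
proof -
  have "continuous_on UNIV (\<lambda>\<omega>. g (iter_int T n \<omega>))" if "continuous_on UNIV g" for g :: "'a \<Rightarrow> real" and n
    by (rule continuous_on_compose2[OF that continuous_on_iter_int]) auto
  then show ?thesis
    using assms unfolding coord_continuous_def nth_jacobi
    by (auto intro!: continuous_intros cont_q cont_p)
qed

lemma coord_continuous_poly_op:
  assumes "coord_continuous f"
  shows "coord_continuous (\<lambda>\<omega>. poly_op R (J \<omega>) (f \<omega>))"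
proof (induction R)
  case (pCons a R)
  then show ?case
    using coord_continuous_jacobi[OF pCons.IH] assms
    by (auto simp: coord_continuous_def poly_op_pCons[OF linear_jacobi] intro!: continuous_intros)
qed (simp add: coord_continuous_def)

text \<open>
  On a finitely supported vector, \<open>\<parallel>(J\<^sub>\<eta> - x) \<psi>\<parallel>\<^sup>2\<close> is a finite sum that depends continuously on \<open>\<eta>\<close>.
  The lower bound therefore passes from the orbit to its closure on these vectors, and by density
  to all vectors.
\<close>

lemma jacobi_lower_bound_closure:
  assumes c: "\<And>\<psi>. c * norm \<psi> \<le> norm (J \<omega> \<psi> - x *\<^sub>R \<psi>)" "c \<ge> 0"
    and cl: "\<omega>' \<in> closure (range (\<lambda>m. iter_int T m \<omega>))"
  shows "c * norm \<psi> \<le> norm (J \<omega>' \<psi> - x *\<^sub>R \<psi>)"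
proof -
  have fin: "c * norm (ell2_cut N \<psi>) \<le> norm (J \<omega>' (ell2_cut N \<psi>) - x *\<^sub>R ell2_cut N \<psi>)" for N
  proof -
    define \<phi> where "\<phi> = ell2_cut N \<psi>"
    define g where "g \<eta> = (norm (J \<eta> \<phi> - x *\<^sub>R \<phi>))\<^sup>2" for \<eta>
    have g: "g \<eta> = (\<Sum>n\<in>{- int N - 1..int N + 1}. (cmod (ell2_nth (J \<eta> \<phi> - x *\<^sub>R \<phi>) n))\<^sup>2)" for \<eta>
      unfolding g_def by (rule norm_ell2_power2_finite) (auto simp: nth_jacobi \<phi>_def ell2_nth_cut)
    have "coord_continuous (\<lambda>\<eta>. J \<eta> \<phi>)"
      by (rule coord_continuous_jacobi) (simp add: coord_continuous_def)
    then have cont: "continuous_on UNIV g"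
      unfolding g[abs_def] by (auto simp: coord_continuous_def intro!: continuous_intros)
    have "closed {\<eta>. (c * norm \<phi>)\<^sup>2 \<le> g \<eta>}"
      by (intro closed_Collect_le cont continuous_on_const)
    moreover have "range (\<lambda>m. iter_int T m \<omega>) \<subseteq> {\<eta>. (c * norm \<phi>)\<^sup>2 \<le> g \<eta>}"
      using jacobi_lower_bound_orbit[of c _ \<omega> x] c by (auto simp: g_def intro!: power_mono)
    ultimately have "(c * norm \<phi>)\<^sup>2 \<le> g \<omega>'"
      using cl closure_minimal by blast
    then show ?thesis unfolding g_def \<phi>_def by (rule power2_le_imp_le) simp
  qed
  interpret bl: bounded_linear "J \<omega>'"
    by (rule symmetric_operator.blinear[OF symmetric_operator_jacobi])
  show ?thesis
  proof (rule LIMSEQ_le)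
    show "(\<lambda>N. c * norm (ell2_cut N \<psi>)) \<longlonglongrightarrow> c * norm \<psi>"
      by (intro tendsto_intros ell2_cut_tendsto)
    show "(\<lambda>N. norm (J \<omega>' (ell2_cut N \<psi>) - x *\<^sub>R ell2_cut N \<psi>)) \<longlonglongrightarrow> norm (J \<omega>' \<psi> - x *\<^sub>R \<psi>)"
      by (intro tendsto_intros ell2_cut_tendsto bl.tendsto)
  qed (use fin in blast)
qed

lemma real_spectrum_closure_mono:
  assumes "\<omega>' \<in> closure (range (\<lambda>m. iter_int T m \<omega>))"
  shows "real_spectrum (J \<omega>') \<subseteq> real_spectrum (J \<omega>)"
proof (rule subsetI, rule ccontr)
  fix x assume x: "x \<in> real_spectrum (J \<omega>')" "x \<notin> real_spectrum (J \<omega>)"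
  interpret \<omega>: symmetric_operator "J \<omega>" by (rule symmetric_operator_jacobi)
  interpret \<omega>': symmetric_operator "J \<omega>'" by (rule symmetric_operator_jacobi)
  obtain c where c: "c > 0" "\<And>\<psi>. c * norm \<psi> \<le> norm (J \<omega> \<psi> - x *\<^sub>R \<psi>)"
    using x(2) by (auto simp: \<omega>.real_notin_spec_iff bounded_below_def)
  have "c * norm \<psi> \<le> norm (J \<omega>' \<psi> - x *\<^sub>R \<psi>)" for \<psi>
    by (rule jacobi_lower_bound_closure[OF c(2) less_imp_le[OF c(1)] assms])
  then have "bounded_below (\<lambda>\<psi>. J \<omega>' \<psi> - x *\<^sub>R \<psi>)"
    unfolding bounded_below_def using c(1) by blast
  then show False using x(1) \<omega>'.real_notin_spec_iff by blast
qed

end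

section \<open>The almost-sure spectrum\<close>

locale ergodic_system =
  fixes T :: "'a::metric_space \<Rightarrow> 'a" and M :: "'a measure"
  assumes compact_space: "compact (UNIV :: 'a set)"
    and homeo: "homeomorphism UNIV UNIV T (inv T)"
    and ergodic: "ergodic_prob T M"
    and full_support: "measure_support M = UNIV"
begin

sublocale prob_space M
  using ergodic by (simp add: ergodic_prob_def)

lemma sets_M [measurable_cong]: "sets M = sets borel"
  using ergodic by (simp add: ergodic_prob_def)

lemma space_M: "space M = UNIV"
  using sets_eq_imp_space_eq[OF sets_M] by simp

sublocale bijective_dynamics T
proof
  show "bij T"
    using homeo by (intro o_bij[of "inv T"]) (auto simp: homeomorphism_def fun_eq_iff)
qed

lemma continuous_T: "continuous_on UNIV T" and continuous_inv_T: "continuous_on UNIV (inv T)"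
  using homeo by (auto simp: homeomorphism_def)

lemma T_measurable [measurable]: "T \<in> measurable M M" and distr_T: "distr M M T = M"
  using ergodic by (auto simp: ergodic_prob_def)

lemma continuous_borel_measurable:
  fixes f :: "'a \<Rightarrow> 'b::topological_space"
  assumes "continuous_on UNIV f"
  shows "f \<in> borel_measurable M"
  using borel_measurable_continuous_onI[OF assms] measurable_cong_sets[OF sets_M refl] by blast

lemma continuous_bounded:
  fixes f :: "'a \<Rightarrow> real"
  assumes "continuous_on UNIV f"
  shows "\<exists>B. \<forall>\<omega>. \<bar>f \<omega>\<bar> \<le> B"
proof -
  have "bounded (range f)" by (rule compact_imp_bounded[OF compact_continuous_image[OF assms compact_space]])
  then show ?thesis by (auto simp: bounded_iff)
qed

lemma integrable_continuous:
  fixes f :: "'a \<Rightarrow> real"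
  assumes "continuous_on UNIV f"
  shows "integrable M f"
proof -
  obtain B where "\<And>\<omega>. \<bar>f \<omega>\<bar> \<le> B" using continuous_bounded[OF assms] by blast
  then show ?thesis
    by (intro integrable_const_bound[where B = B] continuous_borel_measurable[OF assms]) auto
qed

lemma integral_T:
  fixes f :: "'a \<Rightarrow> real"
  assumes "continuous_on UNIV f"
  shows "(\<integral>\<omega>. f (T \<omega>) \<partial>M) = (\<integral>\<omega>. f \<omega> \<partial>M)"
  using integral_distr[OF T_measurable continuous_borel_measurable[OF assms]] distr_T by simp

text \<open>
  The set of points whose orbit meets a given nonempty open set is invariant and, by full support,
  not null; by ergodicity it has full measure.  Countably many balls, finitely many of each radius
  \<open>1 / (n + 1)\<close>, suffice to test density.
\<close>

lemma AE_dense_orbit: "AE \<omega> in M. closure (range (\<lambda>m. iter_int T m \<omega>)) = UNIV"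
proof -
  have cont_iter: "continuous_on UNIV (iter_int T n)" for n
  proof -
    interpret continuous_jacobi_family T "\<lambda>_. 0" "\<lambda>_. 0" 0 0
      by unfold_locales (auto intro: continuous_T continuous_inv_T)
    show ?thesis by (rule continuous_on_iter_int)
  qed
  have visit: "AE \<omega> in M. \<exists>m. iter_int T m \<omega> \<in> B" if B: "open B" "B \<noteq> {}" for B
  proof -
    define V where "V = (\<Union>m. iter_int T m -` B)"
    have "open V" unfolding V_def
      using continuous_open_vimage[OF B(1)] cont_iter by (auto simp: open_UN continuous_on_eq_continuous_at open_vimage B)
    then have V: "V \<in> sets M" by (simp add: sets_M)
    have "T -` V = V"
    proof (intro set_eqI iffI)
      fix \<omega> assume "\<omega> \<in> T -` V"
      then obtain m where "iter_int T m (T \<omega>) \<in> B" by (auto simp: V_def)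
      then show "\<omega> \<in> V" by (auto simp: V_def iter_int_T)
    next
      fix \<omega> assume "\<omega> \<in> V"
      then obtain m where "iter_int T m \<omega> \<in> B" by (auto simp: V_def)
      then have "iter_int T (m - 1) (T \<omega>) \<in> B" by (simp add: iter_int_T)
      then show "\<omega> \<in> T -` V" by (auto simp: V_def)
    qed
    then have "prob V = 0 \<or> prob V = 1" using ergodic V by (auto simp: ergodic_prob_def)
    moreover have "prob V \<noteq> 0"
    proof -
      obtain b where "b \<in> B" using B by blast
      then have "emeasure M B > 0" using B(1) full_support by (auto simp: measure_support_def)
      moreover have "B \<subseteq> V" by (auto simp: V_def intro!: exI[of _ 0])
      ultimately have "emeasure M V > 0" using emeasure_mono[OF _ V] by (meson less_le_trans)
      then show ?thesis by (simp add: emeasure_eq_measure)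
    qed
    ultimately have "AE \<omega> in M. \<omega> \<in> V" using V by (subst AE_in_set_eq_1) auto
    then show ?thesis by eventually_elim (auto simp: V_def)
  qed
  have "\<exists>F. finite F \<and> (UNIV :: 'a set) \<subseteq> (\<Union>x\<in>F. ball x (inverse (real (Suc n))))" for n
    using compact_space by (simp add: compact_eq_totally_bounded)
  then obtain F where F: "\<And>n. finite (F n)" "\<And>n. (UNIV :: 'a set) \<subseteq> (\<Union>x\<in>F n. ball x (inverse (real (Suc n))))"
    using choice[of "\<lambda>n F. finite F \<and> (UNIV :: 'a set) \<subseteq> (\<Union>x\<in>F. ball x (inverse (real (Suc n))))"] by blast
  have "AE \<omega> in M. \<forall>n. \<forall>x\<in>F n. \<exists>m. iter_int T m \<omega> \<in> ball x (inverse (real (Suc n)))"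
    unfolding AE_all_countable
    by (intro allI AE_finite_allI[OF F(1)] visit open_ball) simp
  then show ?thesis
  proof eventually_elim
    case (elim \<omega>)
    have "y \<in> closure (range (\<lambda>m. iter_int T m \<omega>))" for y
      unfolding closure_approachable
    proof (intro allI impI)
      fix e :: real assume "e > 0"
      then obtain n where n: "inverse (real (Suc n)) < e / 2" using reals_Archimedean[of "e / 2"] by auto
      have "y \<in> (\<Union>x\<in>F n. ball x (inverse (real (Suc n))))" using F(2)[of n] by (rule subsetD) simp
      then obtain x where x: "x \<in> F n" "dist x y < inverse (real (Suc n))" by (auto simp only: UN_iff mem_ball)
      have "\<exists>m. iter_int T m \<omega> \<in> ball x (inverse (real (Suc n)))" using elim x(1) by (simp only:)
      then obtain m where "dist x (iter_int T m \<omega>) < inverse (real (Suc n))" by (auto simp only: mem_ball)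
      then have "dist (iter_int T m \<omega>) y < e"
        using x(2) n dist_triangle[of "iter_int T m \<omega>" y x] by (simp add: dist_commute)
      then show "\<exists>z\<in>range (\<lambda>m. iter_int T m \<omega>). dist z y < e" by blast
    qed
    then show ?case by blast
  qed
qed

end

locale ergodic_jacobi_family = ergodic_system T M + continuous_jacobi_family T q p Q P
  for T :: "'a::metric_space \<Rightarrow> 'a" and M q p Q P
begin

text \<open>
  Along a dense orbit the closure of the orbit is the whole space, so two points with dense orbits
  have spectra contained in each other.
\<close>

lemma as_spectrum_props:
  shows "compact (as_spectrum T M q p)"
    and "closure (range (\<lambda>m. iter_int T m \<omega>)) = UNIV \<Longrightarrow> real_spectrum (J \<omega>) = as_spectrum T M q p"
proof -
  obtain \<omega>0 where \<omega>0: "closure (range (\<lambda>m. iter_int T m \<omega>0)) = UNIV"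
    using eventually_happens'[OF ae_filter_bot AE_dense_orbit] by blast
  define S where "S = real_spectrum (J \<omega>0)"
  have dense: "real_spectrum (J \<omega>) = S" if "closure (range (\<lambda>m. iter_int T m \<omega>)) = UNIV" for \<omega>
    unfolding S_def by (intro equalityI real_spectrum_closure_mono) (use that \<omega>0 in auto)
  have S: "compact S" unfolding S_def
    by (rule symmetric_operator.compact_spec[OF symmetric_operator_jacobi])
  have ae: "AE \<omega> in M. op_spectrum (J \<omega>) = complex_of_real ` S"
    using AE_dense_orbit
    by eventually_elim
      (simp add: symmetric_operator.op_spectrum_eq[OF symmetric_operator_jacobi] dense)
  have "as_spectrum T M q p = S"
    unfolding as_spectrum_def
  proof (rule the_equality)
    fix S' assume S': "compact S' \<and> (AE \<omega> in M. op_spectrum (J \<omega>) = complex_of_real ` S')"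
    have "AE \<omega> in M. complex_of_real ` S' = complex_of_real ` S"
      using ae conjunct2[OF S'] by eventually_elim simp
    then have "complex_of_real ` S' = complex_of_real ` S" by simp
    then show "S' = S" by (simp add: inj_image_eq_iff inj_of_real)
  qed (use S ae in simp)
  then show "compact (as_spectrum T M q p)"
    and "closure (range (\<lambda>m. iter_int T m \<omega>)) = UNIV \<Longrightarrow> real_spectrum (J \<omega>) = as_spectrum T M q p"
    using S dense by auto
qed

lemma AE_real_spectrum: "AE \<omega> in M. real_spectrum (J \<omega>) = as_spectrum T M q p"
  using AE_dense_orbit by eventually_elim (rule as_spectrum_props)

text \<open>
  A point whose orbit is not dense still lies in the closure of a dense orbit.
\<close>

lemma real_spectrum_subset: "real_spectrum (J \<omega>) \<subseteq> as_spectrum T M q p"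
proof -
  obtain \<omega>0 where \<omega>0: "closure (range (\<lambda>m. iter_int T m \<omega>0)) = UNIV"
    using eventually_happens'[OF ae_filter_bot AE_dense_orbit] by blast
  show ?thesis
    using real_spectrum_closure_mono[of \<omega> \<omega>0] as_spectrum_props(2)[OF \<omega>0] \<omega>0 by simp
qed

end



section \<open>Measures representing functionals on an interval\<close>

text \<open>
  A step that descends from \<open>a\<close> to \<open>b\<close> has an integral between the values of the distribution function
  at \<open>a\<close> and at \<open>b\<close>; right continuity does the rest.
\<close>

lemma real_distribution_eqI:
  assumes "real_distribution K" "real_distribution K'"
    and eq: "\<And>a b. a < b \<Longrightarrow> (\<integral>x. cts_step a b x \<partial>K) = (\<integral>x. cts_step a b x \<partial>K')"
  shows "K = K'"
proof (rule cdf_unique[OF assms(1,2)])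
  have le: "cdf K x \<le> cdf K' x" if "real_distribution K" "real_distribution K'"
    and eq: "\<And>a b. a < b \<Longrightarrow> (\<integral>x. cts_step a b x \<partial>K) = (\<integral>x. cts_step a b x \<partial>K')" for K K' x
  proof -
    interpret K: real_distribution K by fact
    interpret K': real_distribution K' by fact
    have "(cdf K' \<longlongrightarrow> cdf K' x) (at_right x)"
      using K'.cdf_is_right_cont[of x] by (simp add: continuous_within)
    moreover have "cdf K x \<le> cdf K' y" if "x < y" for y
      using K.cdf_cts_step(1)[OF that] K'.cdf_cts_step(2)[OF that] eq[OF that] by simp
    then have "\<forall>\<^sub>F y in at_right x. cdf K x \<le> cdf K' y"
      by (rule eventually_mono[OF eventually_at_right_less])
    ultimately show ?thesis by (rule tendsto_lowerbound) simp
  qed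
  show "cdf K = cdf K'"
    using le[OF assms] le[OF assms(2,1)] eq by (intro ext antisym) auto
qed

lemma continuous_on_cts_step: "a < b \<Longrightarrow> continuous_on UNIV (cts_step a b)"
  by (rule uniformly_continuous_imp_continuous[OF cts_step_uniformly_continuous])

text \<open>
  The Bernstein polynomials of degree \<open>N\<close>, transported to \<open>[-R, R]\<close>, form a partition of unity.  Their
  images under \<open>L\<close> are nonnegative weights on the equidistant nodes; the resulting discrete
  probability measures integrate \<open>f\<close> to \<open>L\<close> of its Bernstein approximation.  By Helly selection they
  have a weak limit point, which represents \<open>L\<close>.
\<close>

lemma riesz_interval:
  fixes L :: "(real \<Rightarrow> real) \<Rightarrow> real" and R :: real
  assumes add: "\<And>f g. continuous_on UNIV f \<Longrightarrow> continuous_on UNIV g \<Longrightarrow> L (\<lambda>x. f x + g x) = L f + L g"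
    and scale: "\<And>f c. continuous_on UNIV f \<Longrightarrow> L (\<lambda>x. c * f x) = c * L f"
    and one: "L (\<lambda>_. 1) = 1"
    and bound: "\<And>f e. continuous_on UNIV f \<Longrightarrow> (\<And>x. x \<in> {- R..R} \<Longrightarrow> \<bar>f x\<bar> \<le> e) \<Longrightarrow> \<bar>L f\<bar> \<le> e"
    and R: "0 < R"
  obtains K where "real_distribution K"
    "\<And>f :: real \<Rightarrow> real. continuous_on UNIV f \<Longrightarrow> integrable K f" "\<And>f. continuous_on UNIV f \<Longrightarrow> (\<integral>x. f x \<partial>K) = L f"
proof -
  have L_sum: "L (\<lambda>x. \<Sum>i\<in>I. c i * f i x) = (\<Sum>i\<in>I. c i * L (f i))"
    if "finite I" "\<And>i. continuous_on UNIV (f i)" for I :: "nat set" and c f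
    using that(1)
  proof (induction I)
    case empty
    show ?case using scale[of "\<lambda>_. 1" 0] by simp
  next
    case (insert i I)
    have "continuous_on UNIV (\<lambda>x. c i * f i x)" "continuous_on UNIV (\<lambda>x. \<Sum>i\<in>I. c i * f i x)"
      by (intro continuous_intros that(2))+
    then show ?case using insert by (simp add: add scale that(2))
  qed
  have L_diff: "L (\<lambda>x. f x - g x) = L f - L g" if "continuous_on UNIV f" "continuous_on UNIV g" for f g
    using add[OF that(1) continuous_on_mult_left[OF that(2), of "-1"]] scale[OF that(2), of "-1"] by simp
  have interval_bound: "\<exists>m. \<forall>x\<in>{- R..R}. \<bar>f x\<bar> \<le> m" if "continuous_on UNIV f" for f :: "real \<Rightarrow> real"
  proof -
    have "bounded (f ` {- R..R})"
      by (intro compact_imp_bounded compact_continuous_image continuous_on_subset[OF that]) auto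
    then show ?thesis by (force simp add: bounded_iff)
  qed
  \<comment> \<open>If \<open>0 \<le> f \<le> m\<close>, then \<open>\<bar>m - f\<bar> \<le> m\<close>, and the bound on \<open>L (m - f) = m - L f\<close> gives positivity.\<close>
  have L_nonneg: "0 \<le> L f" if f: "continuous_on UNIV f" "\<And>x. x \<in> {- R..R} \<Longrightarrow> 0 \<le> f x" for f
  proof -
    obtain m where m: "\<And>x. x \<in> {- R..R} \<Longrightarrow> \<bar>f x\<bar> \<le> m"
      using interval_bound[OF f(1)] by blast
    have "\<bar>L (\<lambda>x. m - f x)\<bar> \<le> m"
      by (rule bound) (use f m in \<open>force intro!: continuous_intros\<close>)+
    moreover have "L (\<lambda>x. m - f x) = m - L f"
      using L_diff[OF continuous_on_const f(1)] scale[of "\<lambda>_. 1" m] one by simp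
    ultimately show ?thesis by simp
  qed
  define y where "y x = (x + R) / (2 * R)" for x
  define \<xi> where "\<xi> N k = 2 * R * (real k / real N) - R" for N k :: nat
  define \<phi> where "\<phi> N k x = Bernstein N k (y x)" for N k x
  define w where "w N k = L (\<phi> N k)" for N k
  have cont: "continuous_on UNIV (\<phi> N k)" for N k
    unfolding \<phi>_def[abs_def] Bernstein_def y_def using R by (auto intro!: continuous_intros)
  have y01: "y x \<in> {0..1}" if "x \<in> {- R..R}" for x
    using that R by (auto simp: y_def)
  have w0: "0 \<le> w N k" for N k
    unfolding w_def by (rule L_nonneg[OF cont]) (use y01 in \<open>auto simp: \<phi>_def intro!: Bernstein_nonneg\<close>)
  have w1: "(\<Sum>k\<le>N. w N k) = 1" for N
    using L_sum[of "{..N}" "\<phi> N" "\<lambda>_. 1"] cont one by (simp add: w_def \<phi>_def)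
  have \<xi>: "\<xi> N k \<in> {- R..R}" if "k \<le> N" for N k
  proof -
    have "real k / real N \<le> 1" using that by (auto simp: divide_le_eq_1)
    then have "2 * R * (real k / real N) \<le> 2 * R * 1" by (rule mult_left_mono) (use R in simp)
    moreover have "0 \<le> 2 * R * (real k / real N)" using R by simp
    ultimately show ?thesis unfolding \<xi>_def atLeastAtMost_iff by linarith
  qed
  define W where "W N = point_measure {..N} (\<lambda>k. ennreal (w N k))" for N
  have prob_W: "prob_space (W N)" for N
    by (rule prob_spaceI)
      (simp add: W_def space_point_measure emeasure_point_measure_finite sum_ennreal w0 w1)
  define \<mu> where "\<mu> N = distr (W N) borel (\<xi> N)" for N
  have meas: "\<xi> N \<in> borel_measurable (W N)" for N
    by (simp add: W_def measurable_def sets_point_measure space_point_measure Pi_def)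
  have dist_\<mu>: "real_distribution (\<mu> N)" for N
    unfolding \<mu>_def by (rule prob_space.real_distribution_distr[OF prob_W meas])
  have int_\<mu>: "(\<integral>x. f x \<partial>\<mu> N) = (\<Sum>k\<le>N. w N k * f (\<xi> N k))"
    if "f \<in> borel_measurable borel" for f :: "real \<Rightarrow> real" and N
    unfolding \<mu>_def integral_distr[OF meas that]
    by (simp add: W_def lebesgue_integral_point_measure_finite w0)
  have lim: "(\<lambda>N. \<integral>x. f x \<partial>\<mu> N) \<longlonglongrightarrow> L f" if f: "continuous_on UNIV f" for f
  proof (rule LIMSEQ_I)
    fix e :: real assume "e > 0"
    define g where "g t = f (2 * R * t - R)" for t
    have "continuous_on {0..1} g"
      unfolding g_def by (rule continuous_on_compose2[OF f]) (auto intro!: continuous_intros)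
    then obtain N0 where N0: "\<And>n t. N0 \<le> n \<Longrightarrow> t \<in> {0..1} \<Longrightarrow>
        \<bar>g t - (\<Sum>k\<le>n. g (k / n) * Bernstein n k t)\<bar> < e / 2"
      using Bernstein_Weierstrass[of g "e / 2"] \<open>e > 0\<close> by auto
    have "norm ((\<integral>x. f x \<partial>\<mu> N) - L f) < e" if "N0 \<le> N" for N
    proof -
      have c: "continuous_on UNIV (\<lambda>x. \<Sum>k\<le>N. f (\<xi> N k) * \<phi> N k x)"
        by (intro continuous_intros cont)
      have "\<bar>f x - (\<Sum>k\<le>N. f (\<xi> N k) * \<phi> N k x)\<bar> \<le> e / 2" if x: "x \<in> {- R..R}" for x
      proof -
        have "g (y x) = f x" using R by (simp add: g_def y_def)
        then show ?thesis
          using N0[OF \<open>N0 \<le> N\<close> y01[OF x]] by (simp add: \<xi>_def \<phi>_def g_def)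
      qed
      then have "\<bar>L (\<lambda>x. f x - (\<Sum>k\<le>N. f (\<xi> N k) * \<phi> N k x))\<bar> \<le> e / 2"
        by (intro bound continuous_on_diff f c)
      then have "\<bar>L f - (\<Sum>k\<le>N. f (\<xi> N k) * w N k)\<bar> \<le> e / 2"
        by (simp add: L_diff[OF f c] L_sum cont w_def)
      then show ?thesis
        using \<open>e > 0\<close> f by (simp add: int_\<mu> borel_measurable_continuous_onI mult.commute abs_minus_commute)
    qed
    then show "\<exists>N0. \<forall>N\<ge>N0. norm ((\<integral>x. f x \<partial>\<mu> N) - L f) < e" by blast
  qed
  have "tight \<mu>"
    unfolding tight_def
  proof (intro conjI allI impI dist_\<mu>)
    fix e :: real assume "e > 0"
    have "measure (\<mu> N) {- R - 1<..R} = 1" for N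
    proof -
      have m: "(indicator {- R - 1<..R} :: real \<Rightarrow> real) \<in> borel_measurable borel" by simp
      have "measure (\<mu> N) {- R - 1<..R} = (\<integral>x. indicator {- R - 1<..R} x \<partial>\<mu> N)"
        by (simp add: \<mu>_def)
      also have "\<dots> = (\<Sum>k\<le>N. w N k)"
        unfolding int_\<mu>[OF m]
        by (rule sum.cong) (use \<xi> in \<open>force simp: indicator_def\<close>)+
      finally show ?thesis by (simp add: w1)
    qed
    then show "\<exists>a b. a < b \<and> (\<forall>n. 1 - e < measure (\<mu> n) {a<..b})"
      using \<open>e > 0\<close> R by (intro exI[of _ "- R - 1"] exI[of _ R]) auto
  qed
  then obtain r K where r: "strict_mono (r :: nat \<Rightarrow> nat)" and K: "real_distribution K" "weak_conv_m (\<mu> \<circ> r) K"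
    using tight_imp_convergent_subsubsequence[of \<mu> id] by (auto simp: strict_mono_def)
  interpret K: real_distribution K by (rule K)
  have bdd: "(\<integral>x. f x \<partial>K) = L f" if f: "continuous_on UNIV f" and B: "\<And>x. \<bar>f x\<bar> \<le> B" for f B
  proof -
    have "(\<lambda>n. \<integral>x. f x \<partial>(\<mu> \<circ> r) n) \<longlonglongrightarrow> (\<integral>x. f x \<partial>K)"
      by (rule weak_conv_imp_integral_bdd_continuous_conv[OF _ K, where B = B])
        (use f B dist_\<mu> in \<open>auto simp: continuous_on_eq_continuous_at\<close>)
    moreover have "(\<lambda>n. \<integral>x. f x \<partial>(\<mu> \<circ> r) n) \<longlonglongrightarrow> L f"
      using LIMSEQ_subseq_LIMSEQ[OF lim[OF f] r] by (simp add: o_def)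
    ultimately show ?thesis by (rule LIMSEQ_unique)
  qed
  define clamp where "clamp x = max (- R) (min R x)" for x
  have clamp: "clamp x \<in> {- R..R}" "x \<in> {- R..R} \<Longrightarrow> clamp x = x" for x
    using R by (auto simp: clamp_def)
  have cont_clamp: "continuous_on UNIV (\<lambda>x. f (clamp x))" if "continuous_on UNIV f" for f :: "real \<Rightarrow> real"
    unfolding clamp_def by (rule continuous_on_compose2[OF that]) (auto intro!: continuous_intros)
  \<comment> \<open>The limit lives on \<open>[-R, R]\<close>, because \<open>L\<close> does not see functions that vanish there.  Unbounded
      continuous functions may therefore be replaced by bounded ones.\<close>
  have supp: "AE x in K. clamp x = x"
  proof -
    define d where "d x = min 1 \<bar>clamp x - x\<bar>" for x
    have d: "continuous_on UNIV d" unfolding d_def clamp_def by (intro continuous_intros)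
    have "\<bar>L d\<bar> \<le> 0" by (rule bound[OF d]) (use clamp in \<open>simp add: d_def\<close>)
    then have "(\<integral>x. d x \<partial>K) = 0" using bdd[OF d, of 1] by (simp add: d_def)
    moreover have "integrable K d"
      by (rule K.integrable_const_bound[where B = 1])
        (auto simp: d_def[abs_def] clamp_def)
    ultimately have "AE x in K. d x = 0"
      by (subst (asm) integral_nonneg_eq_0_iff_AE) (auto simp: d_def)
    then show ?thesis by eventually_elim (auto simp: d_def min_def split: if_splits)
  qed
  have all: "integrable K f \<and> (\<integral>x. f x \<partial>K) = L f" if f: "continuous_on UNIV f" for f
  proof -
    obtain B where B: "\<And>x. x \<in> {- R..R} \<Longrightarrow> \<bar>f x\<bar> \<le> B"
      using interval_bound[OF f] by blast
    have fm: "f \<in> borel_measurable K"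
      using borel_measurable_continuous_onI[OF f] by simp
    have gm: "(\<lambda>x. f (clamp x)) \<in> borel_measurable K"
      using borel_measurable_continuous_onI[OF cont_clamp[OF f]] by simp
    have ae: "AE x in K. f (clamp x) = f x" using supp by eventually_elim simp
    have "integrable K (\<lambda>x. f (clamp x))"
      by (rule K.integrable_const_bound[where B = B]) (use B clamp gm in auto)
    then have "integrable K f"
      by (rule integrable_cong_AE_imp[OF _ fm]) (use ae in eventually_elim, auto)
    moreover have "(\<integral>x. f x \<partial>K) = (\<integral>x. f (clamp x) \<partial>K)"
      by (rule integral_cong_AE[OF fm gm]) (use ae in eventually_elim, auto)
    moreover have "\<dots> = L (\<lambda>x. f (clamp x))"
      by (rule bdd[OF cont_clamp[OF f], of B]) (use B clamp in auto)
    moreover have "\<bar>L (\<lambda>x. f x - f (clamp x))\<bar> \<le> 0"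
      by (rule bound) (use f cont_clamp clamp in \<open>auto intro!: continuous_intros\<close>)
    ultimately show ?thesis by (simp add: L_diff f cont_clamp)
  qed
  show thesis
  proof (rule that)
    show "real_distribution K" by (rule K)
    show "integrable K f" "(\<integral>x. f x \<partial>K) = L f" if "continuous_on UNIV f" for f
      using all[OF that] by auto
  qed
qed

section \<open>The density of states measure\<close>

context ergodic_jacobi_family
begin

abbreviation \<Sigma> :: "real set" where
  "\<Sigma> \<equiv> as_spectrum T M q p"

lemma real_spectrum_bounded: "real_spectrum (J \<omega>) \<subseteq> {- (Q + 2 * P)..Q + 2 * P}"
  by (rule symmetric_operator.spec_bounded[OF symmetric_operator_jacobi norm_jacobi_le])

text \<open>
  The matrix element \<open>\<langle>\<delta>\<^sub>0, h(J\<^sub>\<omega>) \<delta>\<^sub>0\<rangle>\<close>, which is real by \<open>op_apply_vacuum_real\<close>.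
\<close>

definition vacuum :: "(real \<Rightarrow> real) \<Rightarrow> 'a \<Rightarrow> real" where
  "vacuum h \<omega> = Re (ell2_nth (op_apply h (J \<omega>) (ell2_delta 0)) 0)"

definition spectral_mean :: "(real \<Rightarrow> real) \<Rightarrow> real" where
  "spectral_mean h = (\<integral>\<omega>. vacuum h \<omega> \<partial>M)"

lemma op_apply_vacuum_real:
  assumes h: "continuous_on UNIV h"
  shows "ell2_nth (op_apply h (J \<omega>) (ell2_delta 0)) 0 = complex_of_real (vacuum h \<omega>)"
proof -
  interpret symmetric_operator "J \<omega>" by (rule symmetric_operator_jacobi)
  obtain R where R: "approximates R h" using approximates_exists[OF h] by blast
  have lim: "(\<lambda>n. ell2_nth (poly_op (R n) (J \<omega>) (ell2_delta 0)) 0)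
      \<longlonglongrightarrow> ell2_nth (op_apply h (J \<omega>) (ell2_delta 0)) 0"
    by (rule bounded_linear.tendsto[OF bounded_linear_ell2_nth op_apply_tendsto[OF h R]])
  have "ell2_nth (poly_op (R n) (J \<omega>) (ell2_delta 0)) 0 \<in> \<real>" for n
  proof -
    have "real_vector (poly_op (R n) (J \<omega>) (ell2_delta 0))"
      by (rule real_vector_poly_op_jacobi) (simp add: real_vector_def)
    then show ?thesis by (simp only: real_vector_def)
  qed
  then have "ell2_nth (op_apply h (J \<omega>) (ell2_delta 0)) 0 \<in> \<real>"
    by (rule closed_sequentially[OF closed_complex_Reals _ lim])
  then show ?thesis by (simp only: vacuum_def of_real_Re)
qed

lemma vacuum_diff_le:
  assumes h: "continuous_on UNIV h"
    and e: "\<And>x. x \<in> real_spectrum (J \<omega>) \<Longrightarrow> \<bar>poly R x - h x\<bar> \<le> e"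
  shows "\<bar>Re (ell2_nth (poly_op R (J \<omega>) (ell2_delta 0)) 0) - vacuum h \<omega>\<bar> \<le> e"
proof -
  let ?\<phi> = "poly_op R (J \<omega>) (ell2_delta 0) - op_apply h (J \<omega>) (ell2_delta 0)"
  have "\<bar>Re (ell2_nth ?\<phi> 0)\<bar> \<le> norm ?\<phi>"
    using abs_Re_le_cmod[of "ell2_nth ?\<phi> 0"] cmod_ell2_nth_le[of ?\<phi> 0] by linarith
  also have "\<dots> \<le> e"
    using symmetric_operator.norm_op_apply_diff_le[OF symmetric_operator_jacobi h e, where \<psi> = "ell2_delta 0"]
    by (simp add: norm_ell2_delta)
  finally show ?thesis by (simp add: vacuum_def)
qed

lemma continuous_vacuum_poly: "continuous_on UNIV (\<lambda>\<omega>. Re (ell2_nth (poly_op R (J \<omega>) (ell2_delta 0)) 0))"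
proof -
  have "coord_continuous (\<lambda>\<omega>. poly_op R (J \<omega>) (ell2_delta 0))"
    by (rule coord_continuous_poly_op) (simp add: coord_continuous_def)
  then have "continuous_on UNIV (\<lambda>\<omega>. ell2_nth (poly_op R (J \<omega>) (ell2_delta 0)) 0)"
    by (simp only: coord_continuous_def)
  then show ?thesis by (rule continuous_on_Re)
qed

text \<open>
  All spectra lie in one interval, so polynomials that approximate \<open>h\<close> there approximate the matrix
  elements uniformly in \<open>\<omega>\<close>.
\<close>

lemma continuous_vacuum:
  assumes h: "continuous_on UNIV h"
  shows "continuous_on UNIV (vacuum h)"
proof -
  define K where "K = Q + 2 * P"
  have "continuous_on {- K..K} h" by (rule continuous_on_subset[OF h]) auto
  then obtain R :: "nat \<Rightarrow> real poly" where R: "uniform_limit {- K..K} (\<lambda>n. poly (R n)) h sequentially"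
    by (rule polynomial_sequence)
  have "uniform_limit UNIV (\<lambda>n \<omega>. Re (ell2_nth (poly_op (R n) (J \<omega>) (ell2_delta 0)) 0)) (vacuum h) sequentially"
  proof (rule uniform_limitI)
    fix e :: real assume "e > 0"
    then have "\<forall>\<^sub>F n in sequentially. \<forall>x\<in>{- K..K}. dist (poly (R n) x) (h x) < e / 2"
      by (intro uniform_limitD[OF R]) auto
    then show "\<forall>\<^sub>F n in sequentially. \<forall>\<omega>\<in>UNIV.
        dist (Re (ell2_nth (poly_op (R n) (J \<omega>) (ell2_delta 0)) 0)) (vacuum h \<omega>) < e"
    proof eventually_elim
      case (elim n)
      have "dist (Re (ell2_nth (poly_op (R n) (J \<omega>) (ell2_delta 0)) 0)) (vacuum h \<omega>) \<le> e / 2" for \<omega>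
        unfolding dist_real_def
      proof (rule vacuum_diff_le[OF h])
        fix x assume "x \<in> real_spectrum (J \<omega>)"
        then have "x \<in> {- K..K}" using subsetD[OF real_spectrum_bounded] unfolding K_def by blast
        then show "\<bar>poly (R n) x - h x\<bar> \<le> e / 2"
          using elim by (auto simp: dist_real_def less_imp_le)
      qed
      moreover have "e / 2 < e" using \<open>e > 0\<close> by simp
      ultimately show ?case using le_less_trans by blast
    qed
  qed
  then show ?thesis
    by (rule uniform_limit_theorem[rotated]) (simp_all add: continuous_vacuum_poly)
qed

lemma spectral_mean_diff_le:
  assumes h: "continuous_on UNIV h"
    and e: "\<And>\<omega> x. x \<in> real_spectrum (J \<omega>) \<Longrightarrow> \<bar>poly R x - h x\<bar> \<le> e"
  shows "\<bar>(\<integral>\<omega>. Re (ell2_nth (poly_op R (J \<omega>) (ell2_delta 0)) 0) \<partial>M) - spectral_mean h\<bar> \<le> e"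
proof -
  have i: "integrable M (\<lambda>\<omega>. Re (ell2_nth (poly_op R (J \<omega>) (ell2_delta 0)) 0) - vacuum h \<omega>)"
    by (intro integrable_continuous continuous_on_diff continuous_vacuum_poly continuous_vacuum h)
  have "\<bar>\<integral>\<omega>. Re (ell2_nth (poly_op R (J \<omega>) (ell2_delta 0)) 0) - vacuum h \<omega> \<partial>M\<bar>
      \<le> (\<integral>\<omega>. \<bar>Re (ell2_nth (poly_op R (J \<omega>) (ell2_delta 0)) 0) - vacuum h \<omega>\<bar> \<partial>M)"
    by (rule integral_abs_bound)
  also have "\<dots> \<le> (\<integral>\<omega>. e \<partial>M)"
    by (rule integral_mono[OF integrable_abs[OF i]]) (simp_all add: vacuum_diff_le[OF h e])
  finally show ?thesis
    by (simp add: spectral_mean_def prob_space integrable_continuous continuous_vacuum_poly continuous_vacuum h)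
qed

lemma spectral_mean_le:
  assumes h: "continuous_on UNIV h" and e: "\<And>\<omega> x. x \<in> real_spectrum (J \<omega>) \<Longrightarrow> \<bar>h x\<bar> \<le> e"
  shows "\<bar>spectral_mean h\<bar> \<le> e"
proof -
  have "\<bar>(\<integral>\<omega>. Re (ell2_nth (poly_op 0 (J \<omega>) (ell2_delta 0)) 0) \<partial>M) - spectral_mean h\<bar> \<le> e"
    by (rule spectral_mean_diff_le[OF h]) (simp add: e)
  then show ?thesis by simp
qed

lemma spectral_mean_add:
  assumes "continuous_on UNIV f" "continuous_on UNIV g"
  shows "spectral_mean (\<lambda>x. f x + g x) = spectral_mean f + spectral_mean g"
proof -
  have "vacuum (\<lambda>x. f x + g x) = (\<lambda>\<omega>. vacuum f \<omega> + vacuum g \<omega>)"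
    using assms by (simp add: fun_eq_iff vacuum_def symmetric_operator.op_apply_add[OF symmetric_operator_jacobi])
  then show ?thesis
    using assms by (simp add: spectral_mean_def integrable_continuous continuous_vacuum)
qed

lemma spectral_mean_cmult:
  assumes "continuous_on UNIV f"
  shows "spectral_mean (\<lambda>x. c * f x) = c * spectral_mean f"
proof -
  have "vacuum (\<lambda>x. c * f x) = (\<lambda>\<omega>. c * vacuum f \<omega>)"
    using assms by (simp add: fun_eq_iff vacuum_def symmetric_operator.op_apply_cmult[OF symmetric_operator_jacobi])
  then show ?thesis by (simp add: spectral_mean_def)
qed

lemma spectral_mean_one: "spectral_mean (\<lambda>_. 1) = 1"
proof -
  have "op_apply (\<lambda>_. 1) (J \<omega>) (ell2_delta 0) = ell2_delta 0" for \<omega>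
  proof -
    have one: "poly 1 = (\<lambda>_. 1 :: real)" by (simp add: fun_eq_iff)
    have "op_apply (poly 1) (J \<omega>) (ell2_delta 0) = poly_op 1 (J \<omega>) (ell2_delta 0)"
      by (rule symmetric_operator.op_apply_poly[OF symmetric_operator_jacobi])
    then show ?thesis unfolding one by (simp add: poly_op_def)
  qed
  then show ?thesis by (simp add: spectral_mean_def vacuum_def prob_space)
qed

definition is_dos :: "real measure \<Rightarrow> bool" where
  "is_dos K \<longleftrightarrow> real_distribution K \<and>
    (\<forall>h. continuous_on UNIV h \<longrightarrow> integrable K h \<and> (\<integral>x. h x \<partial>K) = spectral_mean h)"

lemma is_dosD:
  assumes "is_dos K"
  shows "real_distribution K"
    and "continuous_on UNIV h \<Longrightarrow> integrable K h"
    and "continuous_on UNIV h \<Longrightarrow> (\<integral>x. h x \<partial>K) = spectral_mean h"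
proof -
  note * = assms[unfolded is_dos_def]
  show "real_distribution K" by (rule conjunct1[OF *])
  show "integrable K h" if "continuous_on UNIV h" by (rule conjunct1[OF conjunct2[OF *, THEN spec, THEN mp, OF that]])
  show "(\<integral>x. h x \<partial>K) = spectral_mean h" if "continuous_on UNIV h"
    by (rule conjunct2[OF conjunct2[OF *, THEN spec, THEN mp, OF that]])
qed

text \<open>
  The defining property is required for all continuous functions; the constant \<open>1\<close> makes any
  competitor a probability measure, and piecewise linear steps determine its distribution function.
\<close>

lemma dos_measure_eqI:
  assumes "is_dos K"
  shows "dos_measure T M q p = K"
  unfolding dos_measure_def
proof (rule the_equality)
  have mean: "(\<integral>\<omega>. ell2_cinner (ell2_delta 0) (op_apply h (J \<omega>) (ell2_delta 0)) \<partial>M)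
      = complex_of_real (spectral_mean h)" if "continuous_on UNIV h" for h
    unfolding ell2_cinner_delta op_apply_vacuum_real[OF that] spectral_mean_def
    by (rule integral_complex_of_real)
  have K: "real_distribution K" using assms by (rule is_dosD)
  show "sets K = sets borel \<and> (\<forall>h. continuous_on UNIV h \<longrightarrow> integrable K h \<and>
      complex_of_real (\<integral>x. h x \<partial>K) =
        (\<integral>\<omega>. ell2_cinner (ell2_delta 0) (op_apply h (J \<omega>) (ell2_delta 0)) \<partial>M))"
  proof (intro conjI allI impI)
    show "sets K = sets borel" by (rule real_distribution.events_eq_borel[OF K])
    fix h :: "real \<Rightarrow> real" assume h: "continuous_on UNIV h"
    show "integrable K h" by (rule is_dosD(2)[OF assms h])
    show "complex_of_real (\<integral>x. h x \<partial>K) =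
        (\<integral>\<omega>. ell2_cinner (ell2_delta 0) (op_apply h (J \<omega>) (ell2_delta 0)) \<partial>M)"
      by (simp only: mean[OF h] is_dosD(3)[OF assms h])
  qed
  fix K' assume K': "sets K' = sets borel \<and> (\<forall>h. continuous_on UNIV h \<longrightarrow> integrable K' h \<and>
      complex_of_real (\<integral>x. h x \<partial>K') =
        (\<integral>\<omega>. ell2_cinner (ell2_delta 0) (op_apply h (J \<omega>) (ell2_delta 0)) \<partial>M))"
  have int: "integrable K' h" "(\<integral>x. h x \<partial>K') = spectral_mean h" if "continuous_on UNIV h" for h
  proof -
    have "complex_of_real (\<integral>x. h x \<partial>K') = complex_of_real (spectral_mean h)"
      using K' that unfolding mean[OF that, symmetric] by blast
    then show "(\<integral>x. h x \<partial>K') = spectral_mean h" by (simp only: of_real_eq_iff)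
    show "integrable K' h" using K' that by blast
  qed
  have "emeasure K' (space K') = 1"
  proof -
    have "integrable K' (\<lambda>_. 1 :: real)" by (rule int) simp
    then have "emeasure K' (space K') < \<infinity>" by (simp add: integrable_iff_bounded)
    moreover have "measure K' (space K') = 1" using int(2)[of "\<lambda>_. 1"] by (simp add: spectral_mean_one)
    ultimately show ?thesis by (simp add: emeasure_eq_ennreal_measure)
  qed
  then have "real_distribution K'"
    using conjunct1[OF K'] by (intro real_distribution.intro prob_spaceI real_distribution_axioms.intro)
  then show "K' = K"
  proof (rule real_distribution_eqI[OF _ K])
    fix a b :: real assume "a < b"
    then have c: "continuous_on UNIV (cts_step a b)" by (rule continuous_on_cts_step)
    then show "(\<integral>x. cts_step a b x \<partial>K') = (\<integral>x. cts_step a b x \<partial>K)"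
      by (simp only: int(2)[OF c] is_dosD(3)[OF assms c])
  qed
qed

lemma is_dos_dos_measure: "is_dos (dos_measure T M q p)"
proof -
  define R where "R = \<bar>Q + 2 * P\<bar> + 1"
  have R: "real_spectrum (J \<omega>) \<subseteq> {- R..R}" for \<omega>
    by (rule order_trans[OF real_spectrum_bounded]) (auto simp: R_def)
  obtain K where "real_distribution K" "\<And>f :: real \<Rightarrow> real. continuous_on UNIV f \<Longrightarrow> integrable K f"
    "\<And>f. continuous_on UNIV f \<Longrightarrow> (\<integral>x. f x \<partial>K) = spectral_mean f"
  proof (rule riesz_interval[of spectral_mean R])
    show "\<bar>spectral_mean f\<bar> \<le> e" if "continuous_on UNIV f" "\<And>x. x \<in> {- R..R} \<Longrightarrow> \<bar>f x\<bar> \<le> e" for f e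
      by (rule spectral_mean_le[OF that(1)], rule that(2), rule subsetD[OF R])
    show "0 < R" by (simp add: R_def)
  qed (simp_all add: spectral_mean_add spectral_mean_cmult spectral_mean_one)
  then have "is_dos K" unfolding is_dos_def by blast
  then show ?thesis using dos_measure_eqI by simp
qed

lemmas real_distribution_dos = is_dosD(1)[OF is_dos_dos_measure]
  and integrable_dos = is_dosD(2)[OF is_dos_dos_measure]
  and integral_dos = is_dosD(3)[OF is_dos_dos_measure]

lemma as_spectrum_nonempty: "\<Sigma> \<noteq> {}"
proof -
  obtain x where "x \<in> real_spectrum (J undefined)"
    using symmetric_operator.spec_nonempty[OF symmetric_operator_jacobi[of undefined]] by auto
  then show ?thesis using real_spectrum_subset[of undefined] by auto
qed

text \<open>
  Integrate the distance to the spectrum: it vanishes on the spectrum, hence so does its functional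
  calculus.
\<close>

lemma AE_dos_in_spectrum: "AE x in dos_measure T M q p. x \<in> \<Sigma>"
proof -
  define g where "g x = infdist x \<Sigma>" for x
  have g: "continuous_on UNIV g"
    unfolding g_def[abs_def] by (rule continuous_on_infdist[OF continuous_on_id])
  have "\<bar>spectral_mean g\<bar> \<le> 0"
    by (rule spectral_mean_le[OF g]) (use subsetD[OF real_spectrum_subset] in \<open>simp add: g_def\<close>)
  then have "(\<integral>x. g x \<partial>dos_measure T M q p) = 0" "integrable (dos_measure T M q p) g"
    using integral_dos[OF g] integrable_dos[OF g] by simp_all
  then have "AE x in dos_measure T M q p. g x = 0"
    by (subst (asm) integral_nonneg_eq_0_iff_AE) (auto simp: g_def infdist_nonneg)
  then show ?thesis
    by eventually_elim
      (use in_closed_iff_infdist_zero[OF compact_imp_closed[OF as_spectrum_props(1)] as_spectrum_nonempty]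
        in \<open>auto simp: g_def\<close>)
qed

end



section \<open>The trace per unit volume\<close>

context ergodic_system
begin

text \<open>
  Equivariance under the translation is what makes the trace below cyclic.  The continuity
  condition makes matrix elements continuous, hence integrable, and is stated for arguments
  depending on \<open>\<omega>\<close> so that it passes to products.
\<close>

definition covariant :: "('a \<Rightarrow> ell2 \<Rightarrow> ell2) \<Rightarrow> bool" where
  "covariant X \<longleftrightarrow> (\<forall>\<omega>. linear (X \<omega>)) \<and> (\<forall>\<omega> \<psi>. X (T \<omega>) (ell2_shift \<psi>) = ell2_shift (X \<omega> \<psi>)) \<and>
    (\<forall>f. coord_continuous f \<longrightarrow> coord_continuous (\<lambda>\<omega>. X \<omega> (f \<omega>)))"

definition trace :: "('a \<Rightarrow> ell2 \<Rightarrow> ell2) \<Rightarrow> real" where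
  "trace X = (\<integral>\<omega>. Re (ell2_nth (X \<omega> (ell2_delta 0)) 0) \<partial>M)"

lemma coord_continuous_const: "coord_continuous (\<lambda>_. \<psi>)"
  by (simp add: coord_continuous_def)

lemma covariantD:
  assumes "covariant X"
  shows "linear (X \<omega>)" "X (T \<omega>) (ell2_shift \<psi>) = ell2_shift (X \<omega> \<psi>)"
    "coord_continuous f \<Longrightarrow> coord_continuous (\<lambda>\<omega>. X \<omega> (f \<omega>))"
proof -
  note * = assms[unfolded covariant_def]
  show "linear (X \<omega>)" by (rule spec[OF conjunct1[OF *]])
  show "X (T \<omega>) (ell2_shift \<psi>) = ell2_shift (X \<omega> \<psi>)"
    by (rule spec[OF spec[OF conjunct1[OF conjunct2[OF *]]]])
  show "coord_continuous (\<lambda>\<omega>. X \<omega> (f \<omega>))" if "coord_continuous f"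
    by (rule mp[OF spec[OF conjunct2[OF conjunct2[OF *]]] that])
qed

lemma continuous_matrix_element:
  assumes "covariant X"
  shows "continuous_on UNIV (\<lambda>\<omega>. Re (ell2_nth (X \<omega> (ell2_delta k)) n))"
proof -
  have "coord_continuous (\<lambda>\<omega>. X \<omega> (ell2_delta k))"
    by (rule covariantD(3)[OF assms coord_continuous_const])
  then have "continuous_on UNIV (\<lambda>\<omega>. ell2_nth (X \<omega> (ell2_delta k)) n)"
    unfolding coord_continuous_def by (rule spec)
  then show ?thesis by (rule continuous_on_Re)
qed

lemma covariant_comp:
  assumes "covariant X" "covariant Y"
  shows "covariant (\<lambda>\<omega> \<psi>. X \<omega> (Y \<omega> \<psi>))"
  unfolding covariant_def
proof (intro conjI allI impI)
  show "linear (\<lambda>\<psi>. X \<omega> (Y \<omega> \<psi>))" for \<omega>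
    using linear_compose[OF covariantD(1)[OF assms(2)] covariantD(1)[OF assms(1)]] by (simp only: o_def)
  show "X (T \<omega>) (Y (T \<omega>) (ell2_shift \<psi>)) = ell2_shift (X \<omega> (Y \<omega> \<psi>))" for \<omega> \<psi>
    by (simp only: covariantD(2)[OF assms(1)] covariantD(2)[OF assms(2)])
  show "coord_continuous (\<lambda>\<omega>. X \<omega> (Y \<omega> (f \<omega>)))" if "coord_continuous f" for f
    by (rule covariantD(3)[OF assms(1) covariantD(3)[OF assms(2) that]])
qed

lemma covariant_add:
  assumes "covariant X" "covariant Y"
  shows "covariant (\<lambda>\<omega> \<psi>. X \<omega> \<psi> + Y \<omega> \<psi>)"
  unfolding covariant_def
proof (intro conjI allI impI)
  show "linear (\<lambda>\<psi>. X \<omega> \<psi> + Y \<omega> \<psi>)" for \<omega>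
    by (intro linear_compose_add covariantD(1) assms)
  show "X (T \<omega>) (ell2_shift \<psi>) + Y (T \<omega>) (ell2_shift \<psi>) = ell2_shift (X \<omega> \<psi> + Y \<omega> \<psi>)" for \<omega> \<psi>
    by (simp only: covariantD(2)[OF assms(1)] covariantD(2)[OF assms(2)]
        linear_add[OF bounded_linear.linear[OF bounded_linear_ell2_shift]])
  show "coord_continuous (\<lambda>\<omega>. X \<omega> (f \<omega>) + Y \<omega> (f \<omega>))" if "coord_continuous f" for f
    using covariantD(3)[OF assms(1) that] covariantD(3)[OF assms(2) that]
    by (simp add: coord_continuous_def continuous_on_add)
qed

lemma covariant_scaleR: "covariant (\<lambda>\<omega> \<psi>. a *\<^sub>R \<psi>)"
  unfolding covariant_def
  by (auto simp: coord_continuous_def linear_iff scaleR_add_right intro!: ell2_eqI continuous_intros)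

lemma trace_add:
  assumes "covariant X" "covariant Y"
  shows "trace (\<lambda>\<omega> \<psi>. X \<omega> \<psi> + Y \<omega> \<psi>) = trace X + trace Y"
  unfolding trace_def
  by (simp add: integrable_continuous continuous_matrix_element assms)

end

context ergodic_jacobi_family
begin

lemma poly_op_jacobi_bounded: "\<exists>K\<ge>0. \<forall>\<omega> \<psi>. norm (poly_op R (J \<omega>) \<psi>) \<le> K * norm \<psi>"
proof (induction R)
  case 0
  then show ?case by (auto intro!: exI[of _ 0])
next
  case (pCons a R)
  then obtain K where K: "K \<ge> 0" "\<And>\<omega> \<psi>. norm (poly_op R (J \<omega>) \<psi>) \<le> K * norm \<psi>" by blast
  define m where "m = \<bar>Q + 2 * P\<bar>"
  have "norm (poly_op (pCons a R) (J \<omega>) \<psi>) \<le> (\<bar>a\<bar> + m * K) * norm \<psi>" for \<omega> \<psi>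
  proof -
    have "norm (J \<omega> (poly_op R (J \<omega>) \<psi>)) \<le> m * norm (poly_op R (J \<omega>) \<psi>)"
      by (rule order_trans[OF norm_jacobi_le mult_right_mono]) (simp_all add: m_def)
    also have "\<dots> \<le> m * (K * norm \<psi>)"
      by (rule mult_left_mono[OF K(2)]) (simp add: m_def)
    finally show ?thesis
      using norm_triangle_mono[of "a *\<^sub>R \<psi>" "\<bar>a\<bar> * norm \<psi>" "J \<omega> (poly_op R (J \<omega>) \<psi>)" "m * (K * norm \<psi>)"]
      by (simp add: poly_op_pCons[OF linear_jacobi] algebra_simps)
  qed
  moreover have "\<bar>a\<bar> + m * K \<ge> 0" using K(1) by (simp add: m_def)
  ultimately show ?case by blast
qed

lemma covariant_jacobi: "covariant J"
  unfolding covariant_def by (simp add: linear_jacobi jacobi_shift coord_continuous_jacobi)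

lemma covariant_poly_op: "covariant (\<lambda>\<omega>. poly_op R (J \<omega>))"
  unfolding covariant_def
  by (simp add: poly_op_jacobi_shift coord_continuous_poly_op
      bounded_linear.linear[OF bounded_linear_poly_op[OF symmetric_operator.blinear[OF symmetric_operator_jacobi]]])

text \<open>
  Since \<open>J \<delta>\<^sub>0\<close> is a combination of three basis vectors, both sides are sums of three integrals of
  matrix elements.  The diagonal terms agree; the off-diagonal ones are exchanged by covariance and
  the invariance of the measure.
\<close>

lemma trace_commute_jacobi:
  assumes X: "covariant X"
  shows "trace (\<lambda>\<omega> \<psi>. X \<omega> (J \<omega> \<psi>)) = trace (\<lambda>\<omega> \<psi>. J \<omega> (X \<omega> \<psi>))"
proof -
  define x where "x k n \<omega> = Re (ell2_nth (X \<omega> (ell2_delta k)) n)" for k n \<omega>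
  define p' where "p' \<omega> = p (inv T \<omega>)" for \<omega>
  have iter: "iter_int T (- 1) \<omega> = inv T \<omega>" for \<omega> by (simp add: iter_int_def)
  have p'T: "p' (T \<omega>) = p \<omega>" for \<omega> using bij_T by (simp add: p'_def bij_is_inj)
  have cx: "continuous_on UNIV (x k n)" for k n
    unfolding x_def[abs_def] by (rule continuous_matrix_element[OF X])
  have cp': "continuous_on UNIV p'"
    unfolding p'_def[abs_def] by (rule continuous_on_compose2[OF cont_p cont_inv_T]) simp
  have xT: "x (k - 1) n (T \<omega>) = x k (n + 1) \<omega>" for k n \<omega>
    using covariantD(2)[OF X, of \<omega> "ell2_delta k"] by (simp add: x_def ell2_shift_delta)
  have J\<delta>: "J \<omega> (ell2_delta 0) = p' \<omega> *\<^sub>R ell2_delta (- 1) + (q \<omega> *\<^sub>R ell2_delta 0 + p \<omega> *\<^sub>R ell2_delta 1)" for \<omega>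
    by (rule ell2_eqI) (auto simp: nth_jacobi iter p'_def scaleR_conv_of_real)
  have XJ: "Re (ell2_nth (X \<omega> (J \<omega> (ell2_delta 0))) 0) = p' \<omega> * x (- 1) 0 \<omega> + q \<omega> * x 0 0 \<omega> + p \<omega> * x 1 0 \<omega>" for \<omega>
    using covariantD(1)[OF X, of \<omega>] by (simp add: J\<delta> linear_add linear_scale x_def)
  have JX: "Re (ell2_nth (J \<omega> (X \<omega> (ell2_delta 0))) 0) = p' \<omega> * x 0 (- 1) \<omega> + q \<omega> * x 0 0 \<omega> + p \<omega> * x 0 1 \<omega>" for \<omega>
    by (simp add: nth_jacobi x_def iter p'_def)
  have move: "(\<integral>\<omega>. p' \<omega> * x k n \<omega> \<partial>M) = (\<integral>\<omega>. p \<omega> * x (k + 1) (n + 1) \<omega> \<partial>M)" for k n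
    using integral_T[of "\<lambda>\<omega>. p' \<omega> * x k n \<omega>"] xT[of "k + 1" n] cx cp'
    by (simp add: p'T continuous_on_mult)
  have int: "integrable M (\<lambda>\<omega>. f \<omega> * x k n \<omega>)" if "continuous_on UNIV f" for f k n
    by (intro integrable_continuous continuous_on_mult that cx)
  show ?thesis
    unfolding trace_def XJ JX using move[of "-1" 0] move[of 0 "-1"]
    by (simp add: int cp' cont_p cont_q)
qed

lemma trace_commute_poly:
  assumes "covariant X"
  shows "trace (\<lambda>\<omega> \<psi>. X \<omega> (poly_op R (J \<omega>) \<psi>)) = trace (\<lambda>\<omega> \<psi>. poly_op R (J \<omega>) (X \<omega> \<psi>))"
  using assms
proof (induction R arbitrary: X)
  case 0
  then show ?case by (simp add: trace_def linear_0[OF covariantD(1)])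
next
  case (pCons a R)
  note X = pCons.prems
  have XJ: "covariant (\<lambda>\<omega> \<psi>. X \<omega> (J \<omega> \<psi>))"
    by (rule covariant_comp[OF X covariant_jacobi])
  have RX: "covariant (\<lambda>\<omega> \<psi>. poly_op R (J \<omega>) (X \<omega> \<psi>))"
    by (rule covariant_comp[OF covariant_poly_op X])
  have aX: "covariant (\<lambda>\<omega> \<psi>. a *\<^sub>R X \<omega> \<psi>)"
    by (rule covariant_comp[OF covariant_scaleR X])
  have "trace (\<lambda>\<omega> \<psi>. X \<omega> (poly_op (pCons a R) (J \<omega>) \<psi>))
      = trace (\<lambda>\<omega> \<psi>. a *\<^sub>R X \<omega> \<psi> + X \<omega> (J \<omega> (poly_op R (J \<omega>) \<psi>)))"
    by (simp only: poly_op_pCons[OF linear_jacobi] linear_add[OF covariantD(1)[OF X]]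
        linear_scale[OF covariantD(1)[OF X]])
  also have "\<dots> = trace (\<lambda>\<omega> \<psi>. a *\<^sub>R X \<omega> \<psi>) + trace (\<lambda>\<omega> \<psi>. X \<omega> (J \<omega> (poly_op R (J \<omega>) \<psi>)))"
    by (rule trace_add[OF aX covariant_comp[OF XJ covariant_poly_op]])
  also have "trace (\<lambda>\<omega> \<psi>. X \<omega> (J \<omega> (poly_op R (J \<omega>) \<psi>)))
      = trace (\<lambda>\<omega> \<psi>. poly_op R (J \<omega>) (X \<omega> (J \<omega> \<psi>)))"
    by (rule pCons.IH[OF XJ])
  also have "\<dots> = trace (\<lambda>\<omega> \<psi>. J \<omega> (poly_op R (J \<omega>) (X \<omega> \<psi>)))"
    by (rule trace_commute_jacobi[OF RX])
  also have "trace (\<lambda>\<omega> \<psi>. a *\<^sub>R X \<omega> \<psi>) + \<dots>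
      = trace (\<lambda>\<omega> \<psi>. a *\<^sub>R X \<omega> \<psi> + J \<omega> (poly_op R (J \<omega>) (X \<omega> \<psi>)))"
    by (rule trace_add[symmetric, OF aX covariant_comp[OF covariant_jacobi RX]])
  also have "\<dots> = trace (\<lambda>\<omega> \<psi>. poly_op (pCons a R) (J \<omega>) (X \<omega> \<psi>))"
    by (simp only: poly_op_pCons[OF linear_jacobi])
  finally show ?case .
qed

end

section \<open>Switching on the hopping term\<close>

context ergodic_jacobi_family
begin

text \<open>
  The deformation \<open>J\<^sub>t = q + t \<Delta>\<close> from the diagonal operator to the Jacobi operator.
\<close>

abbreviation J' :: "real \<Rightarrow> 'a \<Rightarrow> ell2 \<Rightarrow> ell2" where
  "J' t \<equiv> jacobi T q (\<lambda>\<omega>. t * p \<omega>)"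

abbreviation \<Delta> :: "'a \<Rightarrow> ell2 \<Rightarrow> ell2" where
  "\<Delta> \<equiv> jacobi T (\<lambda>_. 0) p"

lemma P_nonneg: "0 \<le> P"
  using p_le[of undefined] by linarith

lemma family_scaled: "ergodic_jacobi_family T M q (\<lambda>\<omega>. t * p \<omega>) Q (\<bar>t\<bar> * P)"
  using ergodic_system_axioms bijective_dynamics_axioms q_le p_le cont_T cont_inv_T cont_q cont_p
  by (auto simp: ergodic_jacobi_family_def continuous_jacobi_family_def continuous_jacobi_family_axioms_def
      jacobi_family_def jacobi_family_axioms_def abs_mult intro!: mult_left_mono continuous_intros)

lemma family_hopping: "ergodic_jacobi_family T M (\<lambda>_. 0) p 0 P"
  using ergodic_system_axioms bijective_dynamics_axioms p_le cont_T cont_inv_T cont_p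
  by (auto simp: ergodic_jacobi_family_def continuous_jacobi_family_def continuous_jacobi_family_axioms_def
      jacobi_family_def jacobi_family_axioms_def)

lemma jacobi_scaled_add: "J' (t + s) \<omega> \<psi> = J' t \<omega> \<psi> + s *\<^sub>R \<Delta> \<omega> \<psi>"
proof -
  interpret t: ergodic_jacobi_family T M q "\<lambda>\<omega>. t * p \<omega>" Q "\<bar>t\<bar> * P" by (rule family_scaled)
  interpret ts: ergodic_jacobi_family T M q "\<lambda>\<omega>. (t + s) * p \<omega>" Q "\<bar>t + s\<bar> * P" by (rule family_scaled)
  interpret d: ergodic_jacobi_family T M "\<lambda>_. 0" p 0 P by (rule family_hopping)
  show ?thesis
    by (rule ell2_eqI)
      (simp only: t.nth_jacobi ts.nth_jacobi d.nth_jacobi ell2_nth_simps, simp add: scaleR_conv_of_real algebra_simps)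
qed

text \<open>
  The operator \<open>W\<close> is the derivative of \<open>R(J\<^sub>t)\<close> in \<open>t\<close>; for a monomial it is a sum of products
  \<open>J\<^sub>t \<dots> J\<^sub>t \<Delta> J\<^sub>t \<dots> J\<^sub>t\<close> with \<open>\<Delta>\<close> in all possible positions.  It differs
  from \<open>R'(J\<^sub>t) \<Delta>\<close> by the order of the factors, which is invisible to the trace.  The trace formula
  carries an arbitrary left factor \<open>S(J\<^sub>t)\<close>, since in the step from \<open>R\<close> to \<open>a + x R\<close>, where \<open>W\<close> becomes
  \<open>\<Delta> R(J\<^sub>t) + J\<^sub>t W\<close>, a factor \<open>J\<^sub>t\<close> appears on the left.
\<close>

lemma poly_op_scaled_expansion:
  "\<exists>W. covariant W \<and> (\<exists>C\<ge>0. \<forall>\<omega> \<psi>. norm (W \<omega> \<psi>) \<le> C * norm \<psi>) \<and>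
    (\<exists>C\<ge>0. \<forall>s \<omega> \<psi>. \<bar>s\<bar> \<le> 1 \<longrightarrow>
      norm (poly_op R (J' (t + s) \<omega>) \<psi> - poly_op R (J' t \<omega>) \<psi> - s *\<^sub>R W \<omega> \<psi>) \<le> C * s\<^sup>2 * norm \<psi>) \<and>
    (\<forall>S. trace (\<lambda>\<omega> \<psi>. poly_op S (J' t \<omega>) (W \<omega> \<psi>))
      = trace (\<lambda>\<omega> \<psi>. poly_op (S * pderiv R) (J' t \<omega>) (\<Delta> \<omega> \<psi>)))"
proof (induction R)
  case 0
  have "covariant (\<lambda>_ _. 0)" using covariant_scaleR[of 0] by simp
  moreover have "poly_op S (J' t \<omega>) 0 = 0" for S \<omega>
    by (rule linear_0[OF covariantD(1)[OF ergodic_jacobi_family.covariant_poly_op[OF family_scaled]]])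
  moreover have "\<exists>C\<ge>0. \<forall>\<psi>. norm (0 :: ell2) \<le> C * norm (\<psi> :: ell2)" by (intro exI[of _ 0]) simp
  moreover have "\<exists>C\<ge>0. \<forall>s. \<bar>s\<bar> \<le> 1 \<longrightarrow> (\<forall>\<psi>. 0 \<le> C * s\<^sup>2 * norm (\<psi> :: ell2))" by (intro exI[of _ 0]) simp
  ultimately show ?case by (intro exI[of _ "\<lambda>_ _. 0"] conjI) (simp_all add: trace_def)
next
  case (pCons a R)
  interpret t: ergodic_jacobi_family T M q "\<lambda>\<omega>. t * p \<omega>" Q "\<bar>t\<bar> * P" by (rule family_scaled)
  interpret d: ergodic_jacobi_family T M "\<lambda>_. 0" p 0 P by (rule family_hopping)
  obtain W where W: "covariant W"
    and bd_W: "\<exists>C\<ge>0. \<forall>\<omega> \<psi>. norm (W \<omega> \<psi>) \<le> C * norm \<psi>"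
    and quad_W: "\<exists>C\<ge>0. \<forall>s \<omega> \<psi>. \<bar>s\<bar> \<le> 1 \<longrightarrow>
      norm (poly_op R (J' (t + s) \<omega>) \<psi> - poly_op R (J' t \<omega>) \<psi> - s *\<^sub>R W \<omega> \<psi>) \<le> C * s\<^sup>2 * norm \<psi>"
    and tr: "\<forall>S. trace (\<lambda>\<omega> \<psi>. poly_op S (J' t \<omega>) (W \<omega> \<psi>))
      = trace (\<lambda>\<omega> \<psi>. poly_op (S * pderiv R) (J' t \<omega>) (\<Delta> \<omega> \<psi>))"
    using pCons.IH by (rule exE) (elim conjE, rule that; assumption)
  obtain C\<^sub>1 where C\<^sub>1: "C\<^sub>1 \<ge> 0" "\<And>\<omega> \<psi>. norm (W \<omega> \<psi>) \<le> C\<^sub>1 * norm \<psi>"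
    using bd_W by blast
  obtain C\<^sub>2 where C\<^sub>2: "C\<^sub>2 \<ge> 0" "\<And>s \<omega> \<psi>. \<bar>s\<bar> \<le> 1 \<Longrightarrow>
      norm (poly_op R (J' (t + s) \<omega>) \<psi> - poly_op R (J' t \<omega>) \<psi> - s *\<^sub>R W \<omega> \<psi>) \<le> C\<^sub>2 * s\<^sup>2 * norm \<psi>"
    using quad_W by blast
  define W' where "W' \<omega> \<psi> = \<Delta> \<omega> (poly_op R (J' t \<omega>) \<psi>) + J' t \<omega> (W \<omega> \<psi>)" for \<omega> \<psi>
  have c\<^sub>1: "covariant (\<lambda>\<omega> \<psi>. \<Delta> \<omega> (poly_op R (J' t \<omega>) \<psi>))"
    by (rule covariant_comp[OF d.covariant_jacobi t.covariant_poly_op])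
  have c\<^sub>2: "covariant (\<lambda>\<omega> \<psi>. J' t \<omega> (W \<omega> \<psi>))"
    by (rule covariant_comp[OF t.covariant_jacobi W])
  have W': "covariant W'"
    unfolding W'_def[abs_def] by (rule covariant_add[OF c\<^sub>1 c\<^sub>2])
  have bd_W': "\<exists>C\<ge>0. \<forall>\<omega> \<psi>. norm (W' \<omega> \<psi>) \<le> C * norm \<psi>"
  proof -
    obtain K where K: "K \<ge> 0" "\<And>\<omega> \<psi>. norm (poly_op R (J' t \<omega>) \<psi>) \<le> K * norm \<psi>"
      using t.poly_op_jacobi_bounded[of R] by blast
    define m where "m = \<bar>Q\<bar> + 2 * (\<bar>t\<bar> * P)"
    have "norm (W' \<omega> \<psi>) \<le> (2 * P * K + m * C\<^sub>1) * norm \<psi>" for \<omega> \<psi>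
    proof -
      have "norm (\<Delta> \<omega> (poly_op R (J' t \<omega>) \<psi>)) \<le> 2 * P * norm (poly_op R (J' t \<omega>) \<psi>)"
        using d.norm_jacobi_le[of \<omega> "poly_op R (J' t \<omega>) \<psi>"] by simp
      also have "\<dots> \<le> 2 * P * (K * norm \<psi>)"
        by (rule mult_left_mono[OF K(2)]) (use P_nonneg in simp)
      finally have 1: "norm (\<Delta> \<omega> (poly_op R (J' t \<omega>) \<psi>)) \<le> 2 * P * (K * norm \<psi>)" .
      have "norm (J' t \<omega> (W \<omega> \<psi>)) \<le> m * norm (W \<omega> \<psi>)"
        by (rule order_trans[OF t.norm_jacobi_le mult_right_mono]) (simp_all add: m_def)
      also have "\<dots> \<le> m * (C\<^sub>1 * norm \<psi>)"
        by (rule mult_left_mono[OF C\<^sub>1(2)]) (use P_nonneg in \<open>simp add: m_def\<close>)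
      finally have 2: "norm (J' t \<omega> (W \<omega> \<psi>)) \<le> m * (C\<^sub>1 * norm \<psi>)" .
      show ?thesis
        using norm_triangle_mono[OF 1 2] by (simp add: W'_def algebra_simps)
    qed
    moreover have "2 * P * K + m * C\<^sub>1 \<ge> 0" using P_nonneg K(1) C\<^sub>1(1) by (simp add: m_def)
    ultimately show ?thesis by blast
  qed
  have quad: "\<exists>C\<ge>0. \<forall>s \<omega> \<psi>. \<bar>s\<bar> \<le> 1 \<longrightarrow> norm (poly_op (pCons a R) (J' (t + s) \<omega>) \<psi>
      - poly_op (pCons a R) (J' t \<omega>) \<psi> - s *\<^sub>R W' \<omega> \<psi>) \<le> C * s\<^sup>2 * norm \<psi>"
  proof -
    define m where "m = \<bar>Q\<bar> + 2 * ((\<bar>t\<bar> + 1) * P)"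
    have "0 \<le> m" using P_nonneg by (simp add: m_def)
    have bound: "norm (poly_op (pCons a R) (J' (t + s) \<omega>) \<psi>
      - poly_op (pCons a R) (J' t \<omega>) \<psi> - s *\<^sub>R W' \<omega> \<psi>) \<le> (m * C\<^sub>2 + 2 * P * C\<^sub>1) * s\<^sup>2 * norm \<psi>"
      if s: "\<bar>s\<bar> \<le> 1" for s \<omega> \<psi>
    proof -
      interpret ts: ergodic_jacobi_family T M q "\<lambda>\<omega>. (t + s) * p \<omega>" Q "\<bar>t + s\<bar> * P" by (rule family_scaled)
      define \<phi> where "\<phi> = poly_op R (J' (t + s) \<omega>) \<psi> - poly_op R (J' t \<omega>) \<psi> - s *\<^sub>R W \<omega> \<psi>"
      have "poly_op (pCons a R) (J' (t + s) \<omega>) \<psi> - poly_op (pCons a R) (J' t \<omega>) \<psi> - s *\<^sub>R W' \<omega> \<psi>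
          = J' (t + s) \<omega> \<phi> + s\<^sup>2 *\<^sub>R \<Delta> \<omega> (W \<omega> \<psi>)"
      proof -
        define A where "A = J' (t + s) \<omega>"
        have A: "linear A" unfolding A_def by (rule ts.linear_jacobi)
        have A_eq: "A \<eta> = J' t \<omega> \<eta> + s *\<^sub>R \<Delta> \<omega> \<eta>" for \<eta>
          unfolding A_def by (rule jacobi_scaled_add)
        have "A \<phi> = A (poly_op R A \<psi>) - (J' t \<omega> (poly_op R (J' t \<omega>) \<psi>) + s *\<^sub>R \<Delta> \<omega> (poly_op R (J' t \<omega>) \<psi>))
            - s *\<^sub>R (J' t \<omega> (W \<omega> \<psi>) + s *\<^sub>R \<Delta> \<omega> (W \<omega> \<psi>))"
          unfolding \<phi>_def A_def[symmetric] linear_diff[OF A] linear_scale[OF A]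
          unfolding A_eq[of "poly_op R (J' t \<omega>) \<psi>"] A_eq[of "W \<omega> \<psi>"] by (rule refl)
        then show ?thesis
          unfolding A_def[symmetric] poly_op_pCons[OF A] poly_op_pCons[OF t.linear_jacobi] W'_def
          by (simp add: algebra_simps power2_eq_square)
      qed
      also have "norm \<dots> \<le> norm (J' (t + s) \<omega> \<phi>) + norm (s\<^sup>2 *\<^sub>R \<Delta> \<omega> (W \<omega> \<psi>))"
        by (rule norm_triangle_ineq)
      also have "\<dots> \<le> m * (C\<^sub>2 * s\<^sup>2 * norm \<psi>) + s\<^sup>2 * (2 * P * (C\<^sub>1 * norm \<psi>))"
      proof (rule add_mono)
        have "\<bar>t + s\<bar> * P \<le> (\<bar>t\<bar> + 1) * P" using s P_nonneg by (intro mult_right_mono) auto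
        then have "Q + 2 * (\<bar>t + s\<bar> * P) \<le> m" by (simp add: m_def)
        then have "norm (J' (t + s) \<omega> \<phi>) \<le> m * norm \<phi>"
          using ts.norm_jacobi_le[of \<omega> \<phi>] by (meson mult_right_mono norm_ge_zero order_trans)
        also have "\<dots> \<le> m * (C\<^sub>2 * s\<^sup>2 * norm \<psi>)"
          unfolding \<phi>_def by (rule mult_left_mono[OF C\<^sub>2(2)[OF s] \<open>0 \<le> m\<close>])
        finally show "norm (J' (t + s) \<omega> \<phi>) \<le> m * (C\<^sub>2 * s\<^sup>2 * norm \<psi>)" .
        have "norm (\<Delta> \<omega> (W \<omega> \<psi>)) \<le> 2 * P * norm (W \<omega> \<psi>)"
          using d.norm_jacobi_le[of \<omega> "W \<omega> \<psi>"] by simp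
        also have "\<dots> \<le> 2 * P * (C\<^sub>1 * norm \<psi>)"
          by (rule mult_left_mono[OF C\<^sub>1(2)]) (use P_nonneg in simp)
        finally show "norm (s\<^sup>2 *\<^sub>R \<Delta> \<omega> (W \<omega> \<psi>)) \<le> s\<^sup>2 * (2 * P * (C\<^sub>1 * norm \<psi>))"
          by (simp add: mult_left_mono)
      qed
      finally show ?thesis by (simp add: algebra_simps)
    qed
    then show ?thesis
      using \<open>0 \<le> m\<close> C\<^sub>1(1) C\<^sub>2(1) P_nonneg by (intro exI[of _ "m * C\<^sub>2 + 2 * P * C\<^sub>1"]) auto
  qed
  have "trace (\<lambda>\<omega> \<psi>. poly_op S (J' t \<omega>) (W' \<omega> \<psi>))
      = trace (\<lambda>\<omega> \<psi>. poly_op (S * pderiv (pCons a R)) (J' t \<omega>) (\<Delta> \<omega> \<psi>))" for S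
  proof -
    have cS\<Delta>: "covariant (\<lambda>\<omega> \<psi>. poly_op S (J' t \<omega>) (\<Delta> \<omega> \<psi>))" for S
      by (rule covariant_comp[OF t.covariant_poly_op d.covariant_jacobi])
    have "trace (\<lambda>\<omega> \<psi>. poly_op S (J' t \<omega>) (W' \<omega> \<psi>))
      = trace (\<lambda>\<omega> \<psi>. poly_op S (J' t \<omega>) (\<Delta> \<omega> (poly_op R (J' t \<omega>) \<psi>)) + poly_op S (J' t \<omega>) (J' t \<omega> (W \<omega> \<psi>)))"
      unfolding W'_def by (simp only: linear_add[OF covariantD(1)[OF t.covariant_poly_op]])
    also have "\<dots> = trace (\<lambda>\<omega> \<psi>. poly_op S (J' t \<omega>) (\<Delta> \<omega> (poly_op R (J' t \<omega>) \<psi>)))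
        + trace (\<lambda>\<omega> \<psi>. poly_op S (J' t \<omega>) (J' t \<omega> (W \<omega> \<psi>)))"
      by (rule trace_add[OF covariant_comp[OF t.covariant_poly_op c\<^sub>1] covariant_comp[OF t.covariant_poly_op c\<^sub>2]])
    also have "trace (\<lambda>\<omega> \<psi>. poly_op S (J' t \<omega>) (\<Delta> \<omega> (poly_op R (J' t \<omega>) \<psi>)))
        = trace (\<lambda>\<omega> \<psi>. poly_op R (J' t \<omega>) (poly_op S (J' t \<omega>) (\<Delta> \<omega> \<psi>)))"
      by (rule t.trace_commute_poly[OF cS\<Delta>])
    also have "\<dots> = trace (\<lambda>\<omega> \<psi>. poly_op (S * R) (J' t \<omega>) (\<Delta> \<omega> \<psi>))"
      by (simp only: poly_op_mult[OF t.linear_jacobi, symmetric] mult.commute)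
    also have "trace (\<lambda>\<omega> \<psi>. poly_op S (J' t \<omega>) (J' t \<omega> (W \<omega> \<psi>)))
        = trace (\<lambda>\<omega> \<psi>. poly_op (S * [:0, 1:]) (J' t \<omega>) (W \<omega> \<psi>))"
      by (simp add: poly_op_mult[OF t.linear_jacobi] poly_op_pCons[OF t.linear_jacobi] linear_0[OF t.linear_jacobi]
          del: mult_pCons_right)
    also have "\<dots> = trace (\<lambda>\<omega> \<psi>. poly_op (S * [:0, 1:] * pderiv R) (J' t \<omega>) (\<Delta> \<omega> \<psi>))"
      by (rule spec[OF tr])
    also have "trace (\<lambda>\<omega> \<psi>. poly_op (S * R) (J' t \<omega>) (\<Delta> \<omega> \<psi>)) + \<dots>
        = trace (\<lambda>\<omega> \<psi>. poly_op (S * R) (J' t \<omega>) (\<Delta> \<omega> \<psi>) + poly_op (S * [:0, 1:] * pderiv R) (J' t \<omega>) (\<Delta> \<omega> \<psi>))"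
      by (rule trace_add[symmetric, OF cS\<Delta> cS\<Delta>])
    also have "\<dots> = trace (\<lambda>\<omega> \<psi>. poly_op (S * R + S * [:0, 1:] * pderiv R) (J' t \<omega>) (\<Delta> \<omega> \<psi>))"
      by (simp only: poly_op_add)
    also have "S * R + S * [:0, 1:] * pderiv R = S * pderiv (pCons a R)"
      by (simp add: pderiv_pCons algebra_simps)
    finally show ?thesis .
  qed
  then show ?case by (intro exI[of _ W'] conjI allI W' bd_W' quad)
qed

lemma trace_increment_le:
  assumes X: "covariant X" "covariant Y" "covariant W"
    and le: "\<And>\<omega> \<psi>. norm (X \<omega> \<psi> - Y \<omega> \<psi> - s *\<^sub>R W \<omega> \<psi>) \<le> c * norm \<psi>"
  shows "\<bar>trace X - trace Y - s * trace W\<bar> \<le> c"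
proof -
  define e where "e X \<omega> = Re (ell2_nth (X \<omega> (ell2_delta 0)) 0)" for X :: "'a \<Rightarrow> ell2 \<Rightarrow> ell2" and \<omega>
  have i: "integrable M (e X)" if "covariant X" for X
    unfolding e_def[abs_def] by (rule integrable_continuous[OF continuous_matrix_element[OF that]])
  have tr: "trace X = (\<integral>\<omega>. e X \<omega> \<partial>M)" for X
    by (simp only: trace_def e_def)
  have "trace X - trace Y - s * trace W = (\<integral>\<omega>. e X \<omega> - e Y \<omega> - s * e W \<omega> \<partial>M)"
    using i[OF X(1)] i[OF X(2)] i[OF X(3)] unfolding tr by simp
  also have "\<bar>\<dots>\<bar> \<le> (\<integral>\<omega>. \<bar>e X \<omega> - e Y \<omega> - s * e W \<omega>\<bar> \<partial>M)"
    by (rule integral_abs_bound)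
  also have "\<dots> \<le> (\<integral>\<omega>. c \<partial>M)"
  proof (rule integral_mono)
    show "integrable M (\<lambda>\<omega>. \<bar>e X \<omega> - e Y \<omega> - s * e W \<omega>\<bar>)"
      using i[OF X(1)] i[OF X(2)] i[OF X(3)] by simp
    fix \<omega>
    define \<phi> where "\<phi> = X \<omega> (ell2_delta 0) - Y \<omega> (ell2_delta 0) - s *\<^sub>R W \<omega> (ell2_delta 0)"
    have "\<bar>Re (ell2_nth \<phi> 0)\<bar> \<le> norm \<phi>"
      using abs_Re_le_cmod[of "ell2_nth \<phi> 0"] cmod_ell2_nth_le[of \<phi> 0] by linarith
    also have "\<dots> \<le> c" using le[of \<omega> "ell2_delta 0"] by (simp add: norm_ell2_delta \<phi>_def)
    finally show "\<bar>e X \<omega> - e Y \<omega> - s * e W \<omega>\<bar> \<le> c"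
      by (simp add: e_def \<phi>_def)
  qed simp
  finally show ?thesis by (simp add: prob_space)
qed

end

lemma has_real_derivative_quadraticI:
  fixes F :: "real \<Rightarrow> real"
  assumes "\<And>s. \<bar>s\<bar> \<le> 1 \<Longrightarrow> \<bar>F (t + s) - F t - s * D\<bar> \<le> C * s\<^sup>2"
  shows "(F has_real_derivative D) (at t)"
  unfolding DERIV_def
proof (rule LIM_zero_cancel, rule Lim_null_comparison)
  have "\<forall>\<^sub>F s in at 0. s \<noteq> (0::real) \<and> dist s 0 < 1"
    unfolding eventually_at by (rule exI[of _ 1]) simp
  then show "\<forall>\<^sub>F s in at 0. norm ((F (t + s) - F t) / s - D) \<le> C * \<bar>s\<bar>"
  proof eventually_elim
    case (elim s)
    then have s: "\<bar>s\<bar> \<le> 1" "s \<noteq> 0" by (simp_all add: dist_real_def)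
    have "(F (t + s) - F t) / s - D = (F (t + s) - F t - s * D) / s"
      using s(2) by (simp add: diff_divide_distrib)
    then have "norm ((F (t + s) - F t) / s - D) = \<bar>F (t + s) - F t - s * D\<bar> / \<bar>s\<bar>"
      by (simp only: real_norm_def abs_divide)
    also have "\<dots> \<le> C * s\<^sup>2 / \<bar>s\<bar>" by (rule divide_right_mono[OF assms[OF s(1)]]) simp
    also have "\<dots> = C * \<bar>s\<bar>"
      using s(2) by (cases "0 \<le> s") (simp_all add: power2_eq_square)
    finally show ?case .
  qed
  show "(\<lambda>s. C * \<bar>s\<bar>) \<midarrow>0\<rightarrow> 0"
    using tendsto_mult_right_zero[OF tendsto_rabs_zero[OF tendsto_ident_at], of C] by simp
qed

context ergodic_jacobi_family
begin

text \<open>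
  The case \<open>S = 1\<close> of the trace formula; the quadratic remainder is uniform in \<open>\<omega>\<close> and survives the
  integration.
\<close>

lemma trace_poly_has_derivative:
  "((\<lambda>t. trace (\<lambda>\<omega>. poly_op R (J' t \<omega>))) has_real_derivative
    trace (\<lambda>\<omega> \<psi>. poly_op (pderiv R) (J' t \<omega>) (\<Delta> \<omega> \<psi>))) (at t)"
proof -
  obtain W where W: "covariant W"
    and quad: "\<exists>C\<ge>0. \<forall>s \<omega> \<psi>. \<bar>s\<bar> \<le> 1 \<longrightarrow>
      norm (poly_op R (J' (t + s) \<omega>) \<psi> - poly_op R (J' t \<omega>) \<psi> - s *\<^sub>R W \<omega> \<psi>) \<le> C * s\<^sup>2 * norm \<psi>"
    and tr: "\<forall>S. trace (\<lambda>\<omega> \<psi>. poly_op S (J' t \<omega>) (W \<omega> \<psi>))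
      = trace (\<lambda>\<omega> \<psi>. poly_op (S * pderiv R) (J' t \<omega>) (\<Delta> \<omega> \<psi>))"
    using poly_op_scaled_expansion[of R t] by (rule exE) (elim conjE, rule that; assumption)
  obtain C where C: "\<And>s \<omega> \<psi>. \<bar>s\<bar> \<le> 1 \<Longrightarrow>
      norm (poly_op R (J' (t + s) \<omega>) \<psi> - poly_op R (J' t \<omega>) \<psi> - s *\<^sub>R W \<omega> \<psi>) \<le> C * s\<^sup>2 * norm \<psi>"
    using quad by blast
  have one: "poly_op 1 A \<psi> = \<psi>" for A \<psi> by (simp add: poly_op_def)
  have "trace W = trace (\<lambda>\<omega> \<psi>. poly_op (pderiv R) (J' t \<omega>) (\<Delta> \<omega> \<psi>))"
    using spec[OF tr, of 1] unfolding one mult_1 .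
  moreover have cov: "covariant (\<lambda>\<omega>. poly_op R (J' u \<omega>))" for u
    by (rule ergodic_jacobi_family.covariant_poly_op[OF family_scaled])
  have "((\<lambda>t. trace (\<lambda>\<omega>. poly_op R (J' t \<omega>))) has_real_derivative trace W) (at t)"
    by (rule has_real_derivative_quadraticI, rule trace_increment_le[OF cov cov W], rule C)
  ultimately show ?thesis by simp
qed

end



section \<open>Invariance of the integrated density of states in a gap\<close>

lemma poly_antiderivative: "\<exists>P :: real poly. pderiv P = R"
proof -
  define P :: "real poly" where "P = (\<Sum>i\<le>degree R. monom (coeff R i / real (Suc i)) (Suc i))"
  have "coeff P (Suc n) = coeff R n / real (Suc n)" for n
    unfolding P_def coeff_sum by (simp add: coeff_eq_0)
  then have "pderiv P = R" by (intro poly_eqI) (simp add: coeff_pderiv del: of_nat_Suc)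
  then show ?thesis by blast
qed

lemma increment_le_of_derivative_le:
  fixes f f' :: "real \<Rightarrow> real"
  assumes "u \<le> v" "\<And>x. u \<le> x \<Longrightarrow> x \<le> v \<Longrightarrow> (f has_real_derivative f' x) (at x)"
    "\<And>x. u \<le> x \<Longrightarrow> x \<le> v \<Longrightarrow> \<bar>f' x\<bar> \<le> d"
  shows "\<bar>f v - f u\<bar> \<le> d * (v - u)"
proof (cases "u = v")
  case False
  then have "u < v" using assms(1) by simp
  obtain z where z: "u < z" "z < v" "f v - f u = (v - u) * f' z"
    using MVT2[OF \<open>u < v\<close> assms(2)] by blast
  have "\<bar>f v - f u\<bar> = (v - u) * \<bar>f' z\<bar>"
    using \<open>u < v\<close> by (simp add: z(3) abs_mult)
  also have "\<dots> \<le> (v - u) * d"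
    using assms(3)[of z] z \<open>u < v\<close> by (intro mult_left_mono) auto
  finally show ?thesis by (simp add: mult.commute)
qed simp

text \<open>
  The derivative \<open>R'\<close> is chosen first, close to a continuous function \<open>g\<close> that vanishes outside
  \<open>(a, b)\<close> and has integral \<open>-1\<close>.  The antiderivative of \<open>R'\<close> with value \<open>1\<close> at the left end then stays close to
  \<open>1\<close> up to \<open>a\<close>, drops by about \<open>1\<close> on \<open>[a, b]\<close>, and stays close to \<open>0\<close> afterwards.
\<close>

lemma gap_polynomial:
  fixes a b K e :: real
  assumes "- K \<le> a" "a < b" "b \<le> K" "0 < e"
  obtains R :: "real poly" where
    "\<And>x. x \<in> {- K..K} - {a<..<b} \<Longrightarrow> \<bar>poly R x - cts_step a b x\<bar> \<le> e"
    "\<And>x. x \<in> {- K..K} - {a<..<b} \<Longrightarrow> \<bar>poly (pderiv R) x\<bar> \<le> e"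
proof -
  have "K > 0" using assms by linarith
  define d where "d = e / (2 * K + 1)"
  have d: "d > 0" "d * (2 * K) \<le> e" "d \<le> e"
    using \<open>K > 0\<close> \<open>0 < e\<close> by (auto simp: d_def field_simps)
  define k where "k = 6 / (b - a) ^ 3"
  define g where "g x = - k * max 0 ((x - a) * (b - x))" for x
  \<comment> \<open>An antiderivative of \<open>g\<close> on \<open>[a, b]\<close>; the constant \<open>k\<close> normalises its total increment to \<open>-1\<close>.\<close>
  define G where "G x = - k * ((x - a)\<^sup>2 * (b - a) / 2 - (x - a) ^ 3 / 3)" for x
  have "continuous_on {- K..K} g" unfolding g_def[abs_def] by (intro continuous_intros)
  then obtain r :: "real poly" where r: "\<And>x. x \<in> {- K..K} \<Longrightarrow> \<bar>poly r x - g x\<bar> < d"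
    using polynomial_approximation d(1) by blast
  obtain R\<^sub>0 where R\<^sub>0: "pderiv R\<^sub>0 = r" using poly_antiderivative by blast
  define R where "R = R\<^sub>0 + [:1 - poly R\<^sub>0 (- K):]"
  have R: "pderiv R = r" by (simp add: R_def pderiv_add R\<^sub>0 pderiv_pCons)
  have R_left: "poly R (- K) = 1" by (simp add: R_def)
  have g0: "g x = 0" if "x \<le> a \<or> b \<le> x" for x
    using that \<open>a < b\<close> by (auto simp: g_def max_def mult_le_0_iff zero_le_mult_iff)
  have DR: "(poly R has_real_derivative poly r x) (at x)" for x
    using poly_DERIV[of R x] by (simp add: R)
  have small: "\<bar>poly r x\<bar> \<le> d" if "x \<in> {- K..K}" "x \<le> a \<or> b \<le> x" for x
    using r[OF that(1)] g0[OF that(2)] by simp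
  have left: "\<bar>poly R x - 1\<bar> \<le> d * (x + K)" if "- K \<le> x" "x \<le> a" for x
    using increment_le_of_derivative_le[of "- K" x "poly R" "poly r" d] that assms DR small
    by (simp add: R_left)
  have mid: "\<bar>poly R b - poly R a + 1\<bar> \<le> d * (b - a)"
  proof -
    have "((\<lambda>x. poly R x - G x) has_real_derivative poly r x - g x) (at x)" if "a \<le> x" "x \<le> b" for x
    proof -
      have DG: "(G has_real_derivative - k * ((x - a) * (b - x))) (at x)"
        unfolding G_def[abs_def]
        by (auto intro!: derivative_eq_intros simp: power2_eq_square field_simps)
      have "g x = - k * ((x - a) * (b - x))" using that by (simp add: g_def)
      then show ?thesis using DERIV_diff[OF DR DG] by simp
    qed
    then have "\<bar>(poly R b - G b) - (poly R a - G a)\<bar> \<le> d * (b - a)"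
      using assms r
      by (intro increment_le_of_derivative_le[where f' = "\<lambda>x. poly r x - g x"]) (auto intro!: less_imp_le[OF r])
    moreover have "G a = 0" by (simp add: G_def)
    moreover have "G b = - 1"
    proof -
      have "(b - a)\<^sup>2 * (b - a) / 2 - (b - a) ^ 3 / 3 = (b - a) ^ 3 / 6"
        by (simp add: power2_eq_square power3_eq_cube)
      then show ?thesis using \<open>a < b\<close> by (simp add: G_def k_def)
    qed
    ultimately show ?thesis by simp
  qed
  have right: "\<bar>poly R x\<bar> \<le> d * (x + K)" if "b \<le> x" "x \<le> K" for x
  proof -
    have "\<bar>poly R x - poly R b\<bar> \<le> d * (x - b)"
      using increment_le_of_derivative_le[of b x "poly R" "poly r" d] that assms DR small by simp
    then have "\<bar>poly R x\<bar> \<le> d * (x - b) + d * (b - a) + d * (a + K)"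
      using mid left[of a] assms by linarith
    then show ?thesis by (simp add: algebra_simps)
  qed
  have le: "d * (x + K) \<le> e" if "x \<in> {- K..K}" for x
  proof -
    have "d * (x + K) \<le> d * (2 * K)" using that d(1) by (intro mult_left_mono) auto
    then show ?thesis using d(2) by linarith
  qed
  show thesis
  proof (rule that)
    fix x assume x: "x \<in> {- K..K} - {a<..<b}"
    then consider "- K \<le> x" "x \<le> a" | "b \<le> x" "x \<le> K" by fastforce
    then show "\<bar>poly R x - cts_step a b x\<bar> \<le> e"
    proof cases
      case 1
      then show ?thesis using left[OF 1] le[of x] x by (simp add: cts_step_def)
    next
      case 2
      then show ?thesis using right[OF 2] le[of x] x \<open>a < b\<close> by (simp add: cts_step_def)
    qed
    have "x \<in> {- K..K}" "x \<le> a \<or> b \<le> x" using x by auto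
    from small[OF this] show "\<bar>poly (pderiv R) x\<bar> \<le> e" using d(3) by (simp add: R)
  qed
qed

lemma norm_le_weighted_shift:
  assumes a: "\<And>n. \<bar>a n\<bar> \<le> C" and m: "m > 0" "\<And>n. m \<le> \<bar>a n\<bar>"
  shows "m * norm \<psi> \<le> norm (weighted_shift a 0 \<psi>)"
proof -
  have inv: "\<bar>1 / a n\<bar> \<le> 1 / m" for n
    using m(1) m(2)[of n] by (simp add: abs_divide frac_le)
  have nz: "a n \<noteq> 0" for n using m(1) m(2)[of n] by auto
  have "weighted_shift (\<lambda>n. 1 / a n) 0 (weighted_shift a 0 \<psi>) = \<psi>"
    by (rule ell2_eqI)
      (simp add: ell2_nth_weighted_shift[where C = "1 / m", OF inv] ell2_nth_weighted_shift[where C = C, OF a] nz)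
  then have "norm \<psi> \<le> 1 / m * norm (weighted_shift a 0 \<psi>)"
    using norm_weighted_shift_le[of "\<lambda>n. 1 / a n" "1 / m" 0 "weighted_shift a 0 \<psi>", OF inv] by simp
  then show ?thesis using m(1) by (simp add: field_simps)
qed

context ergodic_jacobi_family
begin

text \<open>
  The diagonal part minus \<open>x\<close> is bounded below by \<open>m\<close>, and the hopping part has norm at most \<open>2 P\<close>.
\<close>

lemma notin_real_spectrum:
  assumes "2 * P < m" and m: "\<And>\<omega>. m \<le> \<bar>q \<omega> - x\<bar>"
  shows "x \<notin> real_spectrum (J \<omega>)"
proof (rule symmetric_operator.spec_notin[OF symmetric_operator_jacobi])
  have qx: "\<bar>q (iter_int T n \<omega>) - x\<bar> \<le> Q + \<bar>x\<bar>" for n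
    using q_le[of "iter_int T n \<omega>"] by linarith
  have "m > 0" using assms(1) P_nonneg by linarith
  have "(m - 2 * P) * norm \<psi> \<le> norm (J \<omega> \<psi> - x *\<^sub>R \<psi>)" for \<psi>
  proof -
    define D where "D = weighted_shift (\<lambda>n. q (iter_int T n \<omega>) - x) 0 \<psi>"
    define H where "H = weighted_shift (\<lambda>n. p (iter_int T (n - 1) \<omega>)) (- 1) \<psi>
      + weighted_shift (\<lambda>n. p (iter_int T n \<omega>)) 1 \<psi>"
    have "J \<omega> \<psi> - x *\<^sub>R \<psi> = D + H"
      unfolding jacobi_eq_weighted_shifts D_def H_def
      by (rule ell2_eqI)
        (simp add: ell2_nth_weighted_shift[where C = Q, OF q_le] ell2_nth_weighted_shift[where C = "Q + \<bar>x\<bar>", OF qx]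
          algebra_simps scaleR_conv_of_real)
    moreover have "m * norm \<psi> \<le> norm D"
      unfolding D_def by (rule norm_le_weighted_shift[where C = "Q + \<bar>x\<bar>", OF qx \<open>m > 0\<close> m])
    moreover have "norm H \<le> P * norm \<psi> + P * norm \<psi>"
      unfolding H_def by (intro norm_triangle_mono norm_weighted_shift_le p_le)
    moreover have "norm D \<le> norm (D + H) + norm H"
      using norm_triangle_ineq4[of "D + H" H] by simp
    ultimately show ?thesis by (simp add: left_diff_distrib)
  qed
  then show "bounded_below (\<lambda>\<psi>. J \<omega> \<psi> - x *\<^sub>R \<psi>)"
    unfolding bounded_below_def using assms(1) by (intro exI[of _ "m - 2 * P"]) auto
qed

lemma trace_poly_eq: "trace (\<lambda>\<omega>. poly_op R (J \<omega>)) = (\<integral>\<omega>. Re (ell2_nth (poly_op R (J \<omega>) (ell2_delta 0)) 0) \<partial>M)"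
  by (simp add: trace_def)

text \<open>
  Let \<open>R\<close> be a gap polynomial with error \<open>e\<close>.  At both ends \<open>\<tau>(R(J\<^sub>t))\<close> differs by at most \<open>e\<close> from the
  integral of the step, and in between its derivative \<open>\<tau>(R'(J\<^sub>t) \<Delta>)\<close> is at most \<open>2 P e\<close>, because
  \<open>R'\<close> is at most \<open>e\<close> on the spectrum of every \<open>J\<^sub>t\<close>.
\<close>

lemma gap_integral_invariant:
  assumes "a < b"
    and gap: "\<And>t \<omega> x. 0 \<le> t \<Longrightarrow> t \<le> 1 \<Longrightarrow> a < x \<Longrightarrow> x < b \<Longrightarrow> x \<notin> real_spectrum (J' t \<omega>)"
  shows "(\<integral>x. cts_step a b x \<partial>dos_measure T M q p) = (\<integral>x. cts_step a b x \<partial>dos_measure T M q (\<lambda>_. 0))"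
proof -
  define I where "I t = (\<integral>x. cts_step a b x \<partial>dos_measure T M q (\<lambda>\<omega>. t * p \<omega>))" for t
  have c: "continuous_on UNIV (cts_step a b)" by (rule continuous_on_cts_step[OF \<open>a < b\<close>])
  define K where "K = \<bar>Q\<bar> + 2 * P + \<bar>a\<bar> + \<bar>b\<bar>"
  have K: "- K \<le> a" "b \<le> K" using P_nonneg by (auto simp: K_def)
  have spec: "real_spectrum (J' t \<omega>) \<subseteq> {- K..K} - {a<..<b}" if t: "0 \<le> t" "t \<le> 1" for t \<omega>
  proof -
    interpret t: ergodic_jacobi_family T M q "\<lambda>\<omega>. t * p \<omega>" Q "\<bar>t\<bar> * P" by (rule family_scaled)
    have "\<bar>t\<bar> * P \<le> P" using t P_nonneg by (simp add: mult_left_le_one_le)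
    then have "real_spectrum (J' t \<omega>) \<subseteq> {- K..K}"
      by (intro order_trans[OF t.real_spectrum_bounded]) (auto simp: K_def)
    then show ?thesis using gap[OF t] by auto
  qed
  have close: "\<bar>I 1 - I 0\<bar> \<le> (2 + 2 * P) * e" if "e > 0" for e
  proof -
    obtain R :: "real poly" where R: "\<And>x. x \<in> {- K..K} - {a<..<b} \<Longrightarrow> \<bar>poly R x - cts_step a b x\<bar> \<le> e"
      "\<And>x. x \<in> {- K..K} - {a<..<b} \<Longrightarrow> \<bar>poly (pderiv R) x\<bar> \<le> e"
      using gap_polynomial[OF K(1) \<open>a < b\<close> K(2) \<open>e > 0\<close>] by blast
    define F where "F t = trace (\<lambda>\<omega>. poly_op R (J' t \<omega>))" for t
    have FI: "\<bar>F t - I t\<bar> \<le> e" if t: "0 \<le> t" "t \<le> 1" for t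
    proof -
      interpret t: ergodic_jacobi_family T M q "\<lambda>\<omega>. t * p \<omega>" Q "\<bar>t\<bar> * P" by (rule family_scaled)
      show ?thesis
        unfolding F_def I_def t.integral_dos[OF c] t.trace_poly_eq
        by (rule t.spectral_mean_diff_le[OF c], rule R(1), rule subsetD[OF spec[OF t]])
    qed
    define F' where "F' t = trace (\<lambda>\<omega> \<psi>. poly_op (pderiv R) (J' t \<omega>) (\<Delta> \<omega> \<psi>))" for t
    have "\<bar>F' t\<bar> \<le> 2 * P * e" if t: "0 \<le> t" "t \<le> 1" for t
    proof -
      interpret t: ergodic_jacobi_family T M q "\<lambda>\<omega>. t * p \<omega>" Q "\<bar>t\<bar> * P" by (rule family_scaled)
      interpret d: ergodic_jacobi_family T M "\<lambda>_. 0" p 0 P by (rule family_hopping)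
      have le: "norm (poly_op (pderiv R) (J' t \<omega>) (\<Delta> \<omega> \<psi>)) \<le> 2 * P * e * norm \<psi>" for \<omega> \<psi>
      proof -
        have "norm (poly_op (pderiv R) (J' t \<omega>) (\<Delta> \<omega> \<psi>)) \<le> e * norm (\<Delta> \<omega> \<psi>)"
          by (rule symmetric_operator.norm_poly_op_le[OF t.symmetric_operator_jacobi], rule R(2),
              rule subsetD[OF spec[OF t]])
        also have "\<dots> \<le> e * (2 * P * norm \<psi>)"
          using d.norm_jacobi_le[of \<omega> \<psi>] \<open>e > 0\<close> by (intro mult_left_mono) auto
        finally show ?thesis by (simp add: mult_ac)
      qed
      have z: "covariant (\<lambda>_ _. 0)" using covariant_scaleR[of 0] by simp
      have X: "covariant (\<lambda>\<omega> \<psi>. poly_op (pderiv R) (J' t \<omega>) (\<Delta> \<omega> \<psi>))"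
        by (rule covariant_comp[OF t.covariant_poly_op d.covariant_jacobi])
      have "\<bar>trace (\<lambda>\<omega> \<psi>. poly_op (pderiv R) (J' t \<omega>) (\<Delta> \<omega> \<psi>)) - trace (\<lambda>_ _. 0) - 0 * trace (\<lambda>_ _. 0)\<bar> \<le> 2 * P * e"
        by (rule trace_increment_le[OF X z z]) (simp add: le)
      moreover have "trace (\<lambda>_ _. 0) = 0" by (simp add: trace_def)
      ultimately show ?thesis by (simp add: F'_def)
    qed
    then have "\<bar>F 1 - F 0\<bar> \<le> 2 * P * e * (1 - 0)"
      unfolding F_def F'_def
      by (intro increment_le_of_derivative_le[OF _ trace_poly_has_derivative]) simp_all
    then show ?thesis using FI[of 1] FI[of 0] by (simp add: distrib_right)
  qed
  have "\<bar>I 1 - I 0\<bar> \<le> 0"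
  proof (rule field_le_epsilon)
    fix e :: real assume "e > 0"
    have pos: "2 + 2 * P > 0" using P_nonneg by linarith
    have "\<bar>I 1 - I 0\<bar> \<le> (2 + 2 * P) * (e / (2 + 2 * P))" by (rule close) (use \<open>e > 0\<close> pos in simp)
    then show "\<bar>I 1 - I 0\<bar> \<le> 0 + e" using pos by simp
  qed
  then show ?thesis by (simp add: I_def)
qed

end

section \<open>Diagonal operators\<close>

text \<open>
  The basis vector \<open>\<delta>\<^sub>0\<close> is an eigenvector with eigenvalue \<open>q \<omega>\<close>, so \<open>\<langle>\<delta>\<^sub>0, h(J\<^sub>\<omega>) \<delta>\<^sub>0\<rangle> = h(q \<omega>)\<close>.
\<close>

lemma dos_measure_diagonal:
  assumes "ergodic_jacobi_family T M q (\<lambda>_. 0) Q 0"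
  shows "dos_measure T M q (\<lambda>_. 0) = distr M borel q"
proof -
  interpret ergodic_jacobi_family T M q "\<lambda>_. 0" Q 0 by (rule assms)
  have J\<delta>: "J \<omega> (ell2_delta 0) = q \<omega> *\<^sub>R ell2_delta 0" for \<omega>
    by (rule ell2_eqI) (simp add: nth_jacobi scaleR_conv_of_real)
  have poly: "poly_op R (J \<omega>) (ell2_delta 0) = poly R (q \<omega>) *\<^sub>R ell2_delta 0" for R \<omega>
    by (induction R)
      (simp_all add: poly_op_pCons[OF linear_jacobi] linear_scale[OF linear_jacobi] J\<delta> algebra_simps)
  have vacuum: "vacuum h \<omega> = h (q \<omega>)" if h: "continuous_on UNIV h" for h \<omega>
  proof -
    have "\<bar>vacuum h \<omega> - h (q \<omega>)\<bar> \<le> 0"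
    proof (rule field_le_epsilon)
      fix e :: real assume "e > 0"
      have "continuous_on {- Q..Q} h" by (rule continuous_on_subset[OF h]) auto
      then obtain R :: "real poly" where R: "\<And>x. x \<in> {- Q..Q} \<Longrightarrow> \<bar>poly R x - h x\<bar> < e / 2"
        using polynomial_approximation \<open>e > 0\<close> half_gt_zero by blast
      have "\<bar>Re (ell2_nth (poly_op R (J \<omega>) (ell2_delta 0)) 0) - vacuum h \<omega>\<bar> \<le> e / 2"
      proof (rule vacuum_diff_le[OF h])
        fix x assume "x \<in> real_spectrum (J \<omega>)"
        then have "x \<in> {- Q..Q}" using subsetD[OF real_spectrum_bounded] by simp
        then show "\<bar>poly R x - h x\<bar> \<le> e / 2" using R less_imp_le by blast
      qed
      moreover have "q \<omega> \<in> {- Q..Q}" using q_le[of \<omega>] unfolding atLeastAtMost_iff by linarith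
      from R[OF this] have "\<bar>poly R (q \<omega>) - h (q \<omega>)\<bar> < e / 2" .
      moreover have "Re (ell2_nth (poly_op R (J \<omega>) (ell2_delta 0)) 0) = poly R (q \<omega>)" by (simp add: poly)
      ultimately show "\<bar>vacuum h \<omega> - h (q \<omega>)\<bar> \<le> 0 + e" by linarith
    qed
    then show ?thesis by simp
  qed
  have qm: "q \<in> borel_measurable M" by (rule continuous_borel_measurable[OF cont_q])
  have "is_dos (distr M borel q)"
    unfolding is_dos_def
  proof (intro conjI allI impI)
    show "real_distribution (distr M borel q)" by (rule real_distribution_distr[OF qm])
    fix h :: "real \<Rightarrow> real" assume h: "continuous_on UNIV h"
    have hm: "h \<in> borel_measurable borel" by (rule borel_measurable_continuous_onI[OF h])
    have "continuous_on UNIV (\<lambda>\<omega>. h (q \<omega>))" by (rule continuous_on_compose2[OF h cont_q]) simp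
    then show "integrable (distr M borel q) h"
      by (subst integrable_distr_eq[OF qm hm]) (rule integrable_continuous)
    show "(\<integral>x. h x \<partial>distr M borel q) = spectral_mean h"
    proof -
      have "vacuum h = (\<lambda>\<omega>. h (q \<omega>))" by (rule ext) (rule vacuum[OF h])
      then show ?thesis by (simp add: spectral_mean_def integral_distr[OF qm hm])
    qed
  qed
  then show ?thesis by (rule dos_measure_eqI)
qed

lemma range_subset_as_spectrum_diagonal:
  assumes "ergodic_jacobi_family T M q (\<lambda>_. 0) Q 0"
  shows "range q \<subseteq> as_spectrum T M q (\<lambda>_. 0)"
proof
  interpret ergodic_jacobi_family T M q "\<lambda>_. 0" Q 0 by (rule assms)
  fix x assume "x \<in> range q"
  then obtain \<omega> where x: "x = q \<omega>" by blast
  interpret symmetric_operator "J \<omega>" by (rule symmetric_operator_jacobi)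
  have zero: "J \<omega> (ell2_delta 0) - x *\<^sub>R ell2_delta 0 = 0"
    by (rule ell2_eqI) (simp add: nth_jacobi scaleR_conv_of_real x)
  have "\<not> bounded_below (\<lambda>\<psi>. J \<omega> \<psi> - x *\<^sub>R \<psi>)"
  proof
    assume "bounded_below (\<lambda>\<psi>. J \<omega> \<psi> - x *\<^sub>R \<psi>)"
    then obtain c where "c > 0" "\<And>\<psi>. c * norm \<psi> \<le> norm (J \<omega> \<psi> - x *\<^sub>R \<psi>)"
      unfolding bounded_below_def by blast
    from this(1) this(2)[of "ell2_delta 0"] show False by (simp add: zero norm_ell2_delta)
  qed
  then show "x \<in> as_spectrum T M q (\<lambda>_. 0)"
    using real_notin_spec_iff[of x] real_spectrum_subset[of \<omega>] by blast
qed

section \<open>Gap labels of diagonal and Schroedinger operators\<close>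

context ergodic_jacobi_family
begin

text \<open>
  The density of states measure does not charge the complement of the spectrum, so the integrated
  density of states is constant on the component of the midpoint.  If that component were
  unbounded, the constant would be \<open>0\<close> or \<open>1\<close>.
\<close>

lemma has_open_gapI:
  assumes "a < b" and gap: "\<And>x. a < x \<Longrightarrow> x < b \<Longrightarrow> x \<notin> \<Sigma>"
    and l: "(\<integral>x. cts_step a b x \<partial>dos_measure T M q p) = l" "0 < l" "l < 1"
  shows "has_open_gap T M q p l"
proof -
  define \<kappa> where "\<kappa> = dos_measure T M q p"
  interpret \<kappa>: real_distribution \<kappa> unfolding \<kappa>_def by (rule real_distribution_dos)
  have ae: "AE x in \<kappa>. x \<in> \<Sigma>" unfolding \<kappa>_def by (rule AE_dos_in_spectrum)
  define c where "c = (a + b) / 2"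
  have c: "a < c" "c < b" using \<open>a < b\<close> by (auto simp: c_def)
  have measure_eq: "measure \<kappa> {..E} = measure \<kappa> {..E'}" if "\<And>x. min E E' < x \<Longrightarrow> x \<le> max E E' \<Longrightarrow> x \<notin> \<Sigma>" for E E'
  proof (rule measure_eq_AE)
    show "AE x in \<kappa>. x \<in> {..E} \<longleftrightarrow> x \<in> {..E'}"
      using ae
    proof eventually_elim
      case (elim x)
      then have "\<not> (min E E' < x \<and> x \<le> max E E')" using that by blast
      then show ?case by (auto simp: min_def max_def split: if_splits)
    qed
  qed auto
  have ids_c: "measure \<kappa> {..c} = l"
  proof -
    have "measure \<kappa> {..c} = (\<integral>x. indicator {..c} x \<partial>\<kappa>)" by simp
    also have "\<dots> = (\<integral>x. cts_step a b x \<partial>\<kappa>)"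
    proof (rule integral_cong_AE)
      show "cts_step a b \<in> borel_measurable \<kappa>"
        using borel_measurable_continuous_onI[OF continuous_on_cts_step[OF \<open>a < b\<close>]] by simp
      show "AE x in \<kappa>. indicator {..c} x = cts_step a b x"
        using ae
      proof eventually_elim
        case (elim x)
        then have "x \<le> a \<or> b \<le> x" using gap not_le by blast
        then show ?case using c by (auto simp: cts_step_def indicator_def)
      qed
    qed simp
    finally show ?thesis using l(1) by (simp add: \<kappa>_def)
  qed
  define I where "I = connected_component_set (- \<Sigma>) c"
  have cS: "c \<in> - \<Sigma>" using gap[OF c] by simp
  then have I: "I \<in> components (- \<Sigma>)" "c \<in> I"
    unfolding I_def by (auto simp: components_def)
  have sub: "I \<subseteq> - \<Sigma>" by (rule in_components_subset[OF I(1)])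
  have between: "{min c y..max c y} \<subseteq> - \<Sigma>" if "y \<in> I" for y
  proof -
    have "is_interval I" using in_components_connected[OF I(1)] by (simp add: is_interval_connected_1)
    moreover have "min c y \<in> I" "max c y \<in> I" using I(2) that by (simp_all add: min_def max_def)
    ultimately have "x \<in> I" if "x \<in> {min c y..max c y}" for x
      by (rule mem_is_interval_1_I) (use that in simp_all)
    then show ?thesis using sub by blast
  qed
  have label: "ids T M q p E = l" if "E \<in> I" for E
  proof -
    have "measure \<kappa> {..E} = measure \<kappa> {..c}"
    proof (rule measure_eq)
      fix x assume "min E c < x" "x \<le> max E c"
      then have "x \<in> {min c E..max c E}" by (simp add: min.commute max.commute)
      then show "x \<notin> \<Sigma>" using between[OF that] by blast
    qed
    then show ?thesis using ids_c by (simp add: ids_def \<kappa>_def)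
  qed
  have "\<exists>y\<in>\<Sigma>. y \<le> c"
  proof (rule ccontr)
    assume "\<not> ?thesis"
    then have above: "\<not> y \<le> c" if "y \<in> \<Sigma>" for y using that by blast
    have "AE x in \<kappa>. x \<in> {..c} \<longleftrightarrow> x \<in> {}" using ae by eventually_elim (simp add: above)
    then have "measure \<kappa> {..c} = measure \<kappa> {}" by (intro measure_eq_AE) auto
    then show False using ids_c l by simp
  qed
  then obtain y\<^sub>1 where y\<^sub>1: "y\<^sub>1 \<in> \<Sigma>" "y\<^sub>1 \<le> c" by blast
  have "\<exists>y\<in>\<Sigma>. c \<le> y"
  proof (rule ccontr)
    assume "\<not> ?thesis"
    then have below: "\<not> c \<le> y" if "y \<in> \<Sigma>" for y using that by blast
    have "AE x in \<kappa>. x \<in> {..c} \<longleftrightarrow> x \<in> UNIV"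
      using ae by eventually_elim (use below in \<open>simp add: less_imp_le not_le\<close>)
    then have "measure \<kappa> {..c} = measure \<kappa> UNIV" by (intro measure_eq_AE) auto
    then show False using ids_c l \<kappa>.prob_space by simp
  qed
  then obtain y\<^sub>2 where y\<^sub>2: "y\<^sub>2 \<in> \<Sigma>" "c \<le> y\<^sub>2" by blast
  have "I \<subseteq> {y\<^sub>1..y\<^sub>2}"
  proof
    fix y assume "y \<in> I"
    then have "y\<^sub>1 \<notin> {min c y..max c y}" "y\<^sub>2 \<notin> {min c y..max c y}"
      using subsetD[OF between] y\<^sub>1(1) y\<^sub>2(1) by blast+
    then show "y \<in> {y\<^sub>1..y\<^sub>2}" using y\<^sub>1(2) y\<^sub>2(2) by (auto simp: min_def max_def split: if_splits)
  qed
  then have "bounded I" by (rule bounded_subset[rotated]) simp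
  then show ?thesis
    unfolding has_open_gap_def by (intro bexI[OF _ I(1)] conjI ballI label)
qed

end

context ergodic_system
begin

lemma ergodic_jacobi_familyI:
  assumes "continuous_on UNIV q" "continuous_on UNIV p" "\<And>\<omega>. \<bar>q \<omega>\<bar> \<le> Q" "\<And>\<omega>. \<bar>p \<omega>\<bar> \<le> P"
  shows "ergodic_jacobi_family T M q p Q P"
  using assms continuous_T continuous_inv_T
  by unfold_locales auto

lemma diagonal_gap_gives_schroedinger_gap:
  assumes q: "q \<in> OG_diag T M l" and l: "0 < l" "l < 1"
  shows "\<exists>q'. q' \<in> OG_Schr T M l"
proof -
  have cq: "continuous_on UNIV q" and "has_open_gap T M q (\<lambda>_. 0) l"
    using q by (auto simp: OG_diag_def OG_Jacobi_def)
  then obtain I where I: "I \<in> components (- as_spectrum T M q (\<lambda>_. 0))" "\<And>E. E \<in> I \<Longrightarrow> ids T M q (\<lambda>_. 0) E = l"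
    by (auto simp: has_open_gap_def)
  obtain Q where Q: "\<And>\<omega>. \<bar>q \<omega>\<bar> \<le> Q" using continuous_bounded[OF cq] by blast
  have diag: "ergodic_jacobi_family T M q (\<lambda>_. 0) Q 0"
    by (rule ergodic_jacobi_familyI) (use cq Q in auto)
  interpret d: ergodic_jacobi_family T M q "\<lambda>_. 0" Q 0 by (rule diag)
  obtain E where "E \<in> I" using in_components_nonempty[OF I(1)] by blast
  have "open I"
    by (rule open_components[OF _ I(1)]) (use compact_imp_closed[OF d.as_spectrum_props(1)] in \<open>simp add: open_Compl\<close>)
  then obtain \<delta> where \<delta>: "\<delta> > 0" "ball E \<delta> \<subseteq> I" using \<open>E \<in> I\<close> open_contains_ball by blast
  have far: "\<delta> \<le> \<bar>q \<omega> - E\<bar>" for \<omega>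
  proof (rule ccontr)
    assume "\<not> ?thesis"
    then have "q \<omega> \<in> ball E \<delta>" by (simp add: dist_real_def abs_minus_commute)
    then show False
      using \<delta>(2) in_components_subset[OF I(1)] range_subset_as_spectrum_diagonal[OF diag] by blast
  qed
  have qm: "q \<in> borel_measurable M" by (rule continuous_borel_measurable[OF cq])
  have label: "measure M {\<omega>. q \<omega> \<le> E} = l"
    using I(2)[OF \<open>E \<in> I\<close>]
    by (simp add: ids_def dos_measure_diagonal[OF diag] measure_distr[OF qm] vimage_def space_M)
  \<comment> \<open>The scaled potential has distance at least \<open>4\<close> from \<open>c E\<close>, hence at least \<open>3\<close> from every point of
      \<open>(c E - 1, c E + 1)\<close>, which exceeds the norm \<open>2\<close> of the hopping part.\<close>
  define c where "c = 4 / \<delta>"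
  have "c > 0" using \<delta>(1) by (simp add: c_def)
  define q' where "q' \<omega> = c * q \<omega>" for \<omega>
  have cq': "continuous_on UNIV q'" unfolding q'_def[abs_def] by (intro continuous_intros cq)
  have Q': "\<bar>q' \<omega>\<bar> \<le> c * Q" for \<omega>
    using Q[of \<omega>] \<open>c > 0\<close> by (simp add: q'_def abs_mult)
  have far': "4 \<le> \<bar>q' \<omega> - c * E\<bar>" for \<omega>
  proof -
    have "c * \<delta> \<le> c * \<bar>q \<omega> - E\<bar>" using far \<open>c > 0\<close> by (intro mult_left_mono) auto
    also have "\<dots> = \<bar>q' \<omega> - c * E\<bar>"
      using \<open>c > 0\<close> by (simp add: q'_def abs_mult flip: right_diff_distrib)
    finally show ?thesis using \<delta>(1) by (simp add: c_def)
  qed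
  interpret s: ergodic_jacobi_family T M q' "\<lambda>_. 1" "c * Q" 1
    by (rule ergodic_jacobi_familyI) (use cq' Q' in auto)
  define a where "a = c * E - 1"
  define b where "b = c * E + 1"
  have "a < b" by (simp add: a_def b_def)
  have gap: "x \<notin> real_spectrum (jacobi T q' (\<lambda>\<omega>. t * 1) \<omega>)" if "0 \<le> t" "t \<le> 1" "a < x" "x < b" for t \<omega> x
  proof -
    interpret t: ergodic_jacobi_family T M q' "\<lambda>\<omega>. t * 1" "c * Q" 1
      by (rule ergodic_jacobi_familyI) (use cq' Q' that in auto)
    have "3 \<le> \<bar>q' \<eta> - x\<bar>" for \<eta> using far'[of \<eta>] that(3,4) unfolding a_def b_def by linarith
    then show ?thesis by (intro t.notin_real_spectrum[of 3]) simp_all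
  qed
  have "(\<integral>x. cts_step a b x \<partial>dos_measure T M q' (\<lambda>_. 1)) = (\<integral>x. cts_step a b x \<partial>dos_measure T M q' (\<lambda>_. 0))"
    by (rule s.gap_integral_invariant[OF \<open>a < b\<close>]) (rule gap)
  also have "\<dots> = (\<integral>\<omega>. cts_step a b (q' \<omega>) \<partial>M)"
  proof -
    have diag': "ergodic_jacobi_family T M q' (\<lambda>_. 0) (c * Q) 0"
      by (rule ergodic_jacobi_familyI) (use cq' Q' in auto)
    show ?thesis
      unfolding dos_measure_diagonal[OF diag']
      by (rule integral_distr[OF continuous_borel_measurable[OF cq']
            borel_measurable_continuous_onI[OF continuous_on_cts_step[OF \<open>a < b\<close>]]])
  qed
  also have "\<dots> = (\<integral>\<omega>. indicator {\<omega>. q \<omega> \<le> E} \<omega> \<partial>M)"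
  proof (rule Bochner_Integration.integral_cong[OF refl])
    fix \<omega>
    show "cts_step a b (q' \<omega>) = indicator {\<omega>. q \<omega> \<le> E} \<omega>"
    proof (cases "q \<omega> \<le> E")
      case True
      then have "q' \<omega> \<le> c * E" using \<open>c > 0\<close> by (simp add: q'_def)
      then have "q' \<omega> \<le> a" using far'[of \<omega>] by (simp add: a_def)
      then show ?thesis using True by (simp add: cts_step_def)
    next
      case False
      then have "c * E \<le> q' \<omega>" using \<open>c > 0\<close> by (simp add: q'_def)
      then have "b \<le> q' \<omega>" using far'[of \<omega>] by (simp add: b_def)
      then show ?thesis using False \<open>a < b\<close> by (simp add: cts_step_def)
    qed
  qed
  also have "\<dots> = l" using label by (simp add: space_M)
  finally have mean: "(\<integral>x. cts_step a b x \<partial>dos_measure T M q' (\<lambda>_. 1)) = l" .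
  obtain \<omega>0 where \<omega>0: "real_spectrum (jacobi T q' (\<lambda>_. 1) \<omega>0) = as_spectrum T M q' (\<lambda>_. 1)"
    using eventually_happens'[OF ae_filter_bot s.AE_real_spectrum] by blast
  have "has_open_gap T M q' (\<lambda>_. 1) l"
  proof (rule s.has_open_gapI[OF \<open>a < b\<close> _ mean l])
    show "x \<notin> as_spectrum T M q' (\<lambda>_. 1)" if "a < x" "x < b" for x
      using gap[of 1 x \<omega>0] that \<omega>0 by simp
  qed
  then have "q' \<in> OG_Schr T M l" using cq' by (simp add: OG_Schr_def OG_Jacobi_def)
  then show ?thesis by blast
qed

end

theorem theorem1p8:
  fixes T :: "'a::metric_space \<Rightarrow> 'a" and \<mu> :: "'a measure"
  assumes "compact (UNIV :: 'a set)"
    and "homeomorphism UNIV UNIV T (inv T)"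
    and "ergodic_prob T \<mu>"
    and "measure_support \<mu> = UNIV"
  shows "DL T \<mu> \<subseteq> SL T \<mu> \<and> SL T \<mu> \<subseteq> JL T \<mu> \<and> JL T \<mu> \<subseteq> schwartzman_group0 T \<mu>"
proof (intro conjI)
  interpret ergodic_system T \<mu> by (rule ergodic_system.intro[OF assms])
  show "DL T \<mu> \<subseteq> SL T \<mu>"
  proof
    fix l assume "l \<in> DL T \<mu>"
    then obtain q where "l \<in> schwartzman_group0 T \<mu>" "q \<in> OG_diag T \<mu> l" by (auto simp: DL_def)
    moreover from this(1) have "0 < l" "l < 1" by (auto simp: schwartzman_group0_def)
    ultimately show "l \<in> SL T \<mu>" using diagonal_gap_gives_schroedinger_gap by (auto simp: SL_def)
  qed
  show "SL T \<mu> \<subseteq> JL T \<mu>" by (auto simp: SL_def JL_def OG_Schr_def)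
  show "JL T \<mu> \<subseteq> schwartzman_group0 T \<mu>" by (auto simp: JL_def)
qed

end
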